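(* Let $\rho(t,x)$ be an accumulation point of $\{\rho^\varepsilon\}_{\varepsilon>0}$ as $\varepsilon\to0$, that is, there is a sequence $\varepsilon_k\to0$ such that $\rho^{\varepsilon_k}\to\rho$ strongly in $L^p(0,T;W^{-1,1}(\Omega))$ (for some $p\in[1,\infty)$ and every $T>0$). Then $$0\le\rho(t,x)\le1\quad\text{a.e. in }(0,\infty)\times\Omega,$$ and $$\partial_t\rho\ge0\quad\text{in the sense of distributions.}$$
   Context: $W^{-1,1}(\Omega)$ is the space of distributions $f_0+\partial_xf_1$ with $f_0,f_1\in L^1(\Omega)$, with the usual (infimum) norm. Let $\Omega\subset\mathbb R$ be a bounded open interval, $n\in(0,3)$, and $u_{in}\in H^1(\Omega)$ with $u_{in}\ge 0$, $\int_\Omega u_{in}\,dx=1$. For $\varepsilon\in(0,1/2]$ the thin film problem is $|\ln\varepsilon|^{-1}\partial_t u+\partial_x\big((\varepsilon^{3-n}u^n+u^3)\partial_{xxx}u\big)=0$ in $(0,\infty)\times\Omega$, with $(\varepsilon^{3-n}u^n+u^3)u_{xxx}=0$ and $u_x=0$ on $(0,\infty)\times\partial\Omega$, and $u(0,\cdot)=u_{in}$. (Weak form: $|\ln\varepsilon|^{-1}\big(\int_0^\infty\!\int_\Omega u\psi_t+\int_\Omega u_{in}\psi(0,\cdot)\big)+\iint_{\{u>0\}}(\varepsilon^{3-n}u^n+u^3)u_{xxx}\psi_x=0$ for all $\psi\in C_c^\infty([0,\infty)\times\overline\Omega)$.) Let $B(s)=\int_0^s\int_r^\infty\frac{1}{v^{n-1}+v^2}\,dv\,dr$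 and $B^\varepsilon(s)=|\ln\varepsilon|^{-1}B(s/\varepsilon)$. For each $\varepsilon$, $u^\varepsilon$ denotes a fixed continuous non-negative weak solution such that, with $\rho^\varepsilon:=B^\varepsilon(u^\varepsilon)$, for every $T>0$: (i) $u^\varepsilon\in L^\infty((0,T);H^1(\Omega))$, $u^\varepsilon u^\varepsilon_{xxx}\in L^2((0,T)\times\Omega)$; (ii) $\int_\Omega u^\varepsilon(t)\,dx=\int_\Omega u_{in}\,dx$ for all $t>0$; (iii) $\frac12\int_\Omega|u^\varepsilon_x(t)|^2dx+\int_0^t\int_{\{u^\varepsilon>0\}}|\ln\varepsilon|(\varepsilon^{3-n}(u^\varepsilon)^n+(u^\varepsilon)^3)|u^\varepsilon_{xxx}|^2dx\,ds\le\frac12\int_\Omega|\partial_xu_{in}|^2dx$ for all $t>0$; (iv) $\int_\Omega\rho^\varepsilon(t)\,dx\ge\int_0^t\int_\Omega u^\varepsilon|u^\varepsilon_{xx}|^2dx\,ds+\int_\Omega\rho^\varepsilon(0)\,dx$ for all $t>0$ (with $u^\varepsilon|u^\varepsilon_{xx}|^2:=0$ on $\{u^\varepsilon=0\}$); (v) $u^\varepsilon\in L^2((0,T);H^2(\Omega))$ if $n<2$, and $(u^\varepsilon)^{3/2}\in L^2((0,T);H^2(\Omega))$, $((u^\varepsilon)^{3/4})_x\in L^4((0,T)\times\Omega)$ if $n\ge2$; for a.e. $t$, $u^\varepsilon(t,\cdot)\in C^1(\overline\Omega)$ with $u^\varepsilon_x=0$ on $\partial\Omega$; (vi) $\partial_t\rho^\varepsilon=T^\varepsilon+\partial_xR^\varepsilon$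 in the sense of distributions, where $T^\varepsilon=-u^\varepsilon_x\,u^\varepsilon u^\varepsilon_{xxx}\in L^2((0,T);L^1(\Omega))$, $R^\varepsilon=-|\ln\varepsilon|(B^\varepsilon)'(u^\varepsilon)(\varepsilon^{3-n}(u^\varepsilon)^{n-1}+(u^\varepsilon)^2)u^\varepsilon u^\varepsilon_{xxx}$, and for a.e. $t$ and all $\varphi\in C^\infty(\overline\Omega)$, $\langle T^\varepsilon(t),\varphi\rangle=\int_\Omega u^\varepsilon(u^\varepsilon_{xx})^2\varphi\,dx-\frac56\int_\Omega(u^\varepsilon_x)^3\varphi'\,dx-\frac12\int_\Omega u^\varepsilon(u^\varepsilon_x)^2\varphi''\,dx$. *)

theory Defs
  imports "HOL-Analysis.Analysis"
begin

definition pd :: "'a::euclidean_space \<Rightarrow> ('a \<Rightarrow> real) \<Rightarrow> 'a \<Rightarrow> real" where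
  "pd v f p = frechet_derivative f (at p) v"

primrec cont_diff :: "nat \<Rightarrow> ('a::euclidean_space \<Rightarrow> real) \<Rightarrow> bool" where
  "cont_diff 0 f \<longleftrightarrow> continuous_on UNIV f"
| "cont_diff (Suc k) f \<longleftrightarrow> (\<forall>p. f differentiable (at p)) \<and> (\<forall>v\<in>Basis. cont_diff k (pd v f))"

definition smooth :: "('a::euclidean_space \<Rightarrow> real) \<Rightarrow> bool" where
  "smooth f \<longleftrightarrow> (\<forall>k. cont_diff k f)"

definition test_fun :: "'a::euclidean_space set \<Rightarrow> ('a \<Rightarrow> real) \<Rightarrow> bool" where
  "test_fun U \<phi> \<longleftrightarrow> smooth \<phi> \<and> compact (closure {p. \<phi> p \<noteq> 0}) \<and> closure {p. \<phi> p \<noteq> 0} \<subseteq> U"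

definition loc_integrable :: "'a::euclidean_space set \<Rightarrow> ('a \<Rightarrow> real) \<Rightarrow> bool" where
  "loc_integrable U f \<longleftrightarrow> (\<forall>K. compact K \<and> K \<subseteq> U \<longrightarrow> set_integrable lborel K f)"

text \<open>\<open>g\<close> is the distributional derivative of \<open>f\<close> in direction \<open>v\<close> on the open set \<open>U\<close>.\<close>
definition weak_deriv ::
  "'a::euclidean_space set \<Rightarrow> 'a \<Rightarrow> ('a \<Rightarrow> real) \<Rightarrow> ('a \<Rightarrow> real) \<Rightarrow> bool" where
  "weak_deriv U v f g \<longleftrightarrow> loc_integrable U f \<and> loc_integrable U g \<and>
     (\<forall>\<phi>. test_fun U \<phi> \<longrightarrow> (LBINT p:U. f p * pd v \<phi> p) = - (LBINT p:U. g p * \<phi> p))"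

definition Lp :: "nat \<Rightarrow> 'a::euclidean_space set \<Rightarrow> ('a \<Rightarrow> real) \<Rightarrow> bool" where
  "Lp q U f \<longleftrightarrow> set_borel_measurable lborel U f \<and> set_integrable lborel U (\<lambda>p. \<bar>f p\<bar> ^ q)"

text \<open>\<open>f\<close> belongs to \<open>H\<^sup>1(U)\<close>, with weak derivative \<open>g\<close>.\<close>
definition H1 :: "real set \<Rightarrow> (real \<Rightarrow> real) \<Rightarrow> (real \<Rightarrow> real) \<Rightarrow> bool" where
  "H1 U f g \<longleftrightarrow> Lp 2 U f \<and> Lp 2 U g \<and> weak_deriv U 1 f g"

text \<open>Points of space-time are pairs \<open>(t, x)\<close>, so \<open>(1, 0)\<close> is the time direction and
  \<open>(0, 1)\<close> the space direction.\<close>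

definition L2_H2 :: "(real \<times> real) set \<Rightarrow> (real \<times> real \<Rightarrow> real) \<Rightarrow> bool" where
  "L2_H2 Q f \<longleftrightarrow> (\<exists>fx fxx. Lp 2 Q f \<and> Lp 2 Q fx \<and> Lp 2 Q fxx \<and>
     weak_deriv Q (0, 1) f fx \<and> weak_deriv Q (0, 1) fx fxx)"

text \<open>Distributions are functionals; only their values on test functions on \<open>U\<close> matter.\<close>
type_synonym distr = "(real \<Rightarrow> real) \<Rightarrow> real"

definition Wm11_rep :: "real set \<Rightarrow> distr \<Rightarrow> (real \<Rightarrow> real) \<Rightarrow> (real \<Rightarrow> real) \<Rightarrow> bool" where
  "Wm11_rep U F f0 f1 \<longleftrightarrow> set_integrable lborel U f0 \<and> set_integrable lborel U f1 \<and>
     (\<forall>\<phi>. test_fun U \<phi> \<longrightarrow> F \<phi> = (LBINT x:U. f0 x * \<phi> x) - (LBINT x:U. f1 x * deriv \<phi> x))"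

definition Wm11 :: "real set \<Rightarrow> distr set" where
  "Wm11 U = {F. \<exists>f0 f1. Wm11_rep U F f0 f1}"

definition Wm11_norm :: "real set \<Rightarrow> distr \<Rightarrow> real" where
  "Wm11_norm U F = Inf {(LBINT x:U. \<bar>f0 x\<bar>) + (LBINT x:U. \<bar>f1 x\<bar>) | f0 f1. Wm11_rep U F f0 f1}"

text \<open>\<open>Wm11_norm\<close> is an infimum of a nonempty set only on \<open>Wm11\<close>; hence the membership conditions
  below. Measurability is that of Bochner: a.e. norm limits of simple functions.\<close>
definition Wm11_simple :: "real set \<Rightarrow> real \<Rightarrow> (real \<Rightarrow> distr) \<Rightarrow> bool" where
  "Wm11_simple U T s \<longleftrightarrow> finite (s ` {0<..<T}) \<and> s ` {0<..<T} \<subseteq> Wm11 U \<and>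
     (\<forall>F. {t \<in> {0<..<T}. s t = F} \<in> sets lborel)"

definition Wm11_strongly_measurable :: "real set \<Rightarrow> real \<Rightarrow> (real \<Rightarrow> distr) \<Rightarrow> bool" where
  "Wm11_strongly_measurable U T G \<longleftrightarrow>
     (\<exists>s. (\<forall>j::nat. Wm11_simple U T (s j)) \<and>
       (AE t in lborel. t \<in> {0<..<T} \<longrightarrow>
          (\<lambda>j. Wm11_norm U (\<lambda>\<phi>. s j t \<phi> - G t \<phi>)) \<longlonglongrightarrow> 0))"

definition Lp_Wm11 :: "real \<Rightarrow> real set \<Rightarrow> real \<Rightarrow> (real \<Rightarrow> distr) \<Rightarrow> bool" where
  "Lp_Wm11 p U T G \<longleftrightarrow>
     (AE t in lborel. t \<in> {0<..<T} \<longrightarrow> G t \<in> Wm11 U) \<and>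
     Wm11_strongly_measurable U T G \<and>
     (\<integral>\<^sup>+ t\<in>{0<..<T}. ennreal (Wm11_norm U (G t) powr p) \<partial>lborel) < \<infinity>"

definition tendsto_Lp_Wm11 ::
  "real \<Rightarrow> real set \<Rightarrow> real \<Rightarrow> (nat \<Rightarrow> real \<Rightarrow> distr) \<Rightarrow> (real \<Rightarrow> distr) \<Rightarrow> bool" where
  "tendsto_Lp_Wm11 p U T G G' \<longleftrightarrow>
     (\<forall>k. Lp_Wm11 p U T (G k)) \<and> Lp_Wm11 p U T G' \<and>
     (\<lambda>k. \<integral>\<^sup>+ t\<in>{0<..<T}. ennreal (Wm11_norm U (\<lambda>\<phi>. G k t \<phi> - G' t \<phi>) powr p) \<partial>lborel)
       \<longlonglongrightarrow> 0"

definition distr_of :: "real set \<Rightarrow> (real \<times> real \<Rightarrow> real) \<Rightarrow> real \<Rightarrow> distr" where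
  "distr_of U r t = (\<lambda>\<phi>. LBINT x:U. r (t, x) * \<phi> x)"

definition Bfun :: "real \<Rightarrow> real \<Rightarrow> real" where
  "Bfun n s = (LBINT r:{0<..<s}. (LBINT v:{r<..}. 1 / (v powr (n - 1) + v\<^sup>2)))"

definition Beps :: "real \<Rightarrow> real \<Rightarrow> real \<Rightarrow> real" where
  "Beps n \<epsilon> s = Bfun n (s / \<epsilon>) / \<bar>ln \<epsilon>\<bar>"

definition rho_eps :: "real \<Rightarrow> real \<Rightarrow> (real \<times> real \<Rightarrow> real) \<Rightarrow> real \<times> real \<Rightarrow> real" where
  "rho_eps n \<epsilon> u p = Beps n \<epsilon> (u p)"

definition mobility :: "real \<Rightarrow> real \<Rightarrow> real \<Rightarrow> real" where
  "mobility n \<epsilon> s = \<epsilon> powr (3 - n) * s powr n + s ^ 3"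

definition positivity_set :: "real \<Rightarrow> real \<Rightarrow> (real \<times> real \<Rightarrow> real) \<Rightarrow> (real \<times> real) set" where
  "positivity_set a b u = {p. fst p > 0 \<and> snd p \<in> {a<..<b} \<and> u p > 0}"

text \<open>The test functions in \<open>C\<^sub>c\<^sup>\<infinity>([0,\<infinity>) \<times> [a,b])\<close> are the restrictions of those on the plane. The
  flux condition on the lateral boundary is the natural boundary condition of the weak form.\<close>
definition weak_form ::
  "real \<Rightarrow> real \<Rightarrow> real \<Rightarrow> (real \<Rightarrow> real) \<Rightarrow> real \<Rightarrow>
    (real \<times> real \<Rightarrow> real) \<Rightarrow> (real \<times> real \<Rightarrow> real) \<Rightarrow> bool" where
  "weak_form a b n uin \<epsilon> u uxxx \<longleftrightarrow>
    (\<forall>\<psi>. test_fun UNIV \<psi> \<longrightarrow>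
      ((LBINT p:{0<..} \<times> {a<..<b}. u p * pd (1, 0) \<psi> p)
          + (LBINT x:{a<..<b}. uin x * \<psi> (0, x))) / \<bar>ln \<epsilon>\<bar>
        + (LBINT p:positivity_set a b u. mobility n \<epsilon> (u p) * uxxx p * pd (0, 1) \<psi> p) = 0)"

text \<open>\<open>T\<^sup>\<epsilon>\<close> and \<open>R\<^sup>\<epsilon>\<close>, with the convention that \<open>u u\<^sub>x\<^sub>x\<^sub>x\<close> vanishes where \<open>u\<close> does.\<close>

definition Teps ::
  "real \<Rightarrow> real \<Rightarrow> (real \<times> real \<Rightarrow> real) \<Rightarrow> (real \<times> real \<Rightarrow> real) \<Rightarrow> (real \<times> real \<Rightarrow> real) \<Rightarrow>
    real \<times> real \<Rightarrow> real" where
  "Teps a b u ux uxxx p =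
    (if p \<in> positivity_set a b u then - ux p * (u p * uxxx p) else 0)"

definition Reps ::
  "real \<Rightarrow> real \<Rightarrow> real \<Rightarrow> real \<Rightarrow> (real \<times> real \<Rightarrow> real) \<Rightarrow> (real \<times> real \<Rightarrow> real) \<Rightarrow>
    real \<times> real \<Rightarrow> real" where
  "Reps a b n \<epsilon> u uxxx p =
    (if p \<in> positivity_set a b u
     then - \<bar>ln \<epsilon>\<bar> * deriv (Beps n \<epsilon>) (u p)
            * (\<epsilon> powr (3 - n) * u p powr (n - 1) + (u p)\<^sup>2) * (u p * uxxx p)
     else 0)"

text \<open>The class of weak solutions, with \<open>u\<^sub>x\<close> defined on all of space-time and \<open>u\<^sub>x\<^sub>x\<close>, \<open>u\<^sub>x\<^sub>x\<^sub>x\<close>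
  only (as distributional derivatives) on the open set where \<open>u\<close> is positive. Inequalities between integrals of nonnegative
  functions are stated in the extended nonnegative reals, so finiteness is part of them.\<close>
definition thin_film_solution ::
  "real \<Rightarrow> real \<Rightarrow> real \<Rightarrow> (real \<Rightarrow> real) \<Rightarrow> (real \<Rightarrow> real) \<Rightarrow> real \<Rightarrow> (real \<times> real \<Rightarrow> real) \<Rightarrow> bool"
where
  "thin_film_solution a b n uin uin_x \<epsilon> u \<longleftrightarrow>
    (let \<Omega> = {a<..<b}; P = positivity_set a b u; L = \<bar>ln \<epsilon>\<bar>; \<rho> = rho_eps n \<epsilon> u in
     \<exists>ux uxx uxxx.
      continuous_on ({0..} \<times> {a..b}) u \<and> (\<forall>p \<in> {0..} \<times> {a..b}. 0 \<le> u p) \<and>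
      (AE x in lborel. x \<in> \<Omega> \<longrightarrow> u (0, x) = uin x) \<and>
      set_borel_measurable lborel ({0<..} \<times> \<Omega>) ux \<and>
      (\<forall>t>0. H1 \<Omega> (\<lambda>x. u (t, x)) (\<lambda>x. ux (t, x))) \<and>
      weak_deriv P (0, 1) ux uxx \<and> weak_deriv P (0, 1) uxx uxxx \<and>
      weak_form a b n uin \<epsilon> u uxxx \<and>
      (\<forall>T>0. \<exists>C. AE t in lborel. t \<in> {0<..<T} \<longrightarrow>
         (LBINT x:\<Omega>. (u (t, x))\<^sup>2) + (LBINT x:\<Omega>. (ux (t, x))\<^sup>2) \<le> C) \<and>
      (\<forall>T>0. Lp 2 (P \<inter> {0<..<T} \<times> \<Omega>) (\<lambda>p. u p * uxxx p)) \<and>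
      (\<forall>t>0. (LBINT x:\<Omega>. u (t, x)) = (LBINT x:\<Omega>. uin x)) \<and>
      (\<forall>t>0. (\<integral>\<^sup>+ x\<in>\<Omega>. ennreal ((ux (t, x))\<^sup>2 / 2) \<partial>lborel)
          + (\<integral>\<^sup>+ p\<in>P \<inter> {0<..<t} \<times> \<Omega>. ennreal (L * mobility n \<epsilon> (u p) * (uxxx p)\<^sup>2) \<partial>lborel)
         \<le> (\<integral>\<^sup>+ x\<in>\<Omega>. ennreal ((uin_x x)\<^sup>2 / 2) \<partial>lborel)) \<and>
      (\<forall>t>0. (\<integral>\<^sup>+ x\<in>\<Omega>. ennreal (\<rho> (t, x)) \<partial>lborel)
         \<ge> (\<integral>\<^sup>+ p\<in>P \<inter> {0<..<t} \<times> \<Omega>. ennreal (u p * (uxx p)\<^sup>2) \<partial>lborel)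
            + (\<integral>\<^sup>+ x\<in>\<Omega>. ennreal (\<rho> (0, x)) \<partial>lborel)) \<and>
      (n < 2 \<longrightarrow> (\<forall>T>0. L2_H2 ({0<..<T} \<times> \<Omega>) u)) \<and>
      (n \<ge> 2 \<longrightarrow> (\<forall>T>0. L2_H2 ({0<..<T} \<times> \<Omega>) (\<lambda>p. u p powr (3/2)) \<and>
         (\<exists>g. weak_deriv ({0<..<T} \<times> \<Omega>) (0, 1) (\<lambda>p. u p powr (3/4)) g \<and>
              Lp 4 ({0<..<T} \<times> \<Omega>) g))) \<and>
      (AE t in lborel. 0 < t \<longrightarrow>
         (\<exists>d. continuous_on {a..b} d \<and> d a = 0 \<and> d b = 0 \<and>
           (\<forall>x\<in>{a..b}. ((\<lambda>y. u (t, y)) has_real_derivative d x) (at x within {a..b})))) \<and>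
      (\<forall>T>0. (\<integral>\<^sup>+ t\<in>{0<..<T}.
          (\<integral>\<^sup>+ x\<in>\<Omega>. ennreal \<bar>Teps a b u ux uxxx (t, x)\<bar> \<partial>lborel)\<^sup>2 \<partial>lborel) < \<infinity>) \<and>
      (\<forall>\<phi>. test_fun ({0<..} \<times> \<Omega>) \<phi> \<longrightarrow>
         - (LBINT p:{0<..} \<times> \<Omega>. \<rho> p * pd (1, 0) \<phi> p)
         = (LBINT p:{0<..} \<times> \<Omega>. Teps a b u ux uxxx p * \<phi> p)
           - (LBINT p:{0<..} \<times> \<Omega>. Reps a b n \<epsilon> u uxxx p * pd (0, 1) \<phi> p)) \<and>
      (AE t in lborel. 0 < t \<longrightarrow> (\<forall>\<phi>. smooth \<phi> \<longrightarrow>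
         (LBINT x:\<Omega>. Teps a b u ux uxxx (t, x) * \<phi> x)
         = (LBINT x:{x. (t, x) \<in> P}. u (t, x) * (uxx (t, x))\<^sup>2 * \<phi> x)
           - 5 / 6 * (LBINT x:\<Omega>. (ux (t, x)) ^ 3 * deriv \<phi> x)
           - 1 / 2 * (LBINT x:\<Omega>. u (t, x) * (ux (t, x))\<^sup>2 * (deriv ^^ 2) \<phi> x))))"

end

theory Submission
  imports Defs
begin

text \<open>
  Since \<open>B(s)\<close> grows like \<open>ln s\<close>, a uniform bound on \<open>u\<^sup>\<epsilon>\<close> gives \<open>0 \<le> \<rho>\<^sup>\<epsilon> \<le> 1 + O(1 / \<bar>ln \<epsilon>\<bar>)\<close>,
  whence \<open>0 \<le> \<rho> \<le> 1\<close>. For the monotonicity in time, the energy estimate makes \<open>R\<^sup>\<epsilon>\<close> vanish in the limit,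
  and also the part of \<open>T\<^sup>\<epsilon> = - u\<^sub>x u u\<^sub>x\<^sub>x\<^sub>x\<close> that remains after replacing the factor \<open>u\<close> by the concave
  truncation \<open>m(u) = \<delta> u / (u + \<delta>) \<le> \<delta>\<close>. For a nonnegative test function, on almost every time slice and
  every component of \<open>{u > 0}\<close>, integration by parts gives
  \<open>- \<integral> \<phi> m(u) u\<^sub>x u\<^sub>x\<^sub>x\<^sub>x = \<integral> \<phi> m(u) u\<^sub>x\<^sub>x\<^sup>2 - 1/3 \<integral> \<phi> m''(u) u\<^sub>x\<^sup>4 + 5/3 \<integral> \<phi>' m(u) u\<^sub>x u\<^sub>x\<^sub>x + 1/3 \<integral> \<phi>'' m(u) u\<^sub>x\<^sup>2\<close>:
  the first two terms are nonnegative by concavity of \<open>m\<close>, the last two are \<open>O(\<surd>\<delta>)\<close> by the energy and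
  entropy estimates. With \<open>\<delta> = \<bar>ln \<epsilon>\<bar>\<^sup>-\<^sup>1\<^sup>/\<^sup>2\<close> all errors are \<open>O(\<bar>ln \<epsilon>\<bar>\<^sup>-\<^sup>1\<^sup>/\<^sup>4)\<close>. The density of the limit is
  an almost everywhere limit of convex combinations of tails of the sequence \<open>\<rho>\<^sup>\<epsilon>\<close>.
\<close>

subsection \<open>Smooth functions and bumps\<close>

lemma pd_eqI: "(f has_derivative D) (at p) \<Longrightarrow> pd v f p = D v"
  unfolding pd_def by (metis frechet_derivative_at)

lemma cont_diff_continuous: "cont_diff k f \<Longrightarrow> continuous_on UNIV f"
  by (cases k) (auto intro!: differentiable_imp_continuous_on simp: differentiable_on_def)

lemma cont_diff_Suc: "cont_diff (Suc k) f \<Longrightarrow> cont_diff k f"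
proof (induction k arbitrary: f)
  case 0
  then show ?case by (metis cont_diff_continuous cont_diff.simps(1))
next
  case (Suc k)
  then show ?case by (metis cont_diff.simps(2))
qed

lemma cont_diff_const: "cont_diff k (\<lambda>_. c)"
proof (induction k arbitrary: c)
  case (Suc k)
  have "pd v (\<lambda>_. c) = (\<lambda>_. 0)" for v :: 'a
    using pd_eqI[OF has_derivative_const] by fastforce
  then show ?case by (simp add: Suc)
qed simp

lemma cont_diff_add: "cont_diff k f \<Longrightarrow> cont_diff k g \<Longrightarrow> cont_diff k (\<lambda>x. f x + g x)"
proof (induction k arbitrary: f g)
  case (Suc k)
  have "pd v (\<lambda>x. f x + g x) = (\<lambda>x. pd v f x + pd v g x)" for v
  proof
    fix p
    have "(f has_derivative frechet_derivative f (at p)) (at p)"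
         "(g has_derivative frechet_derivative g (at p)) (at p)"
      using Suc.prems by (auto simp: frechet_derivative_works)
    from pd_eqI[OF has_derivative_add[OF this]]
    show "pd v (\<lambda>x. f x + g x) p = pd v f p + pd v g p" by (simp add: pd_def)
  qed
  then show ?case using Suc by simp
qed (auto intro: continuous_intros)

lemma cont_diff_mult: "cont_diff k f \<Longrightarrow> cont_diff k g \<Longrightarrow> cont_diff k (\<lambda>x. f x * g x)"
proof (induction k arbitrary: f g)
  case (Suc k)
  have "pd v (\<lambda>x. f x * g x) = (\<lambda>x. f x * pd v g x + pd v f x * g x)" for v
  proof
    fix p
    have "(f has_derivative frechet_derivative f (at p)) (at p)"
         "(g has_derivative frechet_derivative g (at p)) (at p)"
      using Suc.prems by (auto simp: frechet_derivative_works)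
    from pd_eqI[OF has_derivative_mult[OF this]]
    show "pd v (\<lambda>x. f x * g x) p = f p * pd v g p + pd v f p * g p" by (simp add: pd_def)
  qed
  then show ?case using Suc cont_diff_Suc[OF Suc.prems(1)] cont_diff_Suc[OF Suc.prems(2)]
    by (simp add: cont_diff_add)
qed (auto intro: continuous_intros)

lemma cont_diff_affine_comp:
  fixes l :: "'a::euclidean_space \<Rightarrow> real"
  assumes l: "bounded_linear l" and "cont_diff k f"
  shows "cont_diff k (\<lambda>p. f (l p + d))"
  using assms(2)
proof (induction k arbitrary: f)
  case 0
  have "continuous_on UNIV (\<lambda>p. l p + d)"
    using l by (intro continuous_intros linear_continuous_on)
  with 0 show ?case by (auto intro: continuous_on_compose2[of UNIV f])
next
  case (Suc k)
  have D: "((\<lambda>p. f (l p + d)) has_derivative (\<lambda>v. l v * pd 1 f (l p + d))) (at p)" for p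
  proof -
    have "(f has_derivative frechet_derivative f (at (l p + d))) (at (l p + d))"
      using Suc.prems by (auto simp: frechet_derivative_works)
    moreover have "((\<lambda>p. l p + d) has_derivative l) (at p)"
      using l by (auto intro!: derivative_eq_intros bounded_linear_imp_has_derivative)
    ultimately have *: "((\<lambda>p. f (l p + d)) has_derivative (\<lambda>v. frechet_derivative f (at (l p + d)) (l v))) (at p)"
      by (rule has_derivative_compose[rotated])
    have "frechet_derivative f (at (l p + d)) (l v) = l v * pd 1 f (l p + d)" for v
      using \<open>(f has_derivative _) _\<close> linear_scale[of "frechet_derivative f (at (l p + d))" "l v" 1]
      by (simp add: pd_def has_derivative_linear)
    with * show ?thesis by simp
  qed
  have "pd v (\<lambda>p. f (l p + d)) = (\<lambda>p. l v * pd 1 f (l p + d))" for v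
    using pd_eqI[OF D] by blast
  moreover have "cont_diff k (\<lambda>p. l v * pd 1 f (l p + d))" for v
    using Suc by (intro cont_diff_mult cont_diff_const) auto
  ultimately show ?case using D by (auto simp: differentiable_def)
qed

lemma smoothI: "(\<And>k. cont_diff k f) \<Longrightarrow> smooth f" by (simp add: smooth_def)

lemma smooth_const: "smooth (\<lambda>_. c)" by (simp add: smooth_def cont_diff_const)
lemma smooth_add: "smooth f \<Longrightarrow> smooth g \<Longrightarrow> smooth (\<lambda>x. f x + g x)"
  by (simp add: smooth_def cont_diff_add)
lemma smooth_mult: "smooth f \<Longrightarrow> smooth g \<Longrightarrow> smooth (\<lambda>x. f x * g x)"
  by (simp add: smooth_def cont_diff_mult)
lemma smooth_diff: "smooth f \<Longrightarrow> smooth g \<Longrightarrow> smooth (\<lambda>x. f x - g x)"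
  using smooth_add[OF _ smooth_mult[OF smooth_const[of "-1"]], of f g] by simp
lemma smooth_affine_comp:
  fixes l :: "'a::euclidean_space \<Rightarrow> real"
  shows "bounded_linear l \<Longrightarrow> smooth f \<Longrightarrow> smooth (\<lambda>p. f (l p + d))"
  unfolding smooth_def using cont_diff_affine_comp by blast

lemma smooth_differentiable: "smooth f \<Longrightarrow> f differentiable (at p)"
  unfolding smooth_def by (metis cont_diff.simps(2))
lemma smooth_continuous: "smooth f \<Longrightarrow> continuous_on UNIV f"
  using cont_diff_continuous smooth_def by blast
lemma smooth_pd: "smooth f \<Longrightarrow> v \<in> Basis \<Longrightarrow> smooth (pd v f)"
  unfolding smooth_def by (metis cont_diff.simps(2))
lemma smooth_has_derivative: "smooth f \<Longrightarrow> (f has_derivative (\<lambda>v. pd v f p)) (at p)"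
  using smooth_differentiable[of f p] unfolding pd_def by (simp add: frechet_derivative_works)

lemma pd_real: fixes f :: "real \<Rightarrow> real"
  assumes "(f has_real_derivative D) (at x)" shows "pd 1 f x = D"
  using pd_eqI[OF assms[unfolded has_field_derivative_def]] by simp

lemma smooth_has_real_derivative:
  fixes f :: "real \<Rightarrow> real" assumes "smooth f"
  shows "(f has_real_derivative pd 1 f x) (at x)"
proof -
  have "f differentiable (at x)" using assms by (rule smooth_differentiable)
  then obtain D where "(f has_real_derivative D) (at x)"
    by (metis real_differentiable_def)
  then show ?thesis using pd_real by metis
qed

lemma cont_diff_SucI_real:
  fixes f :: "real \<Rightarrow> real"
  assumes "\<And>x. (f has_real_derivative f' x) (at x)" "cont_diff k f'"
  shows "cont_diff (Suc k) f"
proof -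
  have "pd 1 f = f'" using pd_real assms(1) by blast
  then show ?thesis using assms by (auto simp: differentiable_def has_field_derivative_def)
qed

lemma smooth_antiderivative:
  fixes f :: "real \<Rightarrow> real"
  assumes "\<And>x. (f has_real_derivative f' x) (at x)" "smooth f'"
  shows "smooth f"
proof (rule smoothI)
  fix k show "cont_diff k f"
    using cont_diff_Suc cont_diff_SucI_real assms unfolding smooth_def by blast
qed

definition flat_exp :: "nat \<Rightarrow> real \<Rightarrow> real" where
  "flat_exp m x = (if x > 0 then exp (- 1 / x) / x ^ m else 0)"

lemma flat_exp_tendsto_0: "((\<lambda>x. flat_exp m x) \<longlongrightarrow> 0) (at_right 0)"
proof -
  have "((\<lambda>y::real. y ^ m / exp y) \<longlongrightarrow> 0) at_top"
    by (rule tendsto_power_div_exp_0)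
  then have "((\<lambda>x. inverse x ^ m / exp (inverse x)) \<longlongrightarrow> (0::real)) (at_right 0)"
    using filterlim_compose filterlim_inverse_at_top_right by blast
  moreover have "\<forall>\<^sub>F x in at_right (0::real). inverse x ^ m / exp (inverse x) = flat_exp m x"
    by (auto simp: eventually_at_right_less flat_exp_def exp_minus field_simps
        intro!: eventually_mono[OF eventually_at_right_less[of 0]])
  ultimately show ?thesis by (rule Lim_transform_eventually)
qed

lemma flat_exp_has_derivative:
  "(flat_exp m has_real_derivative (flat_exp (m+2) x - m * flat_exp (m+1) x)) (at x)"
proof -
  consider "x < 0" | "x = 0" | "x > 0" by linarith
  then show ?thesis
  proof cases
    case 1
    have "((\<lambda>_. 0) has_real_derivative 0) (at x)" by simp
    then have "(flat_exp m has_real_derivative 0) (at x)"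
      by (rule has_field_derivative_transform_within[of _ _ _ _ "-x"])
         (use 1 in \<open>auto simp: flat_exp_def dist_real_def\<close>)
    then show ?thesis using 1 by (simp add: flat_exp_def)
  next
    case 2
    have L: "((\<lambda>h. (flat_exp m h) / h) \<longlongrightarrow> 0) (at_right 0)"
    proof (rule Lim_transform_eventually[OF flat_exp_tendsto_0[of "Suc m"]])
      show "\<forall>\<^sub>F h in at_right 0. flat_exp (Suc m) h = flat_exp m h / h"
        by (simp add: flat_exp_def field_simps)
    qed
    have "((\<lambda>h. flat_exp m h / h) \<longlongrightarrow> 0) (at_left 0)"
      by (rule Lim_transform_eventually[OF tendsto_const])
         (auto simp: flat_exp_def eventually_at_filter)
    with L have "((\<lambda>h. flat_exp m h / h) \<longlongrightarrow> 0) (at 0)"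
      by (simp add: filterlim_split_at)
    then show ?thesis using 2
      by (simp add: has_field_derivative_iff flat_exp_def)
  next
    case 3
    have "((\<lambda>x. exp (- 1 / x) / x ^ m) has_real_derivative (flat_exp (m+2) x - m * flat_exp (m+1) x)) (at x)"
      using 3
      apply (auto intro!: derivative_eq_intros simp: flat_exp_def)
      apply (cases m; simp add: field_simps power2_eq_square)
      done
    then show ?thesis
      by (rule has_field_derivative_transform_within[of _ _ _ _ x])
         (use 3 in \<open>auto simp: flat_exp_def dist_real_def\<close>)
  qed
qed

lemma smooth_flat_exp: "smooth (flat_exp m)"
proof (rule smoothI)
  fix k show "cont_diff k (flat_exp m)"
  proof (induction k arbitrary: m)
    case 0
    have "continuous_on UNIV (flat_exp m)"
      by (rule DERIV_continuous_on[OF flat_exp_has_derivative])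
    then show ?case by simp
  next
    case (Suc k)
    have "cont_diff k (\<lambda>x. flat_exp (m+2) x + (- m) * flat_exp (m+1) x)"
      using Suc by (intro cont_diff_add cont_diff_mult cont_diff_const) auto
    then show ?case by (intro cont_diff_SucI_real[OF flat_exp_has_derivative]) simp
  qed
qed

definition bump :: "real \<Rightarrow> real \<Rightarrow> nat \<Rightarrow> real \<Rightarrow> real" where
  "bump \<alpha> \<beta> j x = flat_exp 0 (real (Suc j) * x - real (Suc j) * \<alpha>) * flat_exp 0 (real (Suc j) * \<beta> - real (Suc j) * x)"

lemma smooth_bump: "smooth (bump \<alpha> \<beta> j)"
proof -
  have "smooth (\<lambda>x. flat_exp 0 (real (Suc j) * x + - real (Suc j) * \<alpha>))"
       "smooth (\<lambda>x. flat_exp 0 (- real (Suc j) * x + real (Suc j) * \<beta>))"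
    by (intro smooth_affine_comp smooth_flat_exp bounded_linear_mult_right)+
  from smooth_mult[OF this] show ?thesis
    by (simp add: bump_def[abs_def] algebra_simps)
qed

lemma flat_exp_range: "0 \<le> flat_exp 0 x" "flat_exp 0 x \<le> 1"
  by (auto simp: flat_exp_def)

lemma bump_nonneg: "0 \<le> bump \<alpha> \<beta> j x"
  by (simp add: bump_def flat_exp_range)

lemma bump_le_1: "bump \<alpha> \<beta> j x \<le> 1"
  by (simp add: bump_def flat_exp_range mult_le_one)

lemma bump_pos: "\<alpha> < x \<Longrightarrow> x < \<beta> \<Longrightarrow> 0 < bump \<alpha> \<beta> j x"
  by (simp add: bump_def flat_exp_def)

lemma bump_zero: "x \<notin> {\<alpha><..<\<beta>} \<Longrightarrow> bump \<alpha> \<beta> j x = 0"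
  by (auto simp: bump_def flat_exp_def not_less mult_le_cancel_left)

lemma bump_tendsto: "(\<lambda>j. bump \<alpha> \<beta> j x) \<longlonglongrightarrow> indicator {\<alpha><..<\<beta>} x"
proof (cases "x \<in> {\<alpha><..<\<beta>}")
  case True
  have *: "(\<lambda>j. exp (- 1 / (real (Suc j) * y))) \<longlonglongrightarrow> 1" if "y > 0" for y :: real
  proof -
    have "(\<lambda>j. exp (- (1 / y) * inverse (real (Suc j)))) \<longlonglongrightarrow> exp (- (1/y) * 0)"
      by (intro tendsto_intros LIMSEQ_inverse_real_of_nat)
    then show ?thesis by (simp add: field_simps)
  qed
  have "(\<lambda>j. exp (- 1 / (real (Suc j) * (x - \<alpha>))) * exp (- 1 / (real (Suc j) * (\<beta> - x)))) \<longlonglongrightarrow> 1 * 1"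
    by (intro tendsto_mult *) (use True in auto)
  moreover have "exp (- 1 / (real (Suc j) * (x - \<alpha>))) * exp (- 1 / (real (Suc j) * (\<beta> - x))) = bump \<alpha> \<beta> j x" for j
    using True by (simp add: bump_def flat_exp_def right_diff_distrib)
  ultimately show ?thesis using True by simp
qed (simp add: bump_zero)

lemma test_funI:
  assumes "smooth \<phi>" "compact K" "K \<subseteq> U" "\<And>x. x \<notin> K \<Longrightarrow> \<phi> x = 0"
  shows "test_fun U \<phi>"
proof -
  have "closure {p. \<phi> p \<noteq> 0} \<subseteq> K"
    using assms by (intro closure_minimal compact_imp_closed) auto
  moreover from this have "compact (closure {p. \<phi> p \<noteq> 0})"
    using assms(2) by (meson closed_closure compact_Int_closed inf.absorb_iff2 compact_imp_closed closed_subset compact_eq_bounded_closed bounded_subset)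
  ultimately show ?thesis using assms by (auto simp: test_fun_def)
qed

subsection \<open>The function B\<close>

definition kernel :: "real \<Rightarrow> real \<Rightarrow> real" where
  "kernel n v = 1 / (v powr (n - 1) + v\<^sup>2)"

definition tail :: "real \<Rightarrow> real \<Rightarrow> real" where
  "tail n r = (LBINT v:{r<..}. kernel n v)"

lemma kernel_measurable [measurable]: "kernel n \<in> borel_measurable borel"
  unfolding kernel_def by measurable

lemma kernel_nonneg: "0 \<le> kernel n v"
  by (simp add: kernel_def)

lemma kernel_le_inverse_square: "0 < v \<Longrightarrow> kernel n v \<le> 1 / v\<^sup>2"
  unfolding kernel_def by (intro divide_left_mono) (auto intro!: mult_pos_pos add_nonneg_pos)

lemma kernel_le_powr: "0 < v \<Longrightarrow> kernel n v \<le> v powr (1 - n)"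
proof -
  assume v: "0 < v"
  have "kernel n v \<le> 1 / v powr (n - 1)"
    unfolding kernel_def using v by (intro divide_left_mono) (auto intro!: mult_pos_pos add_pos_pos)
  also have "\<dots> = v powr (1 - n)"
    using powr_minus_divide[of v "n - 1"] by simp
  finally show ?thesis .
qed

lemma inverse_square_tail:
  fixes r :: real
  assumes "0 < r"
  shows "set_integrable lborel {r<..} (\<lambda>v. 1 / v\<^sup>2)" "(LBINT v:{r<..}. 1 / v\<^sup>2) = 1 / r"
proof -
  have *: "(\<integral>\<^sup>+x. ennreal (1 / x\<^sup>2) * indicator {r ..} x \<partial>lborel) = ennreal (0 - (- inverse r))"
  proof (rule nn_integral_FTC_atLeast)
    show "((\<lambda>x::real. - inverse x) \<longlongrightarrow> 0) at_top"
      using tendsto_minus[OF tendsto_inverse_0_at_top[of "\<lambda>x::real. x" at_top]]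
      by (simp add: filterlim_ident)
  qed (use assms in \<open>auto intro!: derivative_eq_intros simp: power2_eq_square field_simps\<close>)
  have "AE x in lborel. x \<noteq> r" by (rule AE_lborel_singleton)
  then have eq: "(\<integral>\<^sup>+x. ennreal (indicator {r <..} x *\<^sub>R (1 / x\<^sup>2)) \<partial>lborel) = ennreal (1 / r)"
    using *
    by (subst nn_integral_cong_AE[where v="\<lambda>x. ennreal (1 / x\<^sup>2) * indicator {r ..} x"])
       (auto elim!: eventually_mono split: split_indicator simp: inverse_eq_divide)
  have hb: "has_bochner_integral lborel (\<lambda>x. indicator {r <..} x *\<^sub>R (1 / x\<^sup>2)) (1 / r)"
    using eq by (intro has_bochner_integral_nn_integral) (auto simp: assms less_imp_le)
  show "set_integrable lborel {r<..} (\<lambda>v. 1 / v\<^sup>2)"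
    unfolding set_integrable_def using hb by (rule integrable.intros)
  show "(LBINT v:{r<..}. 1 / v\<^sup>2) = 1 / r"
    unfolding set_lebesgue_integral_def using hb by (rule has_bochner_integral_integral_eq)
qed

lemma kernel_integrable: "0 < r \<Longrightarrow> set_integrable lborel {r<..} (kernel n)"
  by (rule set_integrable_bound[OF inverse_square_tail(1)])
     (auto simp: set_borel_measurable_def kernel_nonneg kernel_le_inverse_square)

lemma tail_nonneg: "0 \<le> tail n r"
  unfolding tail_def set_lebesgue_integral_def by (simp add: kernel_nonneg)

lemma tail_le_inverse:
  assumes "0 < r" shows "tail n r \<le> 1 / r"
  unfolding tail_def inverse_square_tail(2)[OF assms, symmetric]
  using assms by (intro set_integral_mono kernel_integrable inverse_square_tail)
    (auto simp: kernel_le_inverse_square)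

lemma tail_split:
  assumes "0 < r" "r \<le> s"
  shows "tail n r = (LBINT v:{r<..s}. kernel n v) + tail n s"
proof -
  have "(LBINT v:{r<..s} \<union> {s<..}. kernel n v) = (LBINT v:{r<..s}. kernel n v) + (LBINT v:{s<..}. kernel n v)"
  proof (rule set_integral_Un)
    show "set_integrable lborel {r<..s} (kernel n)"
      by (rule set_integrable_subset[OF kernel_integrable[OF assms(1)]]) auto
    show "set_integrable lborel {s<..} (kernel n)"
      by (rule kernel_integrable) (use assms in auto)
  qed auto
  moreover have "{r<..s} \<union> {s<..} = {r<..}" using assms by auto
  ultimately show ?thesis by (simp only: tail_def)
qed

lemma tail_diff_le:
  assumes "0 < c" "c \<le> r" "r \<le> s"
  shows "0 \<le> tail n r - tail n s" "tail n r - tail n s \<le> (s - r) / c\<^sup>2"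
proof -
  have r: "0 < r" using assms by simp
  have eq: "tail n r - tail n s = (LBINT v:{r<..s}. kernel n v)"
    using tail_split[OF r assms(3), of n] by simp
  show "0 \<le> tail n r - tail n s"
    unfolding eq set_lebesgue_integral_def by (simp add: kernel_nonneg)
  have "(LBINT v:{r<..s}. kernel n v) \<le> (LBINT v:{r<..s}. 1 / c\<^sup>2)"
  proof (rule set_integral_mono)
    show "set_integrable lborel {r<..s} (kernel n)"
      by (rule set_integrable_subset[OF kernel_integrable[OF r]]) auto
    show "kernel n v \<le> 1 / c\<^sup>2" if "v \<in> {r<..s}" for v
    proof -
      have "kernel n v \<le> 1 / v\<^sup>2" using that r by (intro kernel_le_inverse_square) auto
      also have "\<dots> \<le> 1 / c\<^sup>2" using that assms by (intro divide_left_mono power_mono) auto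
      finally show ?thesis .
    qed
  next
    show "set_integrable lborel {r<..s} (\<lambda>v. 1 / c\<^sup>2)"
      by (rule borel_integrable_atLeastAtMost'[THEN set_integrable_subset, of r s]) auto
  qed
  also have "\<dots> = (s - r) / c\<^sup>2" using assms by (simp add: set_integral_const)
  finally show "tail n r - tail n s \<le> (s - r) / c\<^sup>2" unfolding eq .
qed

lemma continuous_on_tail: "continuous_on {0<..} (tail n)"
proof -
  have "continuous (at r within {0<..}) (tail n)" if "0 < r" for r
  proof -
    define c where "c = r / 2"
    have c: "0 < c" "c < r" using that by (auto simp: c_def)
    have bd: "\<bar>tail n x - tail n y\<bar> \<le> \<bar>x - y\<bar> / c\<^sup>2" if "c \<le> x" "c \<le> y" for x y
    proof (cases "x \<le> y")
      case True
      then show ?thesis using tail_diff_le[OF c(1) that(1) True, of n] by (auto simp: abs_if)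
    next
      case False
      then show ?thesis using tail_diff_le[OF c(1) that(2), of x n] by (auto simp: abs_if)
    qed
    have "(1 / c\<^sup>2)-lipschitz_on {c..} (tail n)"
      by (rule lipschitz_onI) (use bd in \<open>auto simp: dist_real_def\<close>)
    then have "continuous_on {c<..} (tail n)"
      by (rule continuous_on_subset[OF lipschitz_on_continuous_on]) auto
    then show ?thesis using c
      by (simp add: continuous_at_imp_continuous_at_within continuous_on_eq_continuous_at)
  qed
  then show ?thesis by (simp add: continuous_on_eq_continuous_within)
qed

lemma tail_le_powr:
  assumes n: "0 < n" and \<alpha>: "0 \<le> \<alpha>" "0 < 2 - n + \<alpha>" and v: "0 < v" "v \<le> 1"
  shows "tail n v \<le> 1 + v powr (-\<alpha>) / (2 - n + \<alpha>)"
proof -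
  let ?\<gamma> = "1 - n + \<alpha>" let ?g = "2 - n + \<alpha>"
  have *: "has_bochner_integral lborel (\<lambda>x. x powr ?\<gamma> * indicator {v..1} x) (1 powr ?g / ?g - v powr ?g / ?g)"
  proof (rule has_bochner_integral_FTC_Icc_nonneg[OF _ _ _ v(2)])
    show "((\<lambda>x. x powr ?g / ?g) has_real_derivative x powr ?\<gamma>) (at x)" if "x \<in> {v..1}" for x
    proof -
      have "((\<lambda>x. x powr ?g) has_real_derivative ?g * x powr ?\<gamma>) (at x)"
        using v that has_real_derivative_powr[of x ?g] by (simp del: distrib_right add: algebra_simps)
      from DERIV_cdivide[OF this, of ?g] show ?thesis
        using \<alpha> by (simp del: distrib_right left_diff_distrib add: add_diff_eq)
    qed
  qed auto
  have int: "set_integrable lborel {v..1} (\<lambda>x. x powr ?\<gamma>)"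
    using integrable.intros[OF *] by (simp add: set_integrable_def mult.commute)
  have val: "(LBINT x:{v..1}. x powr ?\<gamma>) = 1 / ?g - v powr ?g / ?g"
    using has_bochner_integral_integral_eq[OF *] by (simp add: set_lebesgue_integral_def mult.commute)
  have int': "set_integrable lborel {v<..1} (\<lambda>x. x powr ?\<gamma>)"
    by (rule set_integrable_subset[OF int]) auto
  have "(LBINT x:{v<..1}. kernel n x) \<le> (LBINT x:{v<..1}. v powr (-\<alpha>) * x powr ?\<gamma>)"
  proof (rule set_integral_mono)
    show "set_integrable lborel {v<..1} (kernel n)"
      by (rule set_integrable_subset[OF kernel_integrable[OF v(1)]]) auto
    show "set_integrable lborel {v<..1} (\<lambda>x. v powr (-\<alpha>) * x powr ?\<gamma>)" using int' by simp
    show "kernel n x \<le> v powr (-\<alpha>) * x powr ?\<gamma>" if "x \<in> {v<..1}" for x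
    proof -
      have "kernel n x \<le> x powr (1 - n)" using that v by (intro kernel_le_powr) auto
      also have "\<dots> = x powr (-\<alpha>) * x powr ?\<gamma>" by (simp add: powr_add[symmetric])
      also have "\<dots> \<le> v powr (-\<alpha>) * x powr ?\<gamma>"
        using that v \<alpha> by (intro mult_right_mono powr_mono2') auto
      finally show ?thesis .
    qed
  qed
  also have "\<dots> = v powr (-\<alpha>) * (LBINT x:{v<..1}. x powr ?\<gamma>)" by simp
  also have "\<dots> \<le> v powr (-\<alpha>) * (LBINT x:{v..1}. x powr ?\<gamma>)"
    using int int' unfolding set_lebesgue_integral_def set_integrable_def
    by (intro mult_left_mono integral_mono) (auto split: split_indicator)
  also have "\<dots> \<le> v powr (-\<alpha>) * (1 / ?g)"
    unfolding val using \<alpha> by (intro mult_left_mono) auto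
  finally show ?thesis
    using tail_split[OF v, of n] tail_le_inverse[of 1 n] by simp
qed

lemma tail_measurable_pos: "set_borel_measurable borel {0<..} (tail n)"
  unfolding set_borel_measurable_def
  by (rule borel_measurable_continuous_on_indicator[OF _ continuous_on_tail]) auto

lemma tail_measurable_on: "A \<in> sets borel \<Longrightarrow> A \<subseteq> {0<..} \<Longrightarrow> set_borel_measurable lborel A (tail n)"
  using set_borel_measurable_subset[OF tail_measurable_pos, of A n] by (simp add: set_borel_measurable_def)

lemma tail_integrable:
  assumes n: "0 < n" "n < 3"
  shows "set_integrable lborel {0<..<s} (tail n)"
proof -
  obtain \<alpha> where \<alpha>: "max 0 (n - 2) < \<alpha>" "\<alpha> < 1" using dense[of "max 0 (n-2)" 1] n by auto
  have "(\<lambda>x::real. x powr (-\<alpha>)) absolutely_integrable_on {0..1}"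
    using \<alpha> by (intro nonnegative_absolutely_integrable_1 integrable_on_powr_from_0) auto
  then have "set_integrable lborel {0..1} (\<lambda>x::real. x powr (-\<alpha>))"
    unfolding set_integrable_def by (subst (asm) integrable_completion) auto
  then have pw: "set_integrable lborel {0<..1} (\<lambda>x::real. x powr (-\<alpha>))"
    by (rule set_integrable_subset) auto
  have 1: "set_integrable lborel {0<..1} (tail n)"
  proof (rule set_integrable_bound)
    show "set_integrable lborel {0<..1} (\<lambda>x. 1 + x powr (-\<alpha>) / (2 - n + \<alpha>))"
      using pw by (intro set_integral_add set_integrable_divide) (auto simp: set_integrable_def)
    show "set_borel_measurable lborel {0<..1} (tail n)"
      by (auto intro!: tail_measurable_on)
    show "AE x in lborel. x \<in> {0<..1} \<longrightarrow> norm (tail n x) \<le> norm (1 + x powr (- \<alpha>) / (2 - n + \<alpha>))"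
      using tail_le_powr[of n \<alpha>] \<alpha> n by (auto simp: tail_nonneg)
  qed
  have 2: "set_integrable lborel {1..<max 1 s} (tail n)"
  proof (rule set_integrable_bound)
    show "set_integrable lborel {1..<max 1 s} (\<lambda>x. 1::real)" by (auto simp: set_integrable_def)
    show "set_borel_measurable lborel {1..<max 1 s} (tail n)"
      by (auto intro!: tail_measurable_on)
    have "tail n x \<le> 1" if "1 \<le> x" for x
      using tail_le_inverse[of x n] that order_trans[of "tail n x" "1/x" 1] by simp
    then show "AE x in lborel. x \<in> {1..<max 1 s} \<longrightarrow> norm (tail n x) \<le> norm (1::real)"
      by (auto simp: tail_nonneg)
  qed
  have "set_integrable lborel ({0<..1} \<union> {1..<max 1 s}) (tail n)"
    by (rule set_integrable_Un[OF 1 2]) auto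
  then show ?thesis by (rule set_integrable_subset) auto
qed

lemma Bfun_tail: "Bfun n s = (LBINT r:{0<..<s}. tail n r)"
  by (simp add: Bfun_def tail_def kernel_def)

lemma Bfun_split:
  assumes n: "0 < n" "n < 3" and "0 < c" "c \<le> s"
  shows "Bfun n s = Bfun n c + integral {c..s} (tail n)"
proof -
  have ae: "(LBINT r:{0<..<s}. tail n r) = (LBINT r:({0<..<c} \<union> {c<..<s}). tail n r)"
  proof (rule set_integral_cong_set)
    show "AE x in lborel. (x \<in> {0<..<c} \<union> {c<..<s}) = (x \<in> {0<..<s})"
      using AE_lborel_singleton[of c] by eventually_elim (use assms in auto)
  qed (use assms in \<open>auto intro!: tail_measurable_on\<close>)
  have cont: "continuous_on {c..s} (tail n)"
    by (rule continuous_on_subset[OF continuous_on_tail]) (use assms in auto)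
  have i: "set_integrable lborel {c..s} (tail n)"
    by (rule borel_integrable_atLeastAtMost') (rule cont)
  have "(LBINT r:{c<..<s}. tail n r) = (LBINT r:{c..s}. tail n r)"
  proof (rule set_integral_cong_set)
    show "AE x in lborel. (x \<in> {c..s}) = (x \<in> {c<..<s})"
      using AE_lborel_singleton[of c] AE_lborel_singleton[of s] by eventually_elim auto
  qed (use assms in \<open>auto intro!: tail_measurable_on\<close>)
  also have "\<dots> = integral {c..s} (tail n)"
    by (rule set_borel_integral_eq_integral(2)[OF i])
  finally have "(LBINT r:{c<..<s}. tail n r) = integral {c..s} (tail n)" .
  moreover have i1: "set_integrable lborel {0<..<c} (tail n)" by (rule tail_integrable[OF n])
  moreover have i2: "set_integrable lborel {c<..<s} (tail n)"
    by (rule set_integrable_subset[OF tail_integrable[OF n, of s]]) (use assms in auto)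
  ultimately show ?thesis
    unfolding Bfun_tail ae
    by (subst set_integral_Un) (auto simp: i1 i2)
qed

lemma Bfun_has_derivative:
  assumes n: "0 < n" "n < 3" and "0 < s"
  shows "(Bfun n has_real_derivative tail n s) (at s)"
proof -
  define c where "c = s / 2"
  have c: "0 < c" "c < s" using assms by (auto simp: c_def)
  have "continuous_on {c..s+1} (tail n)"
    by (rule continuous_on_subset[OF continuous_on_tail]) (use c in auto)
  then have "((\<lambda>x. integral {c..x} (tail n)) has_real_derivative tail n s) (at s within {c..s+1})"
    by (rule integral_has_real_derivative) (use c in auto)
  then have "((\<lambda>x. integral {c..x} (tail n)) has_real_derivative tail n s) (at s)"
    using c at_within_Icc_at[of c s "s+1"] by simp
  then have "((\<lambda>x. Bfun n c + integral {c..x} (tail n)) has_real_derivative tail n s) (at s)"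
    by (auto intro!: derivative_eq_intros)
  then show ?thesis
  proof (rule has_field_derivative_transform_within_open[where S="{c<..}"])
    show "Bfun n c + integral {c..x} (tail n) = Bfun n x" if "x \<in> {c<..}" for x
      using Bfun_split[OF n c(1), of x] that by simp
  qed (use c in auto)
qed

lemma Bfun_nonneg: "0 \<le> Bfun n s"
  unfolding Bfun_tail set_lebesgue_integral_def by (simp add: tail_nonneg)

lemma Bfun_mono:
  assumes n: "0 < n" "n < 3" shows "mono (Bfun n)"
proof (rule monoI)
  fix x y :: real assume "x \<le> y"
  then show "Bfun n x \<le> Bfun n y"
    using tail_integrable[OF n, of x] tail_integrable[OF n, of y]
    unfolding Bfun_tail set_lebesgue_integral_def set_integrable_def
    by (intro integral_mono) (auto simp: tail_nonneg split: split_indicator)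
qed

lemma Bfun_measurable [measurable]:
  assumes "0 < n" "n < 3" shows "Bfun n \<in> borel_measurable borel"
  by (rule borel_measurable_mono[OF Bfun_mono[OF assms]])

lemma Bfun_le_ln:
  assumes n: "0 < n" "n < 3" and "1 \<le> s"
  shows "Bfun n s \<le> Bfun n 1 + ln s"
proof -
  have "Bfun n s - ln s \<le> Bfun n 1 - ln 1"
  proof (rule DERIV_nonpos_imp_nonincreasing[of 1 s "\<lambda>s. Bfun n s - ln s"])
    show "\<exists>y. ((\<lambda>s. Bfun n s - ln s) has_real_derivative y) (at x) \<and> y \<le> 0" if "1 \<le> x" "x \<le> s" for x
      using that tail_le_inverse[of x n]
      by (intro exI[of _ "tail n x - 1 / x"] conjI)
         (auto intro!: derivative_eq_intros Bfun_has_derivative[OF n])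
  qed (use assms in auto)
  then show ?thesis by simp
qed

lemma deriv_Beps:
  assumes n: "0 < n" "n < 3" and "0 < \<epsilon>" "0 < s"
  shows "deriv (Beps n \<epsilon>) s = tail n (s / \<epsilon>) / (\<epsilon> * \<bar>ln \<epsilon>\<bar>)"
proof (rule DERIV_imp_deriv)
  have "((\<lambda>s. Bfun n (s / \<epsilon>)) has_real_derivative tail n (s / \<epsilon>) * (1 / \<epsilon>)) (at s)"
    by (rule DERIV_chain2[OF Bfun_has_derivative[OF n]])
       (use assms in \<open>auto intro!: derivative_eq_intros\<close>)
  from DERIV_cdivide[OF this, of "\<bar>ln \<epsilon>\<bar>"]
  show "(Beps n \<epsilon> has_real_derivative tail n (s / \<epsilon>) / (\<epsilon> * \<bar>ln \<epsilon>\<bar>)) (at s)"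
    by (simp add: Beps_def[abs_def])
qed

lemma tail_square_bound:
  assumes n: "0 < n" "n < 3" and v: "0 < v"
  shows "(tail n v)\<^sup>2 * (v powr n + v ^ 3) \<le> 18 + 2 * v"
proof (cases "1 \<le> v")
  case True
  have "v powr n \<le> v powr 3" using n True by (intro powr_mono) auto
  then have 1: "v powr n + v ^ 3 \<le> 2 * v ^ 3" using v by (simp add: powr_numeral)
  have "(tail n v)\<^sup>2 \<le> (1 / v)\<^sup>2"
    using tail_le_inverse[OF v, of n] by (intro power_mono) (auto simp: tail_nonneg)
  then have "(tail n v)\<^sup>2 * (v powr n + v ^ 3) \<le> (1 / v)\<^sup>2 * (2 * v ^ 3)"
    using 1 v by (intro mult_mono) auto
  also have "\<dots> = 2 * v" using v by (simp add: field_simps power2_eq_square power3_eq_cube)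
  finally show ?thesis by simp
next
  case False
  have "v powr 3 \<le> v powr n" using n False v by (intro powr_mono') auto
  then have 1: "v powr n + v ^ 3 \<le> 2 * v powr n" using v by (simp add: powr_numeral)
  have "tail n v \<le> 1 + v powr (-(n/2)) / (2 - n + n/2)"
    using n v False by (intro tail_le_powr) auto
  also have "\<dots> \<le> 1 + v powr (-(n/2)) / (1/2)"
    using n by (intro add_left_mono divide_left_mono) auto
  also have "\<dots> \<le> 3 * v powr (-(n/2))"
    using powr_mono2'[of "-(n/2)" v 1] v n False by simp
  finally have "(tail n v)\<^sup>2 \<le> (3 * v powr (-(n/2)))\<^sup>2"
    by (intro power_mono) (auto simp: tail_nonneg)
  also have "\<dots> = 9 * v powr (-n)"
    using v by (simp add: power_mult_distrib powr_power)
  finally have "(tail n v)\<^sup>2 * (v powr n + v ^ 3) \<le> 9 * v powr (-n) * (2 * v powr n)"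
    using 1 v by (intro mult_mono) auto
  also have "\<dots> = 18" using v by (simp add: powr_add[symmetric])
  finally show ?thesis using v by simp
qed

lemma flux_square_bound:
  assumes n: "0 < n" "n < 3" and e: "0 < \<epsilon>" "\<epsilon> < 1" and s: "0 < s"
  shows "(\<bar>ln \<epsilon>\<bar> * deriv (Beps n \<epsilon>) s * (\<epsilon> powr (3 - n) * s powr (n - 1) + s\<^sup>2) * s)\<^sup>2
    \<le> (18 * \<epsilon> + 2 * s) * mobility n \<epsilon> s"
proof -
  define v where "v = s / \<epsilon>"
  have v: "0 < v" "s = \<epsilon> * v" using e s by (auto simp: v_def)
  have L: "\<bar>ln \<epsilon>\<bar> \<noteq> 0" using e by simp
  have m1: "(\<epsilon> powr (3 - n) * s powr (n - 1) + s\<^sup>2) * s = mobility n \<epsilon> s"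
    using s powr_add[of s "n - 1" 1] by (simp add: mobility_def algebra_simps power2_eq_square power3_eq_cube)
  have m2: "mobility n \<epsilon> s = \<epsilon> ^ 3 * (v powr n + v ^ 3)"
    using v e powr_add[of \<epsilon> "3 - n" n] unfolding mobility_def v(2)
    by (simp add: powr_mult algebra_simps power_mult_distrib powr_numeral)
  have "(\<bar>ln \<epsilon>\<bar> * deriv (Beps n \<epsilon>) s * (\<epsilon> powr (3 - n) * s powr (n - 1) + s\<^sup>2) * s)\<^sup>2
     = (tail n v / \<epsilon> * mobility n \<epsilon> s)\<^sup>2"
    unfolding deriv_Beps[OF n e(1) s] m1[symmetric] v_def[symmetric] using L by (simp add: mult.assoc)
  also have "\<dots> = (\<epsilon> * ((tail n v)\<^sup>2 * (v powr n + v ^ 3))) * mobility n \<epsilon> s"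
    using e unfolding m2 by (simp add: power2_eq_square power3_eq_cube field_simps)
  also have "\<dots> \<le> (\<epsilon> * (18 + 2 * v)) * mobility n \<epsilon> s"
    using e s by (intro mult_right_mono mult_left_mono tail_square_bound[OF n v(1)])
      (auto simp: mobility_def)
  also have "\<epsilon> * (18 + 2 * v) = 18 * \<epsilon> + 2 * s" using v by (simp add: algebra_simps)
  finally show ?thesis .
qed

subsection \<open>Calculus of absolutely continuous functions\<close>

lemma AE_eq_0_if_interval_integrals_0:
  fixes f :: "real \<Rightarrow> real"
  assumes int: "set_integrable lborel {a<..<b} f"
    and 0: "\<And>\<alpha> \<beta>. a \<le> \<alpha> \<Longrightarrow> \<alpha> < \<beta> \<Longrightarrow> \<beta> \<le> b \<Longrightarrow> (LBINT x:{\<alpha><..<\<beta>}. f x) = 0"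
  shows "AE x in lborel. x \<in> {a<..<b} \<longrightarrow> f x = 0"
proof -
  define g where "g = (\<lambda>x. indicator {a<..<b} x * f x)"
  have g: "integrable lborel g" using int by (simp add: g_def set_integrable_def)
  have sg: "set_integrable lborel A g" if "A \<in> sets borel" for A
    using integrable_mult_indicator[OF _ g, of A] that by (simp add: set_integrable_def)
  have seg: "(LBINT x:{\<alpha><..<\<beta>}. f x) = 0" if "a \<le> \<alpha>" "\<beta> \<le> b" for \<alpha> \<beta>
    using 0[of \<alpha> \<beta>] that by (cases "\<alpha> < \<beta>") (auto simp: set_lebesgue_integral_def)
  have G: "sets borel = sigma_sets UNIV (range (lessThan :: real \<Rightarrow> real set))"
    by (subst borel_Iio) (simp add: sets_measure_of)
  have int_stable: "Int_stable (range (lessThan :: real \<Rightarrow> real set))"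
  proof (rule Int_stableI)
    fix A B assume "A \<in> range (lessThan :: real \<Rightarrow> real set)" "B \<in> range (lessThan :: real \<Rightarrow> real set)"
    then obtain c d :: real where "A = {..<c}" "B = {..<d}" by auto
    then have "A \<inter> B = {..<min c d}" by auto
    then show "A \<inter> B \<in> range lessThan" by auto
  qed
  have all: "(LBINT x:UNIV. g x) = 0"
    using seg[of a b] by (simp add: g_def set_lebesgue_integral_def)
  have pow: "range (lessThan :: real \<Rightarrow> real set) \<subseteq> Pow UNIV" by simp
  have "(LBINT x:A. g x) = 0" if "A \<in> sets borel" for A
    using int_stable pow that[unfolded G]
  proof (induction rule: sigma_sets_induct_disjoint)
    case (basic A)
    then obtain c where A: "A = {..<c}" by auto
    have "(LBINT x:A. g x) = (LBINT x:{a<..<min c b}. f x)"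
      unfolding g_def set_lebesgue_integral_def A
      by (intro Bochner_Integration.integral_cong) (auto split: split_indicator)
    then show ?case using seg[of a "min c b"] by simp
  next
    case empty show ?case by (simp add: set_lebesgue_integral_def)
  next
    case (compl A)
    have Ab: "A \<in> sets borel" using compl(1) G by simp
    have "(LBINT x:A \<union> (UNIV - A). g x) = (LBINT x:A. g x) + (LBINT x:UNIV - A. g x)"
      by (rule set_integral_Un) (use Ab in \<open>auto intro!: sg\<close>)
    then show ?case using all compl by simp
  next
    case (union A)
    have Ab: "A i \<in> sets borel" for i using union(2) G by auto
    have "(LBINT x:(\<Union>i. A i). g x) = (\<Sum>i. (LBINT x:A i. g x))"
    proof (rule lebesgue_integral_countable_add)
      show "A i \<inter> A j = {}" if "i \<noteq> j" for i j
        using union(1) that by (simp add: disjoint_family_on_def)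
    qed (use Ab in \<open>auto intro!: sg\<close>)
    then show ?case using union by simp
  qed
  then have "AE x in lborel. g x = 0" by (intro sigma_finite_measure.density_zero[OF sigma_finite_lborel g]) auto
  then show ?thesis by eventually_elim (auto simp: g_def)
qed

lemma LBINT_combine:
  fixes g :: "real \<Rightarrow> real"
  assumes "set_integrable lborel {a..c} g" "a \<le> b" "b \<le> c"
  shows "(LBINT s:{a..c}. g s) = (LBINT s:{a..b}. g s) + (LBINT s:{b..c}. g s)"
proof -
  have "set_integrable lborel {a..b} g" "set_integrable lborel {b..c} g"
    by (rule set_integrable_subset[OF assms(1)]; use assms in auto)+
  then show ?thesis
    using Henstock_Kurzweil_Integration.integral_combine[OF assms(2,3), of g]
      set_borel_integral_eq_integral[OF assms(1)]
    by (simp add: set_borel_integral_eq_integral)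
qed

lemma continuous_on_LBINT:
  fixes g :: "real \<Rightarrow> real"
  assumes "set_integrable lborel {a..b} g"
  shows "continuous_on {a..b} (\<lambda>x. LBINT s:{a..x}. g s)"
proof -
  have "continuous_on {a..b} (\<lambda>x. integral {a..x} g)"
    by (rule indefinite_integral_continuous_1) (rule set_borel_integral_eq_integral(1)[OF assms])
  moreover have "(LBINT s:{a..x}. g s) = integral {a..x} g" if "x \<in> {a..b}" for x
    using that by (intro set_borel_integral_eq_integral set_integrable_subset[OF assms]) auto
  ultimately show ?thesis by (subst continuous_on_cong[OF refl]) auto
qed

lemma continuous_on_Icc_bounded:
  fixes h :: "real \<Rightarrow> real"
  assumes "continuous_on {a..b} h"
  obtains C where "\<And>x. x \<in> {a..b} \<Longrightarrow> \<bar>h x\<bar> \<le> C"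
proof -
  have "bounded (h ` {a..b})"
    by (rule compact_imp_bounded[OF compact_continuous_image[OF assms]]) simp
  then obtain C where "\<forall>x\<in>{a..b}. \<bar>h x\<bar> \<le> C" by (auto simp: bounded_iff)
  then show thesis by (intro that[of C]) blast
qed

lemma set_integrable_continuous_mult:
  fixes g h :: "real \<Rightarrow> real"
  assumes g: "set_integrable lborel {a..b} g" and h: "continuous_on {a..b} h"
  shows "set_integrable lborel {a..b} (\<lambda>x. h x * g x)"
proof -
  obtain C where C: "\<And>x. x \<in> {a..b} \<Longrightarrow> \<bar>h x\<bar> \<le> C"
    using continuous_on_Icc_bounded[OF h] by blast
  have m: "set_borel_measurable lborel {a..b} h"
    using set_measurable_continuous_on[OF _ h] by (simp add: set_borel_measurable_def)
  have mg: "set_borel_measurable lborel {a..b} g"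
    using g by (simp add: set_integrable_def set_borel_measurable_def borel_measurable_integrable)
  have e: "(\<lambda>x. indicator {a..b} x *\<^sub>R (h x * g x)) = (\<lambda>x. (indicator {a..b} x *\<^sub>R h x) * (indicator {a..b} x *\<^sub>R g x))"
    by (auto split: split_indicator)
  show ?thesis
  proof (rule set_integrable_bound)
    show "set_integrable lborel {a..b} (\<lambda>x. C * g x)" using g by simp
    show "set_borel_measurable lborel {a..b} (\<lambda>x. h x * g x)"
      using m mg unfolding set_borel_measurable_def e by (rule borel_measurable_times)
    show "AE x in lborel. x \<in> {a..b} \<longrightarrow> norm (h x * g x) \<le> norm (C * g x)"
    proof (intro AE_I2 impI)
      fix x assume "x \<in> {a..b}"
      from C[OF this] show "norm (h x * g x) \<le> norm (C * g x)"
        by (simp add: abs_mult mult_right_mono)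
    qed
  qed
qed

lemma LBINT_abs_bound:
  fixes g h :: "real \<Rightarrow> real"
  assumes g: "set_integrable lborel {a..b} g" and h: "continuous_on {a..b} h"
    and C: "\<And>x. x \<in> {a..b} \<Longrightarrow> \<bar>h x\<bar> \<le> C"
  shows "\<bar>LBINT x:{a..b}. h x * g x\<bar> \<le> C * (LBINT x:{a..b}. \<bar>g x\<bar>)"
proof -
  have i: "set_integrable lborel {a..b} (\<lambda>x. h x * g x)"
    by (rule set_integrable_continuous_mult[OF g h])
  have "\<bar>LBINT x:{a..b}. h x * g x\<bar> \<le> (LBINT x:{a..b}. \<bar>h x * g x\<bar>)"
    using integral_norm_bound[of lborel "\<lambda>x. indicator {a..b} x *\<^sub>R (h x * g x)"]
    by (simp add: set_lebesgue_integral_def abs_mult)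
  also have "\<dots> \<le> (LBINT x:{a..b}. C * \<bar>g x\<bar>)"
    by (rule set_integral_mono)
       (use set_integrable_abs[OF i] set_integrable_abs[OF g] C in \<open>auto simp: abs_mult intro!: mult_right_mono\<close>)
  also have "\<dots> = C * (LBINT x:{a..b}. \<bar>g x\<bar>)" by simp
  finally show ?thesis .
qed

lemma has_real_derivative_product_AC:
  fixes A A' w z :: "real \<Rightarrow> real"
  assumes z: "set_integrable lborel {\<alpha>..\<beta>} z"
    and w: "\<And>x y. \<alpha> \<le> x \<Longrightarrow> x \<le> y \<Longrightarrow> y \<le> \<beta> \<Longrightarrow> w y - w x = (LBINT s:{x..y}. z s)"
    and A: "\<And>x. x \<in> {\<alpha>..\<beta>} \<Longrightarrow> (A has_real_derivative A' x) (at x within {\<alpha>..\<beta>})"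
    and A': "continuous_on {\<alpha>..\<beta>} A'"
    and x: "x \<in> {\<alpha>..\<beta>}"
  shows "((\<lambda>x. A x * w x - (LBINT s:{\<alpha>..x}. A s * z s)) has_real_derivative A' x * w x) (at x within {\<alpha>..\<beta>})"
proof -
  let ?S = "{\<alpha>..\<beta>}"
  define K where "K = (\<lambda>x. LBINT s:{\<alpha>..x}. \<bar>z s\<bar>)"
  have zabs: "set_integrable lborel ?S (\<lambda>s. \<bar>z s\<bar>)" using z by (rule set_integrable_abs)
  have Kc: "continuous_on ?S K" unfolding K_def by (rule continuous_on_LBINT[OF zabs])
  have Ac: "continuous_on ?S A" using A by (rule DERIV_continuous_on)
  obtain L where L: "\<And>x. x \<in> ?S \<Longrightarrow> \<bar>A' x\<bar> \<le> L"
    using continuous_on_Icc_bounded[OF A'] by blast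
  have lip: "\<bar>A x - A y\<bar> \<le> L * \<bar>x - y\<bar>" if "x \<in> ?S" "y \<in> ?S" for x y
    using field_differentiable_bound[of ?S A A' L x y] A L that by (simp add: convex_real_interval)
  have zi: "set_integrable lborel {x..y} z" if "\<alpha> \<le> x" "y \<le> \<beta>" for x y
    by (rule set_integrable_subset[OF z]) (use that in auto)
  have Azi: "set_integrable lborel {x..y} (\<lambda>s. A s * z s)" if "\<alpha> \<le> x" "y \<le> \<beta>" for x y
    by (rule set_integrable_subset[OF set_integrable_continuous_mult[OF z Ac]]) (use that in auto)
  define Q where "Q = (\<lambda>x. A x * w x - (LBINT s:{\<alpha>..x}. A s * z s))"
  have est: "\<bar>Q y - Q x - w c * (A y - A x)\<bar> \<le> L * (y - x) * (K y - K x)"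
    if "\<alpha> \<le> x" "x \<le> y" "y \<le> \<beta>" and c: "c = x \<or> c = y" for x y c
  proof -
    define e where "e = (if c = x then y else x)"
    have Kd: "K y - K x = (LBINT s:{x..y}. \<bar>z s\<bar>)"
      unfolding K_def using LBINT_combine[of \<alpha> y "\<lambda>s. \<bar>z s\<bar>" x] set_integrable_subset[OF zabs, of "{\<alpha>..y}"] that by auto
    have Id: "(LBINT s:{\<alpha>..y}. A s * z s) - (LBINT s:{\<alpha>..x}. A s * z s) = (LBINT s:{x..y}. A s * z s)"
      using LBINT_combine[OF Azi[of \<alpha> y], of x] that by simp
    have "Q y - Q x - w c * (A y - A x) = A e * (w y - w x) - (LBINT s:{x..y}. A s * z s)"
      unfolding Q_def Id[symmetric] e_def using c by (auto simp: algebra_simps)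
    also have "\<dots> = (LBINT s:{x..y}. A e * z s) - (LBINT s:{x..y}. A s * z s)"
      using w[OF that(1-3)] by simp
    also have "\<dots> = (LBINT s:{x..y}. (A e - A s) * z s)"
      using zi[of x y] Azi[of x y] that by (simp add: left_diff_distrib)
    finally have eq: "Q y - Q x - w c * (A y - A x) = (LBINT s:{x..y}. (A e - A s) * z s)" .
    show ?thesis unfolding eq Kd
    proof (rule LBINT_abs_bound[OF zi])
      show "continuous_on {x..y} (\<lambda>s. A e - A s)"
        by (intro continuous_intros continuous_on_subset[OF Ac]) (use that in auto)
      fix s assume s: "s \<in> {x..y}"
      have "\<bar>A e - A s\<bar> \<le> L * \<bar>e - s\<bar>" by (rule lip) (use s that e_def in auto)
      also have "\<dots> \<le> L * (y - x)"
        using s L[of x] that c by (intro mult_left_mono) (auto simp: e_def)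
      finally show "\<bar>A e - A s\<bar> \<le> L * (y - x)" .
    qed (use that in auto)
  qed
  have est': "\<bar>Q y - Q x - w x * (A y - A x)\<bar> \<le> L * \<bar>y - x\<bar> * \<bar>K y - K x\<bar>" if "y \<in> ?S" for y
  proof (cases "x \<le> y")
    case True
    have "L * (y - x) * (K y - K x) \<le> L * \<bar>y - x\<bar> * \<bar>K y - K x\<bar>"
      using True L[of x] x by (simp add: mult_left_mono)
    then show ?thesis using est[of x y x] x that True by auto
  next
    case False
    have "\<bar>Q x - Q y - w x * (A x - A y)\<bar> \<le> L * (x - y) * (K x - K y)"
      using est[of y x x] x that False by auto
    also have "\<dots> \<le> L * \<bar>y - x\<bar> * \<bar>K y - K x\<bar>"
      using False L[of x] x by (simp add: mult_left_mono)
    also have "\<bar>Q x - Q y - w x * (A x - A y)\<bar> = \<bar>Q y - Q x - w x * (A y - A x)\<bar>"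
      by (simp add: abs_if algebra_simps)
    finally show ?thesis .
  qed
  have 1: "((\<lambda>y. (Q y - Q x - w x * (A y - A x)) / (y - x)) \<longlongrightarrow> 0) (at x within ?S)"
  proof (rule Lim_null_comparison)
    show "((\<lambda>y. L * \<bar>K y - K x\<bar>) \<longlongrightarrow> 0) (at x within ?S)"
    proof -
      have "(K \<longlongrightarrow> K x) (at x within ?S)" using Kc x by (simp add: continuous_on)
      then have "((\<lambda>y. L * \<bar>K y - K x\<bar>) \<longlongrightarrow> L * \<bar>K x - K x\<bar>) (at x within ?S)"
        by (intro tendsto_intros)
      then show ?thesis by simp
    qed
    show "\<forall>\<^sub>F y in at x within ?S. norm ((Q y - Q x - w x * (A y - A x)) / (y - x)) \<le> L * \<bar>K y - K x\<bar>"
      unfolding eventually_at_filter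
    proof (intro always_eventually allI impI)
      fix y assume "y \<noteq> x" "y \<in> ?S"
      with est'[of y] show "norm ((Q y - Q x - w x * (A y - A x)) / (y - x)) \<le> L * \<bar>K y - K x\<bar>"
        by (simp add: divide_le_eq algebra_simps)
    qed
  qed
  have 2: "((\<lambda>y. w x * ((A y - A x) / (y - x))) \<longlongrightarrow> w x * A' x) (at x within ?S)"
    using A[OF x] by (intro tendsto_intros) (simp add: has_field_derivative_iff)
  have "((\<lambda>y. (Q y - Q x) / (y - x)) \<longlongrightarrow> A' x * w x) (at x within ?S)"
  proof (rule Lim_transform_eventually)
    show "((\<lambda>y. (Q y - Q x - w x * (A y - A x)) / (y - x) + w x * ((A y - A x) / (y - x))) \<longlongrightarrow> A' x * w x) (at x within ?S)"
      using tendsto_add[OF 1 2] by (simp add: mult.commute)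
    show "\<forall>\<^sub>F y in at x within ?S. (Q y - Q x - w x * (A y - A x)) / (y - x) + w x * ((A y - A x) / (y - x)) = (Q y - Q x) / (y - x)"
      by (intro always_eventually allI) (simp add: add_divide_distrib[symmetric])
  qed
  then show ?thesis by (simp add: has_field_derivative_iff Q_def)
qed

lemma has_real_derivative_LBINT_linear:
  fixes g :: "real \<Rightarrow> real"
  assumes g: "set_integrable lborel {\<alpha>..\<beta>} g" and x: "x \<in> {\<alpha>..\<beta>}"
  shows "((\<lambda>x. LBINT s:{\<alpha>..x}. (x - s) * g s) has_real_derivative (LBINT s:{\<alpha>..x}. g s)) (at x within {\<alpha>..\<beta>})"
proof -
  have "((\<lambda>x. x * (LBINT s:{\<alpha>..x}. g s) - (LBINT s:{\<alpha>..x}. s * g s)) has_real_derivative 1 * (LBINT s:{\<alpha>..x}. g s)) (at x within {\<alpha>..\<beta>})"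
  proof (rule has_real_derivative_product_AC[OF g _ _ _ x, where A="\<lambda>x. x" and A'="\<lambda>_. 1"])
    fix y z assume "\<alpha> \<le> y" "y \<le> z" "z \<le> \<beta>"
    then show "(LBINT s:{\<alpha>..z}. g s) - (LBINT s:{\<alpha>..y}. g s) = (LBINT s:{y..z}. g s)"
      using LBINT_combine[of \<alpha> z g y] set_integrable_subset[OF g, of "{\<alpha>..z}"] by auto
  qed (auto intro: derivative_eq_intros)
  then have "((\<lambda>x. x * (LBINT s:{\<alpha>..x}. g s) - (LBINT s:{\<alpha>..x}. s * g s)) has_real_derivative (LBINT s:{\<alpha>..x}. g s)) (at x within {\<alpha>..\<beta>})"
    by simp
  then show ?thesis
  proof (rule has_field_derivative_transform_within[where d=1])
    fix y assume y: "y \<in> {\<alpha>..\<beta>}"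
    have "set_integrable lborel {\<alpha>..y} g" "set_integrable lborel {\<alpha>..y} (\<lambda>s. s * g s)"
      by (rule set_integrable_subset[OF g] set_integrable_subset[OF set_integrable_continuous_mult[OF g]];
          use y in \<open>auto intro: continuous_intros\<close>)+
    then show "y * (LBINT s:{\<alpha>..y}. g s) - (LBINT s:{\<alpha>..y}. s * g s) = (LBINT s:{\<alpha>..y}. (y - s) * g s)"
      by (simp add: left_diff_distrib)
  qed (use x in auto)
qed

subsection \<open>Slicing weak derivatives\<close>

definition prim :: "real \<Rightarrow> (real \<Rightarrow> real) \<Rightarrow> real \<Rightarrow> real" where
  "prim \<alpha> h s = integral {\<alpha>-1..s} h"

context
  fixes h :: "real \<Rightarrow> real" and \<alpha> :: real
  assumes h: "smooth h" and h0: "\<And>s. s \<le> \<alpha> \<Longrightarrow> h s = 0"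
begin

lemma prim_0: "s \<le> \<alpha> \<Longrightarrow> prim \<alpha> h s = 0"
  unfolding prim_def using integral_cong[of "{\<alpha>-1..s}" h "\<lambda>_. 0"] h0 by simp

lemma prim_eq_LBINT:
  assumes "\<alpha> \<le> s" shows "prim \<alpha> h s = (LBINT r:{\<alpha>..s}. h r)"
proof -
  have c: "continuous_on A h" for A using smooth_continuous[OF h] by (rule continuous_on_subset) simp
  have "integral {\<alpha>-1..\<alpha>} h + integral {\<alpha>..s} h = integral {\<alpha>-1..s} h"
    by (rule Henstock_Kurzweil_Integration.integral_combine)
       (use assms in \<open>auto intro!: integrable_continuous_real c\<close>)
  moreover have "integral {\<alpha>-1..\<alpha>} h = 0" using prim_0[of \<alpha>] by (simp add: prim_def)
  moreover have "(LBINT r:{\<alpha>..s}. h r) = integral {\<alpha>..s} h"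
    by (rule set_borel_integral_eq_integral) (rule borel_integrable_atLeastAtMost'[OF c])
  ultimately show ?thesis by (simp add: prim_def)
qed

lemma prim_has_real_derivative: "(prim \<alpha> h has_real_derivative h s) (at s)"
proof (cases "s < \<alpha>")
  case True
  have "((\<lambda>_. 0) has_real_derivative 0) (at s)" by simp
  then have "(prim \<alpha> h has_real_derivative 0) (at s)"
    by (rule has_field_derivative_transform_within_open[of _ _ _ "{..<\<alpha>}"])
       (use True in \<open>auto simp: prim_0\<close>)
  then show ?thesis using h0[of s] True by simp
next
  case False
  have c: "continuous_on {\<alpha>-1..s+1} h" using smooth_continuous[OF h] by (rule continuous_on_subset) simp
  have "((\<lambda>x. integral {\<alpha>-1..x} h) has_real_derivative h s) (at s within {\<alpha>-1..s+1})"
    by (rule integral_has_real_derivative[OF c]) (use False in auto)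
  then show ?thesis using at_within_Icc_at[of "\<alpha>-1" s "s+1"] False by (simp add: prim_def[abs_def])
qed

lemma smooth_prim: "smooth (prim \<alpha> h)"
  by (rule smooth_antiderivative[OF prim_has_real_derivative h])

end

lemma bump_0_left: "s \<le> \<alpha> \<Longrightarrow> bump \<alpha> \<beta> j s = 0" by (simp add: bump_zero)

lemma bump_set_integrable: "set_integrable lborel {a..b} (bump \<alpha> \<beta> j)"
  by (intro borel_integrable_atLeastAtMost' continuous_on_subset[OF smooth_continuous[OF smooth_bump]]) auto

lemma bump_LBINT_bounds:
  assumes "a \<le> b"
  shows "0 \<le> (LBINT r:{a..b}. bump \<alpha> \<beta> j r)" "(LBINT r:{a..b}. bump \<alpha> \<beta> j r) \<le> b - a"
proof -
  show "0 \<le> (LBINT r:{a..b}. bump \<alpha> \<beta> j r)"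
    unfolding set_lebesgue_integral_def by (simp add: bump_nonneg)
  have "(LBINT r:{a..b}. bump \<alpha> \<beta> j r) \<le> (LBINT r:{a..b}. 1)"
    by (rule set_integral_mono[OF bump_set_integrable borel_integrable_atLeastAtMost'])
       (auto simp: bump_le_1)
  then show "(LBINT r:{a..b}. bump \<alpha> \<beta> j r) \<le> b - a"
    using assms by (simp add: set_integral_const)
qed

lemma bump_LBINT_pos:
  assumes "\<alpha> < \<beta>" shows "0 < (LBINT r:{\<alpha>..\<beta>}. bump \<alpha> \<beta> j r)"
proof -
  have c: "continuous_on {\<alpha>..\<beta>} (bump \<alpha> \<beta> j)"
    by (rule continuous_on_subset[OF smooth_continuous[OF smooth_bump]]) auto
  have "integral {\<alpha>..\<beta>} (bump \<alpha> \<beta> j) \<noteq> 0"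
  proof
    assume "integral {\<alpha>..\<beta>} (bump \<alpha> \<beta> j) = 0"
    then have "bump \<alpha> \<beta> j ((\<alpha>+\<beta>)/2) = 0"
      using integral_eq_0_iff[OF c] assms by (auto simp: bump_nonneg)
    then show False using bump_pos[of \<alpha> "(\<alpha>+\<beta>)/2" \<beta> j] assms by auto
  qed
  then show ?thesis
    using set_borel_integral_eq_integral(2)[OF bump_set_integrable, of \<alpha> \<beta> \<alpha> \<beta> j]
      bump_LBINT_bounds(1)[of \<alpha> \<beta> \<alpha> \<beta> j] assms by linarith
qed

lemma bump_LBINT_tendsto:
  assumes "\<alpha> \<le> s" "\<alpha> < x"
  shows "(\<lambda>j. LBINT r:{\<alpha>..s}. bump \<alpha> x j r) \<longlonglongrightarrow> min s x - \<alpha>"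
proof -
  have "(\<lambda>j. \<integral>r. indicator {\<alpha>..s} r * bump \<alpha> x j r \<partial>lborel) \<longlonglongrightarrow> (\<integral>r. indicator {\<alpha>..s} r * indicator {\<alpha><..<x} r \<partial>lborel)"
  proof (rule integral_dominated_convergence[where w="indicator {\<alpha>..s}"])
    show "(\<lambda>r. indicator {\<alpha>..s} r * bump \<alpha> x j r) \<in> borel_measurable lborel" for j
      using bump_set_integrable[of \<alpha> s \<alpha> x j] by (simp add: set_integrable_def borel_measurable_integrable)
    show "AE r in lborel. (\<lambda>j. indicator {\<alpha>..s} r * bump \<alpha> x j r) \<longlonglongrightarrow> indicator {\<alpha>..s} r * indicator {\<alpha><..<x} r"
      by (intro AE_I2 tendsto_intros bump_tendsto)
    show "AE r in lborel. norm (indicator {\<alpha>..s} r * bump \<alpha> x j r) \<le> indicator {\<alpha>..s} r" for j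
      by (auto simp: bump_nonneg bump_le_1 split: split_indicator)
    show "integrable lborel (indicat_real {\<alpha>..s})"
      using borel_integrable_atLeastAtMost'[of \<alpha> s "\<lambda>_. 1::real"] by (simp add: set_integrable_def)
  qed auto
  moreover have "(\<integral>r. indicator {\<alpha>..s} r * indicator {\<alpha><..<x} r \<partial>lborel) = min s x - \<alpha>"
  proof -
    have "AE r in lborel. r \<noteq> \<alpha>" "AE r in lborel. r \<noteq> x" by (rule AE_lborel_singleton)+
    then have "(\<integral>r. indicator {\<alpha>..s} r * indicator {\<alpha><..<x} r \<partial>lborel) = (\<integral>r. indicat_real {\<alpha>..min s x} r \<partial>lborel)"
      by (intro integral_cong_AE; (measurable; fail)?) (auto elim!: AE_mp split: split_indicator)
    also have "\<dots> = min s x - \<alpha>" using assms by simp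
    finally show ?thesis .
  qed
  ultimately show ?thesis by (simp add: set_lebesgue_integral_def)
qed

lemma pd_product:
  fixes \<psi> \<theta> :: "real \<Rightarrow> real"
  assumes "smooth \<psi>" "smooth \<theta>"
  shows "smooth (\<lambda>p. \<psi> (fst p) * \<theta> (snd p))"
    "pd (0,1) (\<lambda>p. \<psi> (fst p) * \<theta> (snd p)) = (\<lambda>p. \<psi> (fst p) * pd 1 \<theta> (snd p))"
proof -
  show "smooth (\<lambda>p. \<psi> (fst p) * \<theta> (snd p))"
    using smooth_mult[OF smooth_affine_comp[OF bounded_linear_fst assms(1), of 0] smooth_affine_comp[OF bounded_linear_snd assms(2), of 0]]
    by simp
  show "pd (0,1) (\<lambda>p. \<psi> (fst p) * \<theta> (snd p)) = (\<lambda>p. \<psi> (fst p) * pd 1 \<theta> (snd p))"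
  proof
    fix p :: "real \<times> real"
    have "((\<lambda>p. \<psi> (fst p)) has_derivative (\<lambda>v. pd 1 \<psi> (fst p) * fst v)) (at p)"
      using has_derivative_compose[OF bounded_linear_imp_has_derivative[OF bounded_linear_fst]
          smooth_has_real_derivative[OF assms(1), of "fst p", unfolded has_field_derivative_def]] by simp
    moreover have "((\<lambda>p. \<theta> (snd p)) has_derivative (\<lambda>v. pd 1 \<theta> (snd p) * snd v)) (at p)"
      using has_derivative_compose[OF bounded_linear_imp_has_derivative[OF bounded_linear_snd]
          smooth_has_real_derivative[OF assms(2), of "snd p", unfolded has_field_derivative_def]] by simp
    ultimately have "((\<lambda>p. \<psi> (fst p) * \<theta> (snd p)) has_derivative
      (\<lambda>v. \<psi> (fst p) * (pd 1 \<theta> (snd p) * snd v) + (pd 1 \<psi> (fst p) * fst v) * \<theta> (snd p))) (at p)"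
      by (rule has_derivative_mult)
    from pd_eqI[OF this, of "(0,1)"]
    show "pd (0,1) (\<lambda>p. \<psi> (fst p) * \<theta> (snd p)) p = \<psi> (fst p) * pd 1 \<theta> (snd p)" by simp
  qed
qed

lemma weak_deriv_slice_tested:
  fixes f g :: "real \<times> real \<Rightarrow> real"
  assumes wd: "weak_deriv U (0, 1) f g" and R: "{t1..t2} \<times> {\<alpha>..\<beta>} \<subseteq> U"
    and x: "\<alpha> < x" "x \<le> \<beta>" and \<tau>: "t1 \<le> \<tau>1" "\<tau>2 \<le> t2"
    and l: "l * (LBINT r:{\<alpha>..\<beta>}. bump \<alpha> \<beta> 0 r) = x - \<alpha>"
  shows "(LBINT p:{t1..t2} \<times> {\<alpha>..\<beta>}. indicator {\<tau>1<..<\<tau>2} (fst p) *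
     (f p * (indicator {\<alpha><..<x} (snd p) - l * bump \<alpha> \<beta> 0 (snd p)) +
      g p * (min (snd p) x - \<alpha> - l * (LBINT r:{\<alpha>..snd p}. bump \<alpha> \<beta> 0 r)))) = 0"
proof -
  define K where "K = {t1..t2} \<times> {\<alpha>..\<beta>}"
  define \<kappa> where "\<kappa> = bump \<alpha> \<beta> 0"
  define k where "k = prim \<alpha> \<kappa>"
  define c where "c = (LBINT r:{\<alpha>..\<beta>}. \<kappa> r)"
  have ab: "\<alpha> < \<beta>" using x by simp
  have c: "0 < c" unfolding c_def \<kappa>_def by (rule bump_LBINT_pos[OF ab])
  define \<Lambda> where "\<Lambda> j = (LBINT r:{\<alpha>..\<beta>}. bump \<alpha> x j r) / c" for j
  define \<theta>' where "\<theta>' j s = bump \<alpha> x j s - \<Lambda> j * \<kappa> s" for j s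
  define \<theta> where "\<theta> j s = prim \<alpha> (bump \<alpha> x j) s - \<Lambda> j * k s" for j s
  have lam: "l = (x - \<alpha>) / c" using l c by (simp add: c_def \<kappa>_def field_simps)
  have sm\<kappa>: "smooth \<kappa>" by (simp add: \<kappa>_def smooth_bump)
  have der: "(\<theta> j has_real_derivative \<theta>' j s) (at s)" for j s
    unfolding \<theta>_def \<theta>'_def k_def \<kappa>_def
    by (intro DERIV_diff DERIV_cmult prim_has_real_derivative smooth_bump bump_0_left)
  have sm\<theta>': "smooth (\<theta>' j)" for j
    unfolding \<theta>'_def by (intro smooth_diff smooth_mult smooth_const smooth_bump sm\<kappa>)
  have sm\<theta>: "smooth (\<theta> j)" for j by (rule smooth_antiderivative[OF der sm\<theta>'])
  have pd\<theta>: "pd 1 (\<theta> j) = \<theta>' j" for j using pd_real[OF der] by blast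
  have primL: "prim \<alpha> (bump \<alpha> y j) s = (LBINT r:{\<alpha>..s}. bump \<alpha> y j r)" if "\<alpha> \<le> s" for s y j
    by (rule prim_eq_LBINT[OF smooth_bump bump_0_left that])
  have \<theta>0: "\<theta> j s = 0" if "s \<notin> {\<alpha>..\<beta>}" for j s
  proof (cases "s \<le> \<alpha>")
    case True
    then show ?thesis by (simp add: \<theta>_def k_def \<kappa>_def prim_0[OF smooth_bump bump_0_left])
  next
    case False
    have *: "(LBINT r:{\<alpha>..s}. bump \<alpha> y j r) = (LBINT r:{\<alpha>..\<beta>}. bump \<alpha> y j r)" if "y \<le> \<beta>" for y j
      unfolding set_lebesgue_integral_def
      by (intro Bochner_Integration.integral_cong) (use that False \<open>s \<notin> _\<close> in \<open>auto simp: bump_zero split: split_indicator\<close>)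
    show ?thesis
      unfolding \<theta>_def k_def \<kappa>_def using False primL[of s] *[OF x(2)] *[of \<beta>] c
      by (simp add: \<Lambda>_def c_def \<kappa>_def)
  qed
  define \<phi> where "\<phi> j p = bump \<tau>1 \<tau>2 j (fst p) * \<theta> j (snd p)" for j and p :: "real \<times> real"
  have tf: "test_fun U (\<phi> j)" for j
  proof (rule test_funI)
    show "smooth (\<phi> j)" unfolding \<phi>_def by (rule pd_product(1)[OF smooth_bump sm\<theta>])
    show "compact K" unfolding K_def by (intro compact_Times compact_Icc)
    show "K \<subseteq> U" using R by (simp add: K_def)
    show "\<phi> j p = 0" if "p \<notin> K" for p
      using that \<theta>0[of "snd p" j] bump_zero[of "fst p" \<tau>1 \<tau>2 j] \<tau>
      by (cases p) (auto simp: K_def \<phi>_def)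
  qed
  have pd\<phi>: "pd (0,1) (\<phi> j) p = bump \<tau>1 \<tau>2 j (fst p) * \<theta>' j (snd p)" for j p
    unfolding \<phi>_def[abs_def] pd_product(2)[OF smooth_bump sm\<theta>] pd\<theta> ..
  have \<theta>'0: "\<theta>' j s = 0" if "s \<notin> {\<alpha>..\<beta>}" for j s
    using that x by (auto simp: \<theta>'_def \<kappa>_def bump_zero)
  have KU: "compact K" "K \<subseteq> U" using R by (auto simp: K_def compact_Times)
  have fK: "set_integrable lborel K f" and gK: "set_integrable lborel K g"
    using wd KU unfolding weak_deriv_def loc_integrable_def by auto
  define F where "F p = indicator K p * f p" for p
  define G where "G p = indicator K p * g p" for p
  have Fi: "integrable lborel F" and Gi: "integrable lborel G"
    using fK gK by (simp_all add: F_def[abs_def] G_def[abs_def] set_integrable_def)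
  have [measurable]: "F \<in> borel_measurable borel" "G \<in> borel_measurable borel"
    using borel_measurable_integrable[OF Fi] borel_measurable_integrable[OF Gi] by simp_all
  have cont[measurable]: "bump a b j \<in> borel_measurable borel" "\<theta> j \<in> borel_measurable borel" 
     "\<theta>' j \<in> borel_measurable borel" "\<kappa> \<in> borel_measurable borel" "k \<in> borel_measurable borel" for a b j
    by (auto intro!: borel_measurable_continuous_onI smooth_continuous smooth_bump sm\<theta> sm\<theta>' sm\<kappa>
        smooth_prim[OF smooth_bump bump_0_left] simp: k_def \<kappa>_def)
  have Lam: "0 \<le> \<Lambda> j" "\<Lambda> j \<le> (\<beta> - \<alpha>) / c" for j
    unfolding \<Lambda>_def using bump_LBINT_bounds[of \<alpha> \<beta> \<alpha> x j] ab c by (auto intro!: divide_right_mono)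
  define M where "M = (1 + (\<beta> - \<alpha>) / c)"
  have M: "1 \<le> M" using ab c by (simp add: M_def)
  have b1: "\<bar>\<theta>' j s\<bar> \<le> M" for j s
  proof -
    have "\<bar>\<theta>' j s\<bar> \<le> 1 + \<Lambda> j * 1"
      unfolding \<theta>'_def \<kappa>_def using Lam(1)[of j] bump_nonneg bump_le_1
      by (intro order_trans[OF abs_triangle_ineq4] add_mono) (auto simp: abs_mult intro!: mult_left_le)
    then show ?thesis using Lam(2)[of j] by (simp add: M_def)
  qed
  have b2: "\<bar>\<theta> j s\<bar> \<le> M * (\<beta> - \<alpha>)" if "s \<in> {\<alpha>..\<beta>}" for j s
  proof -
    have 1: "0 \<le> prim \<alpha> (bump \<alpha> y i) s" "prim \<alpha> (bump \<alpha> y i) s \<le> \<beta> - \<alpha>" for y i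
      using bump_LBINT_bounds[of \<alpha> s \<alpha> y i] that primL[of s] by auto
    have "\<bar>\<theta> j s\<bar> \<le> (\<beta> - \<alpha>) + \<Lambda> j * (\<beta> - \<alpha>)"
      unfolding \<theta>_def k_def \<kappa>_def using Lam(1)[of j] 1
      by (intro order_trans[OF abs_triangle_ineq4] add_mono) (auto simp: abs_mult intro!: mult_left_mono)
    also have "\<dots> \<le> M * (\<beta> - \<alpha>)"
      using mult_right_mono[OF Lam(2)[of j], of "\<beta> - \<alpha>"] ab by (simp add: M_def distrib_right)
    finally show ?thesis .
  qed
  define H where "H j p = bump \<tau>1 \<tau>2 j (fst p) * (F p * \<theta>' j (snd p) + G p * \<theta> j (snd p))" for j p
  define H0 where "H0 p = indicator {\<tau>1<..<\<tau>2} (fst p) *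
     (F p * (indicator {\<alpha><..<x} (snd p) - l * \<kappa> (snd p)) + G p * (min (snd p) x - \<alpha> - l * k (snd p)))" for p
  have bdF: "\<bar>bump \<tau>1 \<tau>2 j (fst p) * (F p * \<theta>' j (snd p))\<bar> \<le> M * \<bar>F p\<bar>" for j p
  proof -
    have "\<bar>bump \<tau>1 \<tau>2 j (fst p)\<bar> * (\<bar>F p\<bar> * \<bar>\<theta>' j (snd p)\<bar>) \<le> 1 * (\<bar>F p\<bar> * M)"
      by (intro mult_mono b1) (use M in \<open>auto simp: bump_nonneg bump_le_1\<close>)
    then show ?thesis by (simp add: abs_mult mult.commute)
  qed
  have bdG: "\<bar>bump \<tau>1 \<tau>2 j (fst p) * (G p * \<theta> j (snd p))\<bar> \<le> M * (\<beta> - \<alpha>) * \<bar>G p\<bar>" for j p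
  proof (cases "p \<in> K")
    case True
    have "\<bar>bump \<tau>1 \<tau>2 j (fst p)\<bar> * (\<bar>G p\<bar> * \<bar>\<theta> j (snd p)\<bar>) \<le> 1 * (\<bar>G p\<bar> * (M * (\<beta> - \<alpha>)))"
      by (intro mult_mono b2) (use M ab True in \<open>auto simp: bump_nonneg bump_le_1 K_def\<close>)
    then show ?thesis by (simp add: abs_mult mult.commute)
  qed (simp add: G_def)
  have [measurable]: "(fst :: real \<times> real \<Rightarrow> real) \<in> borel_measurable borel"
    "(snd :: real \<times> real \<Rightarrow> real) \<in> borel_measurable borel"
    by (auto intro!: borel_measurable_continuous_onI continuous_intros)
  have mF: "(\<lambda>p. bump \<tau>1 \<tau>2 j (fst p) * (F p * \<theta>' j (snd p))) \<in> borel_measurable lborel" for j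
    by measurable
  have mG: "(\<lambda>p. bump \<tau>1 \<tau>2 j (fst p) * (G p * \<theta> j (snd p))) \<in> borel_measurable lborel" for j
    by measurable
  have i1: "integrable lborel (\<lambda>p. bump \<tau>1 \<tau>2 j (fst p) * (F p * \<theta>' j (snd p)))" for j
    by (rule Bochner_Integration.integrable_bound[of _ "\<lambda>p. M * F p", OF _ mF])
       (use Fi bdF M in \<open>auto simp: abs_mult intro!: AE_I2\<close>)
  have i2: "integrable lborel (\<lambda>p. bump \<tau>1 \<tau>2 j (fst p) * (G p * \<theta> j (snd p)))" for j
    by (rule Bochner_Integration.integrable_bound[of _ "\<lambda>p. M * (\<beta> - \<alpha>) * G p", OF _ mG])
       (use Gi bdG M ab in \<open>auto simp: abs_mult intro!: AE_I2\<close>)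
  have zero: "(\<integral>p. H j p \<partial>lborel) = 0" for j
  proof -
    have "(LBINT p:U. f p * pd (0,1) (\<phi> j) p) = - (LBINT p:U. g p * \<phi> j p)"
      using wd tf[of j] unfolding weak_deriv_def by blast
    moreover have "(LBINT p:U. f p * pd (0,1) (\<phi> j) p) = (\<integral>p. bump \<tau>1 \<tau>2 j (fst p) * (F p * \<theta>' j (snd p)) \<partial>lborel)"
      unfolding set_lebesgue_integral_def
    proof (intro Bochner_Integration.integral_cong refl)
      fix p show "indicator U p *\<^sub>R (f p * pd (0,1) (\<phi> j) p) = bump \<tau>1 \<tau>2 j (fst p) * (F p * \<theta>' j (snd p))"
        using KU(2) \<theta>'0[of "snd p" j] bump_zero[of "fst p" \<tau>1 \<tau>2 j] \<tau>
        by (cases "p \<in> K") (auto simp: pd\<phi> F_def K_def mem_Times_iff split: split_indicator)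
    qed
    moreover have "(LBINT p:U. g p * \<phi> j p) = (\<integral>p. bump \<tau>1 \<tau>2 j (fst p) * (G p * \<theta> j (snd p)) \<partial>lborel)"
      unfolding set_lebesgue_integral_def
    proof (intro Bochner_Integration.integral_cong refl)
      fix p show "indicator U p *\<^sub>R (g p * \<phi> j p) = bump \<tau>1 \<tau>2 j (fst p) * (G p * \<theta> j (snd p))"
        using KU(2) \<theta>0[of "snd p" j] bump_zero[of "fst p" \<tau>1 \<tau>2 j] \<tau>
        by (cases "p \<in> K") (auto simp: \<phi>_def G_def K_def mem_Times_iff split: split_indicator)
    qed
    ultimately show ?thesis
      using i1[of j] i2[of j] by (simp add: H_def distrib_left)
  qed
  have lim: "(\<lambda>j. \<integral>p. H j p \<partial>lborel) \<longlonglongrightarrow> (\<integral>p. H0 p \<partial>lborel)"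
  proof (rule integral_dominated_convergence[where w="\<lambda>p. M * \<bar>F p\<bar> + M * (\<beta> - \<alpha>) * \<bar>G p\<bar>"])
    show "H0 \<in> borel_measurable lborel" "\<And>j. H j \<in> borel_measurable lborel"
      unfolding H0_def H_def by measurable
    show "integrable lborel (\<lambda>p. M * \<bar>F p\<bar> + M * (\<beta> - \<alpha>) * \<bar>G p\<bar>)" using Fi Gi by simp
    show "AE p in lborel. norm (H j p) \<le> M * \<bar>F p\<bar> + M * (\<beta> - \<alpha>) * \<bar>G p\<bar>" for j
      unfolding H_def distrib_left real_norm_def
      by (intro AE_I2 order_trans[OF abs_triangle_ineq] add_mono bdF bdG)
    show "AE p in lborel. (\<lambda>j. H j p) \<longlonglongrightarrow> H0 p"
    proof (rule AE_I2)
      fix p :: "real \<times> real"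
      show "(\<lambda>j. H j p) \<longlonglongrightarrow> H0 p"
      proof (cases "p \<in> K")
        case False then show ?thesis by (simp add: H_def H0_def F_def G_def)
      next
        case True
        then have s: "\<alpha> \<le> snd p" by (auto simp: K_def)
        have "(\<lambda>j. \<Lambda> j) \<longlonglongrightarrow> l"
          unfolding \<Lambda>_def lam using bump_LBINT_tendsto[of \<alpha> \<beta> x] x c
          by (intro tendsto_divide tendsto_const) auto
        moreover have "(\<lambda>j. prim \<alpha> (bump \<alpha> x j) (snd p)) \<longlonglongrightarrow> min (snd p) x - \<alpha>"
          using bump_LBINT_tendsto[OF s x(1)] primL[OF s] by simp
        ultimately show ?thesis
          unfolding H_def H0_def \<theta>_def \<theta>'_def by (intro tendsto_intros bump_tendsto)
      qed
    qed
  qed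
  have "(\<integral>p. H0 p \<partial>lborel) = 0"
    using lim unfolding zero by (simp add: LIMSEQ_const_iff)
  moreover have "(\<integral>p. H0 p \<partial>lborel) = (LBINT p:{t1..t2} \<times> {\<alpha>..\<beta>}. indicator {\<tau>1<..<\<tau>2} (fst p) *
     (f p * (indicator {\<alpha><..<x} (snd p) - l * bump \<alpha> \<beta> 0 (snd p)) +
      g p * (min (snd p) x - \<alpha> - l * (LBINT r:{\<alpha>..snd p}. bump \<alpha> \<beta> 0 r))))"
    unfolding K_def[symmetric] unfolding set_lebesgue_integral_def[where A=K]
  proof (intro Bochner_Integration.integral_cong refl)
    fix p
    show "H0 p = indicator K p *\<^sub>R (indicator {\<tau>1<..<\<tau>2} (fst p) *
     (f p * (indicator {\<alpha><..<x} (snd p) - l * bump \<alpha> \<beta> 0 (snd p)) +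
      g p * (min (snd p) x - \<alpha> - l * (LBINT r:{\<alpha>..snd p}. bump \<alpha> \<beta> 0 r))))"
    proof (cases "p \<in> K")
      case True
      then have "\<alpha> \<le> snd p" by (auto simp: K_def)
      then show ?thesis using True primL[of "snd p" \<beta> 0] by (simp add: H0_def F_def G_def \<kappa>_def k_def)
    qed (simp add: H0_def F_def G_def)
  qed
  ultimately show ?thesis by simp
qed

lemma set_integral_cong_AE_on:
  assumes "set_borel_measurable M A f" "set_borel_measurable M A g" "AE x in M. x \<in> A \<longrightarrow> f x = g x"
  shows "(LINT x:A|M. f x) = (LINT x:A|M. g x)"
  unfolding set_lebesgue_integral_def
proof (rule integral_cong_AE)
  show "AE x in M. indicator A x *\<^sub>R f x = indicator A x *\<^sub>R g x"
    using assms(3) by eventually_elim (auto split: split_indicator)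
qed (use assms in \<open>auto simp: set_borel_measurable_def\<close>)

lemma has_real_derivative_affine_LBINT:
  fixes g :: "real \<Rightarrow> real"
  assumes "set_integrable lborel {\<alpha>..\<beta>} g" "x \<in> {\<alpha>..\<beta>}"
  shows "((\<lambda>x. c * (x - \<alpha>) + (LBINT s:{\<alpha>..x}. (x - s) * g s)) has_real_derivative
    c + (LBINT s:{\<alpha>..x}. g s)) (at x within {\<alpha>..\<beta>})"
proof (rule DERIV_add[OF _ has_real_derivative_LBINT_linear[OF assms]])
  show "((\<lambda>x. c * (x - \<alpha>)) has_real_derivative c) (at x within {\<alpha>..\<beta>})"
    by (auto intro!: derivative_eq_intros)
qed

lemma weak_deriv_slice_AE:
  fixes f g :: "real \<times> real \<Rightarrow> real"
  assumes wd: "weak_deriv U (0, 1) f g" and R: "{t1..t2} \<times> {\<alpha>..\<beta>} \<subseteq> U" and ab: "\<alpha> < \<beta>"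
  shows "AE t in lborel. t \<in> {t1<..<t2} \<longrightarrow>
    set_integrable lborel {\<alpha>..\<beta>} (\<lambda>s. f (t, s)) \<and> set_integrable lborel {\<alpha>..\<beta>} (\<lambda>s. g (t, s)) \<and>
    (\<exists>c. \<forall>x\<in>{\<alpha>..\<beta>}. (LBINT s:{\<alpha>..x}. f (t, s)) = c * (x - \<alpha>) + (LBINT s:{\<alpha>..x}. (x - s) * g (t, s)))"
proof -
  define K where "K = {t1..t2} \<times> {\<alpha>..\<beta>}"
  define \<kappa> where "\<kappa> = bump \<alpha> \<beta> 0"
  define k where "k s = (LBINT r:{\<alpha>..s}. \<kappa> r)" for s
  define c0 where "c0 = (LBINT r:{\<alpha>..\<beta>}. \<kappa> r)"
  have c0: "0 < c0" unfolding c0_def \<kappa>_def by (rule bump_LBINT_pos[OF ab])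
  define l where "l x = (x - \<alpha>) / c0" for x
  have KU: "compact K" "K \<subseteq> U" using R by (auto simp: K_def compact_Times)
  define F where "F p = indicator K p * f p" for p
  define G where "G p = indicator K p * g p" for p
  have Fi: "integrable lborel F" and Gi: "integrable lborel G"
    using wd KU unfolding weak_deriv_def loc_integrable_def set_integrable_def F_def[abs_def] G_def[abs_def] by auto
  have [measurable]: "F \<in> borel_measurable borel" "G \<in> borel_measurable borel"
    using borel_measurable_integrable[OF Fi] borel_measurable_integrable[OF Gi] by simp_all
  have kb: "0 \<le> k s" "k s \<le> \<beta> - \<alpha>" if "s \<in> {\<alpha>..\<beta>}" for s
    using bump_LBINT_bounds[of \<alpha> s \<alpha> \<beta> 0] that by (auto simp: k_def \<kappa>_def)
  have kc: "continuous_on {\<alpha>..\<beta>} k"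
    unfolding k_def \<kappa>_def by (intro continuous_on_LBINT bump_set_integrable)
  define k' where "k' s = indicator {\<alpha>..\<beta>} s * k s" for s
  have [measurable]: "k' \<in> borel_measurable borel"
    using borel_measurable_continuous_on_indicator[OF _ kc] by (simp add: k'_def[abs_def])
  have [measurable]: "\<kappa> \<in> borel_measurable borel"
    unfolding \<kappa>_def by (intro borel_measurable_continuous_onI smooth_continuous smooth_bump)
  have [measurable]: "(fst :: real \<times> real \<Rightarrow> real) \<in> borel_measurable borel"
    "(snd :: real \<times> real \<Rightarrow> real) \<in> borel_measurable borel"
    by (auto intro!: borel_measurable_continuous_onI continuous_intros)
  define h where "h x p = F p * (indicator {\<alpha><..<x} (snd p) - l x * \<kappa> (snd p)) +
      G p * (min (max \<alpha> (snd p)) x - \<alpha> - l x * k' (snd p))" for x p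
  have hint: "integrable lborel (h x)" if x: "x \<in> {\<alpha><..\<beta>}" for x
  proof -
    have l: "0 \<le> l x" "l x \<le> (\<beta> - \<alpha>) / c0" using x c0 by (auto simp: l_def intro!: divide_right_mono)
    show ?thesis unfolding h_def
    proof (rule Bochner_Integration.integrable_add)
      show "integrable lborel (\<lambda>p. F p * (indicator {\<alpha><..<x} (snd p) - l x * \<kappa> (snd p)))"
      proof (rule Bochner_Integration.integrable_bound[of _ "\<lambda>p. (1 + l x) * F p"])
        have "\<bar>indicator {\<alpha><..<x} s - l x * \<kappa> s\<bar> \<le> 1 + l x" for s
          using l(1) bump_nonneg[of \<alpha> \<beta> 0 s] bump_le_1[of \<alpha> \<beta> 0 s]
          by (intro order_trans[OF abs_triangle_ineq4] add_mono)
             (auto simp: abs_mult \<kappa>_def intro!: mult_left_le split: split_indicator)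
        then show "AE p in lborel. norm (F p * (indicator {\<alpha><..<x} (snd p) - l x * \<kappa> (snd p))) \<le> norm ((1 + l x) * F p)"
          using l(1) by (auto simp: abs_mult mult.commute intro!: mult_left_mono)
        show "(\<lambda>p. F p * (indicator {\<alpha><..<x} (snd p) - l x * \<kappa> (snd p))) \<in> borel_measurable lborel"
          by measurable
      qed (use Fi in auto)
      show "integrable lborel (\<lambda>p. G p * (min (max \<alpha> (snd p)) x - \<alpha> - l x * k' (snd p)))"
      proof (rule Bochner_Integration.integrable_bound[of _ "\<lambda>p. ((\<beta> - \<alpha>) + l x * (\<beta> - \<alpha>)) * G p"])
        have *: "\<bar>min (max \<alpha> s) x - \<alpha> - l x * k' s\<bar> \<le> (\<beta> - \<alpha>) + l x * (\<beta> - \<alpha>)" for s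
          using l(1) kb[of s] x ab
          by (intro order_trans[OF abs_triangle_ineq4[of "min (max \<alpha> s) x - \<alpha>"]] add_mono)
             (auto simp: abs_mult k'_def intro!: mult_left_mono split: split_indicator)
        have "0 \<le> (\<beta> - \<alpha>) + l x * (\<beta> - \<alpha>)" using l(1) ab by simp
        then show "AE p in lborel. norm (G p * (min (max \<alpha> (snd p)) x - \<alpha> - l x * k' (snd p))) \<le> norm (((\<beta> - \<alpha>) + l x * (\<beta> - \<alpha>)) * G p)"
          using * by (simp add: abs_mult mult.commute[of "\<bar>G _\<bar>"] mult_right_mono del: distrib_right distrib_left)
        show "(\<lambda>p. G p * (min (max \<alpha> (snd p)) x - \<alpha> - l x * k' (snd p))) \<in> borel_measurable lborel"
          by measurable
      qed (use Gi in auto)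
    qed
  qed
  have hint2: "integrable (lborel \<Otimes>\<^sub>M lborel) (h x)" if "x \<in> {\<alpha><..\<beta>}" for x
    using hint[OF that] by (simp add: lborel_prod)
  have h0: "AE t in lborel. t \<in> {t1<..<t2} \<longrightarrow> (\<integral>s. h x (t, s) \<partial>lborel) = 0" if x: "x \<in> {\<alpha><..\<beta>}" for x
  proof (rule AE_eq_0_if_interval_integrals_0)
    have it: "integrable lborel (\<lambda>t. \<integral>s. h x (t, s) \<partial>lborel)"
      by (rule lborel_pair.integrable_fst'[OF hint2[OF x]])
    then show "set_integrable lborel {t1<..<t2} (\<lambda>t. \<integral>s. h x (t, s) \<partial>lborel)"
      unfolding set_integrable_def by (rule integrable_mult_indicator[rotated]) simp
    fix \<tau>1 \<tau>2 assume \<tau>: "t1 \<le> \<tau>1" "\<tau>1 < \<tau>2" "\<tau>2 \<le> t2"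
    have i: "integrable lborel (\<lambda>p. indicator {\<tau>1<..<\<tau>2} (fst p) * h x p)"
      by (rule Bochner_Integration.integrable_bound[OF hint[OF x]])
         (use borel_measurable_integrable[OF hint[OF x]] in \<open>auto split: split_indicator\<close>)
    have "(\<integral>p. indicator {\<tau>1<..<\<tau>2} (fst p) * h x p \<partial>lborel) = 0"
    proof -
      have "(\<integral>p. indicator {\<tau>1<..<\<tau>2} (fst p) * h x p \<partial>lborel) = (LBINT p:{t1..t2} \<times> {\<alpha>..\<beta>}. indicator {\<tau>1<..<\<tau>2} (fst p) *
     (f p * (indicator {\<alpha><..<x} (snd p) - l x * bump \<alpha> \<beta> 0 (snd p)) +
      g p * (min (snd p) x - \<alpha> - l x * (LBINT r:{\<alpha>..snd p}. bump \<alpha> \<beta> 0 r))))"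
        unfolding K_def[symmetric] unfolding set_lebesgue_integral_def[where A=K]
      proof (intro Bochner_Integration.integral_cong refl)
        fix p
        show "indicator {\<tau>1<..<\<tau>2} (fst p) * h x p = indicator K p *\<^sub>R (indicator {\<tau>1<..<\<tau>2} (fst p) *
     (f p * (indicator {\<alpha><..<x} (snd p) - l x * bump \<alpha> \<beta> 0 (snd p)) +
      g p * (min (snd p) x - \<alpha> - l x * (LBINT r:{\<alpha>..snd p}. bump \<alpha> \<beta> 0 r))))"
          by (cases "p \<in> K") (auto simp: h_def F_def G_def \<kappa>_def k_def k'_def K_def max_def)
      qed
      also have "\<dots> = 0"
      proof (rule weak_deriv_slice_tested[OF wd R _ _ \<tau>(1) \<tau>(3)])
        show "l x * (LBINT r:{\<alpha>..\<beta>}. bump \<alpha> \<beta> 0 r) = x - \<alpha>"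
          using c0 by (simp add: l_def c0_def \<kappa>_def)
      qed (use x in auto)
      finally show ?thesis .
    qed
    then have "(\<integral>t. \<integral>s. indicator {\<tau>1<..<\<tau>2} (fst (t, s)) * h x (t, s) \<partial>lborel \<partial>lborel) = 0"
      using lborel_pair.integral_fst'[of "\<lambda>p. indicator {\<tau>1<..<\<tau>2} (fst p) * h x p"] i
      by (simp add: lborel_prod)
    then show "(LBINT t:{\<tau>1<..<\<tau>2}. \<integral>s. h x (t, s) \<partial>lborel) = 0"
      by (simp add: set_lebesgue_integral_def)
  qed
  have "AE t in lborel. \<forall>x\<in>\<rat> \<inter> {\<alpha><..\<beta>}. t \<in> {t1<..<t2} \<longrightarrow> (\<integral>s. h x (t, s) \<partial>lborel) = 0"
    by (rule AE_ball_countable') (use h0 countable_rat in auto)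
  moreover have "AE t in lborel. integrable lborel (\<lambda>s. F (t, s))" "AE t in lborel. integrable lborel (\<lambda>s. G (t, s))"
    using lborel_pair.AE_integrable_fst'[of F] lborel_pair.AE_integrable_fst'[of G] Fi Gi by (auto simp: lborel_prod)
  ultimately show ?thesis
  proof (eventually_elim, intro impI conjI)
    fix t assume h0: "\<forall>x\<in>\<rat> \<inter> {\<alpha><..\<beta>}. t \<in> {t1<..<t2} \<longrightarrow> (\<integral>s. h x (t, s) \<partial>lborel) = 0"
      and Ft: "integrable lborel (\<lambda>s. F (t, s))" and Gt: "integrable lborel (\<lambda>s. G (t, s))"
      and t: "t \<in> {t1<..<t2}"
    have Fe: "F (t, s) = indicator {\<alpha>..\<beta>} s * f (t, s)" and Ge: "G (t, s) = indicator {\<alpha>..\<beta>} s * g (t, s)" for s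
      using t by (auto simp: F_def G_def K_def split: split_indicator)
    show f: "set_integrable lborel {\<alpha>..\<beta>} (\<lambda>s. f (t, s))" and g: "set_integrable lborel {\<alpha>..\<beta>} (\<lambda>s. g (t, s))"
      using Ft Gt by (simp_all add: Fe Ge set_integrable_def)
    define c where "c = ((LBINT s:{\<alpha>..\<beta>}. \<kappa> s * f (t, s)) + (LBINT s:{\<alpha>..\<beta>}. k s * g (t, s))) / c0 - (LBINT s:{\<alpha>..\<beta>}. g (t, s))"
    define E where "E x = (LBINT s:{\<alpha>..x}. f (t, s)) - c * (x - \<alpha>) - (LBINT s:{\<alpha>..x}. (x - s) * g (t, s))" for x
    have Ec: "continuous_on {\<alpha>..\<beta>} E"
      unfolding E_def
      by (intro continuous_intros continuous_on_LBINT f DERIV_continuous_on[OF has_real_derivative_LBINT_linear[OF g]])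
    have Er: "E x = 0" if x: "x \<in> \<rat> \<inter> {\<alpha><..<\<beta>}" for x
    proof -
      have \<kappa>f: "set_integrable lborel {\<alpha>..\<beta>} (\<lambda>s. \<kappa> s * f (t, s))"
        unfolding \<kappa>_def by (intro set_integrable_continuous_mult f continuous_on_subset[OF smooth_continuous[OF smooth_bump]]) auto
      have kg: "set_integrable lborel {\<alpha>..\<beta>} (\<lambda>s. k s * g (t, s))"
        by (intro set_integrable_continuous_mult g kc)
      have gx: "set_integrable lborel {\<alpha>..x} (\<lambda>s. (x - s) * g (t, s))"
        by (intro set_integrable_continuous_mult set_integrable_subset[OF g] continuous_intros) (use x in auto)
      have fx: "set_integrable lborel {\<alpha>..x} (\<lambda>s. f (t, s))"
        by (intro set_integrable_subset[OF f]) (use x in auto)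
      have "0 = (\<integral>s. h x (t, s) \<partial>lborel)" using h0 x t by auto
      also have "\<dots> = (\<integral>s. indicator {\<alpha>..x} s * f (t, s) - l x * (indicator {\<alpha>..\<beta>} s * (\<kappa> s * f (t, s)))
          + (x - \<alpha>) * (indicator {\<alpha>..\<beta>} s * g (t, s)) - indicator {\<alpha>..x} s * ((x - s) * g (t, s))
          - l x * (indicator {\<alpha>..\<beta>} s * (k s * g (t, s))) \<partial>lborel)"
      proof (rule integral_cong_AE)
        have "AE s in lborel. s \<noteq> \<alpha>" "AE s in lborel. s \<noteq> x" by (rule AE_lborel_singleton)+
        then show "AE s in lborel. h x (t, s) = indicator {\<alpha>..x} s * f (t, s) - l x * (indicator {\<alpha>..\<beta>} s * (\<kappa> s * f (t, s)))
          + (x - \<alpha>) * (indicator {\<alpha>..\<beta>} s * g (t, s)) - indicator {\<alpha>..x} s * ((x - s) * g (t, s))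
          - l x * (indicator {\<alpha>..\<beta>} s * (k s * g (t, s)))"
          by eventually_elim
            (use x in \<open>auto simp: h_def Fe Ge k'_def algebra_simps min_def max_def split: split_indicator\<close>)
        show "(\<lambda>s. h x (t, s)) \<in> borel_measurable lborel"
          unfolding h_def by measurable
        show "(\<lambda>s. indicator {\<alpha>..x} s * f (t, s) - l x * (indicator {\<alpha>..\<beta>} s * (\<kappa> s * f (t, s)))
          + (x - \<alpha>) * (indicator {\<alpha>..\<beta>} s * g (t, s)) - indicator {\<alpha>..x} s * ((x - s) * g (t, s))
          - l x * (indicator {\<alpha>..\<beta>} s * (k s * g (t, s)))) \<in> borel_measurable lborel"
          using fx \<kappa>f g gx kg unfolding set_integrable_def real_scaleR_def
          by (intro borel_measurable_integrable Bochner_Integration.integrable_add Bochner_Integration.integrable_diff integrable_mult_right)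
      qed
      also have "\<dots> = (LBINT s:{\<alpha>..x}. f (t, s)) - l x * (LBINT s:{\<alpha>..\<beta>}. \<kappa> s * f (t, s))
          + (x - \<alpha>) * (LBINT s:{\<alpha>..\<beta>}. g (t, s)) - (LBINT s:{\<alpha>..x}. (x - s) * g (t, s)) - l x * (LBINT s:{\<alpha>..\<beta>}. k s * g (t, s))"
        using fx \<kappa>f g gx kg unfolding set_integrable_def set_lebesgue_integral_def real_scaleR_def by simp
      finally show ?thesis
        unfolding E_def c_def l_def
        by (simp add: add_divide_distrib ring_distribs divide_inverse mult.commute mult.left_commute)
    qed
    have cl: "closure (\<rat> \<inter> {\<alpha><..<\<beta>}) = {\<alpha>..\<beta>}"
      using closure_open_Int_superset[of "{\<alpha><..<\<beta>}" "\<rat>"] ab by (simp add: Rats_closure_real Int_commute)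
    have "E x = 0" if "x \<in> {\<alpha>..\<beta>}" for x
      by (rule continuous_constant_on_closure[of "\<rat> \<inter> {\<alpha><..<\<beta>}" E 0]) (use Ec Er cl that in auto)
    then have "(LBINT s:{\<alpha>..x}. f (t, s)) = c * (x - \<alpha>) + (LBINT s:{\<alpha>..x}. (x - s) * g (t, s))"
      if "x \<in> {\<alpha>..\<beta>}" for x
    proof -
      have "E x = 0" using that \<open>\<And>x. x \<in> {\<alpha>..\<beta>} \<Longrightarrow> E x = 0\<close> by blast
      then show ?thesis unfolding E_def by linarith
    qed
    then show "\<exists>c. \<forall>x\<in>{\<alpha>..\<beta>}. (LBINT s:{\<alpha>..x}. f (t, s)) = c * (x - \<alpha>) + (LBINT s:{\<alpha>..x}. (x - s) * g (t, s))"
      by blast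
  qed
qed

lemma rational_box_inside:
  fixes P :: "(real \<times> real) set"
  assumes P: "open P" and xy: "x \<le> y" "{t} \<times> {x..y} \<subseteq> P"
  obtains t1 t2 \<alpha> \<beta> where "t1 \<in> \<rat>" "t2 \<in> \<rat>" "\<alpha> \<in> \<rat>" "\<beta> \<in> \<rat>" "t1 < t" "t < t2" "\<alpha> < x" "y < \<beta>"
    "{t1..t2} \<times> {\<alpha>..\<beta>} \<subseteq> P"
proof -
  have "compact ({t} \<times> {x..y})" by (intro compact_Times compact_Icc) simp
  then obtain e where e: "0 < e" "(\<Union>z\<in>{t} \<times> {x..y}. ball z e) \<subseteq> P"
    using compact_subset_open_imp_ball_epsilon_subset[OF _ P xy(2)] by auto
  obtain t1 where t1: "t1 \<in> \<rat>" "t - e/2 < t1" "t1 < t" using Rats_dense_in_real[of "t - e/2" t] e by auto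
  obtain t2 where t2: "t2 \<in> \<rat>" "t < t2" "t2 < t + e/2" using Rats_dense_in_real[of t "t + e/2"] e by auto
  obtain \<alpha> where \<alpha>: "\<alpha> \<in> \<rat>" "x - e/2 < \<alpha>" "\<alpha> < x" using Rats_dense_in_real[of "x - e/2" x] e by auto
  obtain \<beta> where \<beta>: "\<beta> \<in> \<rat>" "y < \<beta>" "\<beta> < y + e/2" using Rats_dense_in_real[of y "y + e/2"] e by auto
  have "{t1..t2} \<times> {\<alpha>..\<beta>} \<subseteq> P"
  proof
    fix p assume p: "p \<in> {t1..t2} \<times> {\<alpha>..\<beta>}"
    define z where "z = (t, max x (min y (snd p)))"
    have "dist z p \<le> dist (fst z) (fst p) + dist (snd z) (snd p)"
      using sqrt_sum_squares_le_sum[of "dist (fst z) (fst p)" "dist (snd z) (snd p)"] by (simp add: dist_prod_def)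
    also have "\<dots> < e/2 + e/2"
    proof (rule add_strict_mono)
      have b: "t1 \<le> fst p" "fst p \<le> t2" "\<alpha> \<le> snd p" "snd p \<le> \<beta>" using p by auto
      show "dist (fst z) (fst p) < e/2"
        unfolding z_def dist_real_def fst_conv using b t1 t2 by linarith
      show "dist (snd z) (snd p) < e/2"
        unfolding z_def dist_real_def snd_conv using b \<alpha> \<beta> xy(1) e(1) by linarith
    qed
    finally have "p \<in> ball z e" by simp
    moreover have "z \<in> {t} \<times> {x..y}" using xy by (auto simp: z_def)
    ultimately show "p \<in> P" using e by blast
  qed
  with t1 t2 \<alpha> \<beta> show thesis by (intro that[of t1 t2 \<alpha> \<beta>])
qed

lemma slice_regularity:
  fixes f g h :: "real \<times> real \<Rightarrow> real"
  assumes P: "open P" and fg: "weak_deriv P (0, 1) f g" and gh: "weak_deriv P (0, 1) g h"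
  shows "AE t in lborel. \<forall>d. continuous_on {x. (t, x) \<in> P} d \<and> (AE x in lborel. (t, x) \<in> P \<longrightarrow> f (t, x) = d x) \<longrightarrow>
    (\<exists>w. (\<forall>x. (t, x) \<in> P \<longrightarrow> (d has_real_derivative w x) (at x)) \<and>
       continuous_on {x. (t, x) \<in> P} w \<and>
       (AE x in lborel. (t, x) \<in> P \<longrightarrow> g (t, x) = w x) \<and>
       (\<forall>x y. x \<le> y \<and> {x..y} \<subseteq> {x. (t, x) \<in> P} \<longrightarrow>
          set_integrable lborel {x..y} (\<lambda>s. h (t, s)) \<and> w y - w x = (LBINT s:{x..y}. h (t, s))))"
proof -
  define I where "I = {(t1,t2,\<alpha>,\<beta>). t1 \<in> \<rat> \<and> t2 \<in> \<rat> \<and> \<alpha> \<in> \<rat> \<and> \<beta> \<in> \<rat> \<and> \<alpha> < \<beta> \<and> {t1..t2} \<times> {\<alpha>..\<beta>} \<subseteq> P}"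
  have cI: "countable I"
    by (rule countable_subset[of _ "\<rat> \<times> \<rat> \<times> \<rat> \<times> \<rat>"]) (auto simp: I_def countable_rat intro!: countable_SIGMA)
  define S where "S f g = (\<lambda>(t1,t2,\<alpha>,\<beta>) t. t \<in> {t1<..<t2} \<longrightarrow>
    set_integrable lborel {\<alpha>..\<beta>} (\<lambda>s. f (t, s)) \<and> set_integrable lborel {\<alpha>..\<beta>} (\<lambda>s. g (t, s)) \<and>
    (\<exists>c. \<forall>x\<in>{\<alpha>..\<beta>}. (LBINT s:{\<alpha>..x}. f (t, s)) = c * (x - \<alpha>) + (LBINT s:{\<alpha>..x}. (x - s) * g (t, s))))"
    for f g :: "real \<times> real \<Rightarrow> real"
  have S: "AE t in lborel. \<forall>i\<in>I. S f g i t" if "weak_deriv P (0, 1) f g" for f g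
    by (rule AE_ball_countable'[OF _ cI]) (use weak_deriv_slice_AE[OF that] in \<open>auto simp: I_def S_def\<close>)
  show ?thesis using S[OF fg] S[OF gh]
  proof (eventually_elim, intro allI impI)
    fix t d
    assume S1: "\<forall>i\<in>I. S f g i t" and S2: "\<forall>i\<in>I. S g h i t"
      and d: "continuous_on {x. (t, x) \<in> P} d \<and> (AE x in lborel. (t, x) \<in> P \<longrightarrow> f (t, x) = d x)"
    define w where "w = deriv d"
    have loc: "(\<forall>x\<in>{\<alpha><..<\<beta>}. (d has_real_derivative w x) (at x)) \<and> continuous_on {\<alpha><..<\<beta>} w \<and>
        (AE x in lborel. x \<in> {\<alpha><..<\<beta>} \<longrightarrow> g (t, x) = w x) \<and>
        (\<forall>x y. x \<le> y \<and> {x..y} \<subseteq> {\<alpha><..<\<beta>} \<longrightarrow>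
          set_integrable lborel {x..y} (\<lambda>s. h (t, s)) \<and> w y - w x = (LBINT s:{x..y}. h (t, s)))"
      if I: "(t1,t2,\<alpha>,\<beta>) \<in> I" and t: "t \<in> {t1<..<t2}" for t1 t2 \<alpha> \<beta>
    proof -
      have ab: "\<alpha> < \<beta>" and sub: "{\<alpha>..\<beta>} \<subseteq> {x. (t, x) \<in> P}" using I t by (auto simp: I_def)
      from S1 I t obtain c1 where fi: "set_integrable lborel {\<alpha>..\<beta>} (\<lambda>s. f (t, s))"
        and gi: "set_integrable lborel {\<alpha>..\<beta>} (\<lambda>s. g (t, s))"
        and c1: "\<And>x. x\<in>{\<alpha>..\<beta>} \<Longrightarrow> (LBINT s:{\<alpha>..x}. f (t, s)) = c1 * (x - \<alpha>) + (LBINT s:{\<alpha>..x}. (x - s) * g (t, s))"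
        by (fastforce simp: S_def)
      from S2 I t obtain c2 where hi: "set_integrable lborel {\<alpha>..\<beta>} (\<lambda>s. h (t, s))"
        and c2: "\<And>x. x\<in>{\<alpha>..\<beta>} \<Longrightarrow> (LBINT s:{\<alpha>..x}. g (t, s)) = c2 * (x - \<alpha>) + (LBINT s:{\<alpha>..x}. (x - s) * h (t, s))"
        by (fastforce simp: S_def)
      have dc: "continuous_on {\<alpha>..\<beta>} d" using d sub by (blast intro: continuous_on_subset)
      have di: "set_integrable lborel {\<alpha>..\<beta>} d" by (rule borel_integrable_atLeastAtMost'[OF dc])
      have fd: "(LBINT s:{\<alpha>..x}. f (t, s)) = integral {\<alpha>..x} d" if "x \<in> {\<alpha>..\<beta>}" for x
      proof -
        have dix: "set_integrable lborel {\<alpha>..x} d" by (rule set_integrable_subset[OF di]) (use that in auto)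
        have "(LBINT s:{\<alpha>..x}. f (t, s)) = (LBINT s:{\<alpha>..x}. d s)"
        proof (rule set_integral_cong_AE_on)
          show "set_borel_measurable lborel {\<alpha>..x} (\<lambda>s. f (t, s))"
            using set_integrable_subset[OF fi, of "{\<alpha>..x}"] that
            by (auto simp: set_integrable_def set_borel_measurable_def borel_measurable_integrable)
          show "set_borel_measurable lborel {\<alpha>..x} d"
            using dix by (auto simp: set_integrable_def set_borel_measurable_def borel_measurable_integrable)
          have "AE s in lborel. (t, s) \<in> P \<longrightarrow> f (t, s) = d s" using d by blast
          then show "AE s in lborel. s \<in> {\<alpha>..x} \<longrightarrow> f (t, s) = d s"
          proof eventually_elim
            case (elim s)
            then show ?case using subsetD[OF sub, of s] that by auto
          qed
        qed
        also have "\<dots> = integral {\<alpha>..x} d" by (rule set_borel_integral_eq_integral(2)[OF dix])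
        finally show ?thesis .
      qed
      have d1: "d x = c1 + (LBINT s:{\<alpha>..x}. g (t, s))" if x: "x \<in> {\<alpha><..<\<beta>}" for x
      proof -
        have "((\<lambda>x. integral {\<alpha>..x} d) has_real_derivative d x) (at x within {\<alpha>..\<beta>})"
          by (rule integral_has_real_derivative[OF dc]) (use x in auto)
        moreover have "((\<lambda>x. c1 * (x - \<alpha>) + (LBINT s:{\<alpha>..x}. (x - s) * g (t, s))) has_real_derivative
            c1 + (LBINT s:{\<alpha>..x}. g (t, s))) (at x within {\<alpha>..\<beta>})"
          by (rule has_real_derivative_affine_LBINT[OF gi]) (use x in auto)
        then have "((\<lambda>x. integral {\<alpha>..x} d) has_real_derivative c1 + (LBINT s:{\<alpha>..x}. g (t, s))) (at x within {\<alpha>..\<beta>})"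
          by (rule has_field_derivative_transform_within[of _ _ _ _ 1]) (use x c1 fd in auto)
        moreover have "at x within {\<alpha>..\<beta>} = at x" by (rule at_within_Icc_at) (use x in auto)
        ultimately show ?thesis by (auto dest: DERIV_unique)
      qed
      define v where "v x = c2 + (LBINT s:{\<alpha>..x}. h (t, s))" for x
      have d2: "(d has_real_derivative v x) (at x)" if x: "x \<in> {\<alpha><..<\<beta>}" for x
      proof -
        have "((\<lambda>x. c1 + (c2 * (x - \<alpha>) + (LBINT s:{\<alpha>..x}. (x - s) * h (t, s)))) has_real_derivative v x) (at x within {\<alpha>..\<beta>})"
          unfolding v_def using DERIV_add[OF DERIV_const has_real_derivative_affine_LBINT[OF hi]] x by auto
        moreover have "at x within {\<alpha>..\<beta>} = at x" by (rule at_within_Icc_at) (use x in auto)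
        ultimately have "((\<lambda>x. c1 + (c2 * (x - \<alpha>) + (LBINT s:{\<alpha>..x}. (x - s) * h (t, s)))) has_real_derivative v x) (at x)"
          by simp
        then show ?thesis
          by (rule has_field_derivative_transform_within_open[where S="{\<alpha><..<\<beta>}"]) (use x d1 c2 in auto)
      qed
      have wv: "w x = v x" if "x \<in> {\<alpha><..<\<beta>}" for x
        unfolding w_def using d2[OF that] by (rule DERIV_imp_deriv)
      have vc: "continuous_on {\<alpha>..\<beta>} v"
        unfolding v_def by (intro continuous_intros continuous_on_LBINT hi)
      have "AE x in lborel. x \<in> {\<alpha><..<\<beta>} \<longrightarrow> g (t, x) - v x = 0"
      proof (rule AE_eq_0_if_interval_integrals_0)
        have gv: "set_integrable lborel {\<alpha>..\<beta>} (\<lambda>x. g (t, x) - v x)"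
          by (intro set_integral_diff gi borel_integrable_atLeastAtMost'[OF vc])
        then show "set_integrable lborel {\<alpha><..<\<beta>} (\<lambda>x. g (t, x) - v x)"
          by (rule set_integrable_subset) auto
        have z: "(LBINT x:{\<alpha>..y}. g (t, x) - v x) = c" if "y \<in> {\<alpha>..\<beta>}" "c = 0" for y c
        proof -
          have vy: "set_integrable lborel {\<alpha>..y} v" and gy: "set_integrable lborel {\<alpha>..y} (\<lambda>x. g (t, x))"
            by (rule set_integrable_subset[OF borel_integrable_atLeastAtMost'[OF vc]] set_integrable_subset[OF gi]; use that in auto)+
          have "(LBINT x:{\<alpha>..y}. v x) = (LBINT s:{\<alpha>..y}. g (t, s)) - (LBINT s:{\<alpha>..\<alpha>}. g (t, s))"
          proof -
            have "(v has_integral ((LBINT s:{\<alpha>..y}. g (t, s)) - (LBINT s:{\<alpha>..\<alpha>}. g (t, s)))) {\<alpha>..y}"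
            proof (rule fundamental_theorem_of_calculus)
              fix x assume x: "x \<in> {\<alpha>..y}"
              have "((\<lambda>x. c2 * (x - \<alpha>) + (LBINT s:{\<alpha>..x}. (x - s) * h (t, s))) has_real_derivative v x) (at x within {\<alpha>..\<beta>})"
                unfolding v_def by (rule has_real_derivative_affine_LBINT[OF hi]) (use x that in auto)
              then have "((\<lambda>x. LBINT s:{\<alpha>..x}. g (t, s)) has_real_derivative v x) (at x within {\<alpha>..\<beta>})"
                by (rule has_field_derivative_transform_within[of _ _ _ _ 1]) (use x that c2 in auto)
              then show "((\<lambda>x. LBINT s:{\<alpha>..x}. g (t, s)) has_vector_derivative v x) (at x within {\<alpha>..y})"
                using that by (auto simp: has_real_derivative_iff_has_vector_derivative[symmetric] intro: has_field_derivative_subset)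
            qed (use that in auto)
            then show ?thesis
              using set_borel_integral_eq_integral(2)[OF vy] by (simp add: integral_unique)
          qed
          moreover have "(LBINT s:{\<alpha>..\<alpha>}. g (t, s)) = 0" using c2[of \<alpha>] ab
            by (simp add: set_integral_at_point)
          ultimately show ?thesis using vy gy that by simp
        qed
        fix p q assume pq: "\<alpha> \<le> p" "p < q" "q \<le> \<beta>"
        have "(LBINT x:{p..q}. g (t, x) - v x) = 0"
          using LBINT_combine[OF set_integrable_subset[OF gv, of "{\<alpha>..q}"], of p] z[of q 0] z[of p 0] pq by auto
        moreover have "(LBINT x:{p<..<q}. g (t, x) - v x) = (LBINT x:{p..q}. g (t, x) - v x)"
        proof (rule set_integral_cong_set)
          show "AE x in lborel. (x \<in> {p..q}) = (x \<in> {p<..<q})"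
            using AE_lborel_singleton[of p] AE_lborel_singleton[of q] by eventually_elim auto
          show "set_borel_measurable lborel {p..q} (\<lambda>x. g (t, x) - v x)"
            "set_borel_measurable lborel {p<..<q} (\<lambda>x. g (t, x) - v x)"
            using set_integrable_subset[OF gv, of "{p..q}"] set_integrable_subset[OF gv, of "{p<..<q}"] pq
            by (auto simp: set_integrable_def set_borel_measurable_def borel_measurable_integrable greaterThanLessThan_subseteq_atLeastAtMost_iff)
        qed
        ultimately show "(LBINT x:{p<..<q}. g (t, x) - v x) = 0" by simp
      qed
      then have "AE x in lborel. x \<in> {\<alpha><..<\<beta>} \<longrightarrow> g (t, x) = w x"
        by eventually_elim (auto simp: wv)
      moreover have "continuous_on {\<alpha><..<\<beta>} w"
      proof -
        have "continuous_on {\<alpha><..<\<beta>} v" by (rule continuous_on_subset[OF vc]) auto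
        then show ?thesis using wv by (subst continuous_on_cong[OF refl, of _ _ v]) auto
      qed
      moreover have "set_integrable lborel {x..y} (\<lambda>s. h (t, s)) \<and> w y - w x = (LBINT s:{x..y}. h (t, s))"
        if xy: "x \<le> y" "{x..y} \<subseteq> {\<alpha><..<\<beta>}" for x y
      proof -
        have "x \<in> {\<alpha><..<\<beta>}" "y \<in> {\<alpha><..<\<beta>}" using xy by auto
        then show ?thesis
          using wv[of x] wv[of y] LBINT_combine[OF set_integrable_subset[OF hi, of "{\<alpha>..y}"], of x] xy
            set_integrable_subset[OF hi, of "{x..y}"] by (auto simp: v_def)
      qed
      ultimately show ?thesis using d2 wv by auto
    qed
    have box: "\<exists>t1 t2 \<alpha> \<beta>. (t1,t2,\<alpha>,\<beta>) \<in> I \<and> t \<in> {t1<..<t2} \<and> {x..y} \<subseteq> {\<alpha><..<\<beta>}"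
      if "x \<le> y" "{x..y} \<subseteq> {x. (t, x) \<in> P}" for x y
    proof -
      have "{t} \<times> {x..y} \<subseteq> P" using that by auto
      from rational_box_inside[OF P that(1) this] obtain t1 t2 \<alpha> \<beta>
        where *: "t1 \<in> \<rat>" "t2 \<in> \<rat>" "\<alpha> \<in> \<rat>" "\<beta> \<in> \<rat>" "t1 < t" "t < t2" "\<alpha> < x" "y < \<beta>"
          "{t1..t2} \<times> {\<alpha>..\<beta>} \<subseteq> P" by blast
      then have "(t1,t2,\<alpha>,\<beta>) \<in> I" using that(1) by (simp add: I_def)
      moreover have "t \<in> {t1<..<t2}" "{x..y} \<subseteq> {\<alpha><..<\<beta>}" using * by auto
      ultimately show ?thesis by blast
    qed
    show "\<exists>w. (\<forall>x. (t, x) \<in> P \<longrightarrow> (d has_real_derivative w x) (at x)) \<and>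
       continuous_on {x. (t, x) \<in> P} w \<and>
       (AE x in lborel. (t, x) \<in> P \<longrightarrow> g (t, x) = w x) \<and>
       (\<forall>x y. x \<le> y \<and> {x..y} \<subseteq> {x. (t, x) \<in> P} \<longrightarrow>
          set_integrable lborel {x..y} (\<lambda>s. h (t, s)) \<and> w y - w x = (LBINT s:{x..y}. h (t, s)))"
    proof (intro exI[of _ w] conjI allI impI)
      fix x assume x: "(t, x) \<in> P"
      from box[of x x] x obtain t1 t2 \<alpha> \<beta> where "(t1,t2,\<alpha>,\<beta>) \<in> I" "t \<in> {t1<..<t2}" "x \<in> {\<alpha><..<\<beta>}" by auto
      with loc show "(d has_real_derivative w x) (at x)" by blast
    next
      have "isCont w x" if "(t, x) \<in> P" for x
      proof -
        from box[of x x] that obtain t1 t2 \<alpha> \<beta> where *: "(t1,t2,\<alpha>,\<beta>) \<in> I" "t \<in> {t1<..<t2}" "x \<in> {\<alpha><..<\<beta>}" by auto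
        with loc have "continuous_on {\<alpha><..<\<beta>} w" by blast
        with * show ?thesis by (simp add: continuous_on_eq_continuous_at)
      qed
      then show "continuous_on {x. (t, x) \<in> P} w" by (auto intro: continuous_at_imp_continuous_on)
    next
      have "AE x in lborel. \<forall>i\<in>I. case i of (t1,t2,\<alpha>,\<beta>) \<Rightarrow> t \<in> {t1<..<t2} \<longrightarrow> x \<in> {\<alpha><..<\<beta>} \<longrightarrow> g (t, x) = w x"
        by (rule AE_ball_countable'[OF _ cI]) (use loc in auto)
      then show "AE x in lborel. (t, x) \<in> P \<longrightarrow> g (t, x) = w x"
      proof eventually_elim
        case (elim x)
        show ?case
        proof
          assume "(t, x) \<in> P"
          with box[of x x] obtain t1 t2 \<alpha> \<beta> where "(t1,t2,\<alpha>,\<beta>) \<in> I" "t \<in> {t1<..<t2}" "x \<in> {\<alpha><..<\<beta>}" by auto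
          with elim show "g (t, x) = w x" by blast
        qed
      qed
    next
      fix x y assume "x \<le> y \<and> {x..y} \<subseteq> {x. (t, x) \<in> P}"
      with box[of x y] loc show "set_integrable lborel {x..y} (\<lambda>s. h (t, s))" "w y - w x = (LBINT s:{x..y}. h (t, s))"
        by meson+
    qed
  qed
qed

subsection \<open>The truncated dissipation inequality on a slice\<close>

lemma set_integral_nonneg_components:
  fixes g :: "real \<Rightarrow> real"
  assumes P: "open P" and g: "set_integrable lborel P g"
    and pos: "\<And>C. C \<in> components P \<Longrightarrow> 0 \<le> (LBINT x:C. g x)"
  shows "0 \<le> (LBINT x:P. g x)"
proof -
  have oC: "open C" if "C \<in> components P" for C using open_components[OF P that] .
  have cC: "countable (components P)"
    by (rule countable_disjoint_open_subsets[OF oC])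
       (use pairwise_disjoint_components[of P] in \<open>auto simp: pairwise_def disjnt_def\<close>)
  define A where "A i = \<Union>{C \<in> components P. to_nat_on (components P) C = i}" for i
  have Ai: "A i = {} \<or> A i \<in> components P" for i
  proof (cases "\<exists>C\<in>components P. to_nat_on (components P) C = i")
    case True
    then obtain C where C: "C \<in> components P" "to_nat_on (components P) C = i" by blast
    then have "{C \<in> components P. to_nat_on (components P) C = i} = {C}"
      using inj_on_to_nat_on[OF cC] by (auto simp: inj_on_def)
    then show ?thesis using C by (simp add: A_def)
  qed (auto simp: A_def)
  have UA: "(\<Union>i. A i) = P"
  proof -
    have "(\<Union>i. A i) = \<Union> (components P)" unfolding A_def by blast
    then show ?thesis by simp
  qed
  have disj: "disjoint_family A"
  proof (unfold disjoint_family_on_def, intro ballI impI)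
    fix i j :: nat assume ij: "i \<noteq> j"
    have "x \<notin> A j" if xi: "x \<in> A i" for x
    proof
      assume "x \<in> A j"
      then obtain C where C: "C \<in> components P" "x \<in> C" "to_nat_on (components P) C = j" by (auto simp: A_def)
      obtain D where D: "D \<in> components P" "x \<in> D" "to_nat_on (components P) D = i"
        using xi by (auto simp: A_def)
      have "C \<noteq> D" using C D ij by auto
      then show False using pairwiseD[OF pairwise_disjoint_components C(1) D(1)] C D by auto
    qed
    then show "A i \<inter> A j = {}" by blast
  qed
  have sA: "A i \<in> sets borel" for i using Ai[of i] oC by auto
  have iA: "set_integrable lborel (A i) g" for i
    by (rule set_integrable_subset[OF g]) (use sA UA in auto)
  define B where "B n = (\<Union>i\<in>{..<n}. A i)" for n :: nat
  have "(LBINT x:B n. g x) = (\<Sum>i<n. LBINT x:A i. g x)" for n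
    unfolding B_def by (rule set_integral_finite_Union)
      (use iA sA disj in \<open>auto simp: disjoint_family_on_def\<close>)
  moreover have "0 \<le> (LBINT x:A i. g x)" for i
    using Ai[of i] pos by (auto simp: set_lebesgue_integral_def)
  ultimately have Bn: "0 \<le> (LBINT x:B n. g x)" for n by (simp add: sum_nonneg)
  have UB: "(\<Union>n. B n) = P" unfolding UA[symmetric] B_def by auto
  have "(\<lambda>n. LBINT x:B n. g x) \<longlonglongrightarrow> (LBINT x:(\<Union>n. B n). g x)"
  proof (rule set_integral_cont_up)
    show "B n \<in> sets lborel" for n unfolding B_def using sA by auto
    show "incseq B" unfolding B_def incseq_def by fastforce
    show "set_integrable lborel (\<Union>n. B n) g" unfolding UB by (rule g)
  qed
  then show ?thesis unfolding UB using Bn by (metis LIMSEQ_le_const)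
qed

lemma bounded_component_interval:
  fixes P :: "real set"
  assumes P: "open P" "P \<subseteq> {a<..<b}" and C: "C \<in> components P"
  obtains \<alpha> \<beta> where "\<alpha> < \<beta>" "C = {\<alpha><..<\<beta>}" "a \<le> \<alpha>" "\<beta> \<le> b" "\<alpha> \<notin> P" "\<beta> \<notin> P"
proof -
  have oC: "open C" and cC: "connected C" and CP: "C \<subseteq> P" and ne: "C \<noteq> {}"
    using open_components[OF P(1) C] in_components_connected[OF C] in_components_subset[OF C] in_components_nonempty[OF C] .
  define \<alpha> where "\<alpha> = Inf C" define \<beta> where "\<beta> = Sup C"
  have bb: "bdd_below C" "bdd_above C" using CP P(2) by (auto intro!: bdd_belowI[of _ a] bdd_aboveI[of _ b])
  have le: "\<alpha> \<le> x" "x \<le> \<beta>" if "x \<in> C" for x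
    using that bb by (auto simp: \<alpha>_def \<beta>_def intro: cInf_lower cSup_upper)
  have st: "\<alpha> < x" "x < \<beta>" if x: "x \<in> C" for x
  proof -
    obtain e where e: "0 < e" "ball x e \<subseteq> C" using oC x open_contains_ball by blast
    have "x - e/2 \<in> C" "x + e/2 \<in> C" using e by (auto simp: subset_eq dist_real_def)
    then show "\<alpha> < x" "x < \<beta>" using le[of "x - e/2"] le[of "x + e/2"] e by auto
  qed
  have Ceq: "C = {\<alpha><..<\<beta>}"
  proof
    show "C \<subseteq> {\<alpha><..<\<beta>}" using st by auto
    show "{\<alpha><..<\<beta>} \<subseteq> C"
    proof
      fix x assume x: "x \<in> {\<alpha><..<\<beta>}"
      obtain c1 where "c1 \<in> C" "c1 < x" using x cInf_less_iff[OF ne bb(1), of x] by (auto simp: \<alpha>_def)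
      moreover obtain c2 where "c2 \<in> C" "x < c2" using x less_cSup_iff[OF ne bb(2), of x] by (auto simp: \<beta>_def)
      ultimately show "x \<in> C" using connectedD_interval[OF cC, of c1 c2 x] by auto
    qed
  qed
  have ab: "\<alpha> < \<beta>" using ne Ceq by force
  have "a \<le> \<alpha>" unfolding \<alpha>_def using ne CP P(2) by (intro cInf_greatest) auto
  moreover have "\<beta> \<le> b" unfolding \<beta>_def using ne CP P(2) by (intro cSup_least) auto
  moreover have "\<alpha> \<notin> P"
  proof
    assume "\<alpha> \<in> P"
    obtain c where c: "c \<in> C" using ne by blast
    have "{\<alpha>..c} \<subseteq> P"
    proof
      fix x assume "x \<in> {\<alpha>..c}"
      then show "x \<in> P" using \<open>\<alpha> \<in> P\<close> CP st(2)[OF c] Ceq by (cases "x = \<alpha>") auto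
    qed
    then have "{\<alpha>..c} \<subseteq> C" by (rule components_maximal[OF C connected_Icc]) (use c st in force)
    then have "\<alpha> \<in> C" using st(1)[OF c] by auto
    then show False using st(1) by blast
  qed
  moreover have "\<beta> \<notin> P"
  proof
    assume "\<beta> \<in> P"
    obtain c where c: "c \<in> C" using ne by blast
    have "{c..\<beta>} \<subseteq> P"
    proof
      fix x assume "x \<in> {c..\<beta>}"
      then show "x \<in> P" using \<open>\<beta> \<in> P\<close> CP st(1)[OF c] Ceq by (cases "x = \<beta>") auto
    qed
    then have "{c..\<beta>} \<subseteq> C" by (rule components_maximal[OF C connected_Icc]) (use c st in force)
    then have "\<beta> \<in> C" using st(2)[OF c] by auto
    then show False using st(2) by blast
  qed
  ultimately show thesis using that ab Ceq by blast
qed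

text \<open>If \<open>\<bar>u d w\<bar> \<ge> c\<close> near a zero of \<open>u\<close>, then \<open>\<bar>(d\<^sup>2)'\<bar> = 2 \<bar>d w\<bar> \<ge> 2 c / u\<close>, and \<open>u \<le> K (x - \<alpha>)\<close> makes \<open>d\<^sup>2\<close>
  diverge logarithmically.\<close>
lemma exists_small_flux_left:
  fixes u d w :: "real \<Rightarrow> real"
  assumes ae: "\<alpha> < \<eta>" and c: "0 < c"
    and u: "\<And>x. x \<in> {\<alpha><..<\<eta>} \<Longrightarrow> 0 < u x \<and> u x \<le> K * (x - \<alpha>)"
    and dw: "\<And>x. x \<in> {\<alpha><..<\<eta>} \<Longrightarrow> (d has_real_derivative w x) (at x)"
    and w: "continuous_on {\<alpha><..<\<eta>} w"
    and d: "\<And>x. x \<in> {\<alpha><..<\<eta>} \<Longrightarrow> \<bar>d x\<bar> \<le> K"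
  shows "\<exists>x\<in>{\<alpha><..<\<eta>}. \<bar>u x * d x * w x\<bar> < c"
proof (rule ccontr)
  assume "\<not> ?thesis"
  then have big: "c \<le> \<bar>u x * d x * w x\<bar>" if "x \<in> {\<alpha><..<\<eta>}" for x using that by force
  define y where "y = (\<alpha> + \<eta>) / 2"
  have y: "\<alpha> < y" "y < \<eta>" using ae by (auto simp: y_def)
  have K: "0 < K" 
  proof -
    have "0 < K * (y - \<alpha>)" using u[of y] y by (simp add: less_le_trans)
    then show ?thesis using y by (simp add: zero_less_mult_iff)
  qed
  have dc: "continuous_on {\<alpha><..<\<eta>} d"
    by (intro continuous_at_imp_continuous_on ballI DERIV_isCont[OF dw])
  have dwc: "continuous_on {\<alpha><..<\<eta>} (\<lambda>x. d x * w x)" by (intro continuous_intros dc w)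
  have bigdw: "c / (K * (x - \<alpha>)) \<le> \<bar>d x * w x\<bar>" if x: "x \<in> {\<alpha><..<\<eta>}" for x
  proof -
    have "c \<le> u x * \<bar>d x * w x\<bar>" using big[OF x] u[OF x] by (simp add: abs_mult mult.assoc)
    also have "\<dots> \<le> K * (x - \<alpha>) * \<bar>d x * w x\<bar>" using u[OF x] by (intro mult_right_mono) auto
    finally show ?thesis using K x by (simp add: divide_le_eq mult.commute)
  qed
  have nz: "d x * w x \<noteq> 0" if x: "x \<in> {\<alpha><..<\<eta>}" for x
    using big[OF x] c by auto
  have con: "connected ((\<lambda>x. d x * w x) ` {\<alpha><..<\<eta>})"
    by (rule connected_continuous_image[OF dwc]) simp
  define \<sigma> where "\<sigma> = sgn (d y * w y)"
  have \<sigma>: "\<sigma> = 1 \<or> \<sigma> = -1" using nz[of y] y by (auto simp: \<sigma>_def sgn_if)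
  have sign: "0 < \<sigma> * (d x * w x)" if x: "x \<in> {\<alpha><..<\<eta>}" for x
  proof (rule ccontr)
    assume n: "\<not> ?thesis"
    have "0 < \<sigma> * (d y * w y)" using nz[of y] y by (auto simp: \<sigma>_def sgn_mult_abs abs_sgn[symmetric] mult.commute)
    moreover have "\<sigma> * (d x * w x) \<noteq> 0" using nz[OF x] \<sigma> by auto
    then have "\<sigma> * (d x * w x) < 0" using n by linarith
    ultimately have "0 \<in> (\<lambda>x. d x * w x) ` {\<alpha><..<\<eta>}"
      using \<sigma> connectedD_interval[OF con, of "d x * w x" "d y * w y" 0]
        connectedD_interval[OF con, of "d y * w y" "d x * w x" 0] x y by force
    then show False using nz by force
  qed
  have lb: "c / (K * (x - \<alpha>)) \<le> \<sigma> * (d x * w x)" if x: "x \<in> {\<alpha><..<\<eta>}" for x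
    using bigdw[OF x] sign[OF x] \<sigma> by (auto simp: abs_if split: if_splits)
  define H where "H x = \<sigma> * (d x)\<^sup>2 - 2 * c / K * ln (x - \<alpha>)" for x
  have mono: "H x \<le> H y" if x: "\<alpha> < x" "x \<le> y" for x
  proof (rule DERIV_nonneg_imp_nondecreasing[OF x(2)])
    fix s assume s: "x \<le> s" "s \<le> y"
    then have s': "s \<in> {\<alpha><..<\<eta>}" using x y by auto
    have "(H has_real_derivative \<sigma> * (2 * d s * w s) - 2 * c / K * (1 / (s - \<alpha>))) (at s)"
      unfolding H_def using s x K by (auto intro!: derivative_eq_intros dw[OF s'] simp: power2_eq_square)
    moreover have "0 \<le> \<sigma> * (2 * d s * w s) - 2 * c / K * (1 / (s - \<alpha>))"
      using lb[OF s'] K s x by (simp add: field_simps)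
    ultimately show "\<exists>v. (H has_real_derivative v) (at s) \<and> 0 \<le> v" by blast
  qed
  define N where "N = K ^ 3 / c + 1"
  define x where "x = \<alpha> + (y - \<alpha>) * exp (- N)"
  have N: "0 < N" using K c by (simp add: N_def add_pos_pos)
  have x: "\<alpha> < x" "x \<le> y" 
  proof -
    have "(y - \<alpha>) * exp (- N) \<le> (y - \<alpha>) * 1" using y N by (intro mult_left_mono) auto
    then have "x - \<alpha> \<le> y - \<alpha>" unfolding x_def by (simp only: mult_1_right add_diff_cancel_left')
    then show "x \<le> y" by simp
    show "\<alpha> < x" using y by (simp add: x_def)
  qed
  have ln: "ln (x - \<alpha>) = ln (y - \<alpha>) - N" using y by (simp add: x_def ln_mult)
  have "2 * c / K * N \<le> \<sigma> * (d y)\<^sup>2 - \<sigma> * (d x)\<^sup>2"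
  proof -
    have "2 * c / K * N = 2 * c / K * ln (y - \<alpha>) - 2 * c / K * ln (x - \<alpha>)"
      unfolding ln by (simp add: right_diff_distrib)
    then show ?thesis using mono[OF x] unfolding H_def by linarith
  qed
  also have "\<dots> \<le> (d y)\<^sup>2 + (d x)\<^sup>2" using \<sigma> by auto
  also have "\<dots> \<le> K\<^sup>2 + K\<^sup>2"
    using d[of x] d[of y] x y K by (intro add_mono) (auto simp: abs_le_square_iff[symmetric])
  finally have "c * N \<le> K ^ 3" using K by (simp add: field_simps power2_eq_square power3_eq_cube)
  moreover have "c * N = K ^ 3 + c" using c by (simp add: N_def field_simps)
  ultimately show False using c by simp
qed

definition trunc :: "real \<Rightarrow> real \<Rightarrow> real" where
  "trunc \<delta> s = \<delta> * s / (s + \<delta>)"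

lemma trunc_bounds:
  assumes "0 < \<delta>" "0 \<le> s"
  shows "0 \<le> trunc \<delta> s" "trunc \<delta> s \<le> s" "trunc \<delta> s \<le> \<delta>"
  using assms by (auto simp: trunc_def field_simps)

lemma trunc_has_derivative:
  assumes "0 < \<delta>" "0 \<le> s"
  shows "(trunc \<delta> has_real_derivative \<delta>\<^sup>2 / (s + \<delta>)\<^sup>2) (at s)"
    "((\<lambda>s. \<delta>\<^sup>2 / (s + \<delta>)\<^sup>2) has_real_derivative - 2 * \<delta>\<^sup>2 / (s + \<delta>) ^ 3) (at s)"
proof -
  have nz: "s + \<delta> \<noteq> 0" using assms by simp
  show "(trunc \<delta> has_real_derivative \<delta>\<^sup>2 / (s + \<delta>)\<^sup>2) (at s)"
    unfolding trunc_def[abs_def] using nz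
    by (auto intro!: derivative_eq_intros simp: power2_eq_square algebra_simps)
  show "((\<lambda>s. \<delta>\<^sup>2 / (s + \<delta>)\<^sup>2) has_real_derivative - 2 * \<delta>\<^sup>2 / (s + \<delta>) ^ 3) (at s)"
    using nz by (auto intro!: derivative_eq_intros simp: power2_eq_square power3_eq_cube divide_simps)
qed

lemma exists_small_flux_right:
  fixes u d w :: "real \<Rightarrow> real"
  assumes ae: "\<eta> < \<beta>" and c: "0 < c"
    and u: "\<And>x. x \<in> {\<eta><..<\<beta>} \<Longrightarrow> 0 < u x \<and> u x \<le> K * (\<beta> - x)"
    and dw: "\<And>x. x \<in> {\<eta><..<\<beta>} \<Longrightarrow> (d has_real_derivative w x) (at x)"
    and w: "continuous_on {\<eta><..<\<beta>} w"
    and d: "\<And>x. x \<in> {\<eta><..<\<beta>} \<Longrightarrow> \<bar>d x\<bar> \<le> K"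
  shows "\<exists>x\<in>{\<eta><..<\<beta>}. \<bar>u x * d x * w x\<bar> < c"
proof -
  have "\<exists>x\<in>{-\<beta><..<-\<eta>}. \<bar>u (-x) * (- d (-x)) * w (-x)\<bar> < c"
  proof (rule exists_small_flux_left[where K=K])
    show "((\<lambda>x. - d (-x)) has_real_derivative w (-x)) (at x)" if "x \<in> {-\<beta><..<-\<eta>}" for x
      using DERIV_minus[OF DERIV_chain2[OF dw[of "-x"] DERIV_minus[OF DERIV_ident]]] that by simp
    show "continuous_on {-\<beta><..<-\<eta>} (\<lambda>x. w (-x))"
      by (rule continuous_on_compose2[OF w]) (auto intro: continuous_intros)
    show "0 < u (-x) \<and> u (-x) \<le> K * (x - - \<beta>)" if "x \<in> {-\<beta><..<-\<eta>}" for x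
      using u[of "-x"] that by (simp add: algebra_simps)
  qed (use ae c d in auto)
  then obtain x where "x \<in> {-\<beta><..<-\<eta>}" "\<bar>u (-x) * (- d (-x)) * w (-x)\<bar> < c" by blast
  then show ?thesis by (intro bexI[of _ "-x"]) auto
qed

locale slice =
  fixes a b \<delta> a' b' :: real and u d w z \<phi> \<phi>' \<phi>'' :: "real \<Rightarrow> real"
  assumes ab: "a < b" and \<delta>: "0 < \<delta>"
    and dc: "continuous_on {a..b} d"
    and ud: "\<And>x. x \<in> {a..b} \<Longrightarrow> (u has_real_derivative d x) (at x within {a..b})"
    and u0: "\<And>x. x \<in> {a..b} \<Longrightarrow> 0 \<le> u x"
    and dw: "\<And>x. x \<in> {a<..<b} \<Longrightarrow> 0 < u x \<Longrightarrow> (d has_real_derivative w x) (at x)"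
    and wc: "continuous_on {x \<in> {a<..<b}. 0 < u x} w"
    and wz: "\<And>x y. x \<le> y \<Longrightarrow> {x..y} \<subseteq> {x \<in> {a<..<b}. 0 < u x} \<Longrightarrow>
      set_integrable lborel {x..y} z \<and> w y - w x = (LBINT s:{x..y}. z s)"
    and \<phi>0: "\<And>x. 0 \<le> \<phi> x"
    and \<phi>d: "\<And>x. (\<phi> has_real_derivative \<phi>' x) (at x)" "\<And>x. (\<phi>' has_real_derivative \<phi>'' x) (at x)"
    and \<phi>c: "continuous_on UNIV \<phi>''"
    and supp: "a < a'" "b' < b" "\<And>x. x \<notin> {a'..b'} \<Longrightarrow> \<phi> x = 0 \<and> \<phi>' x = 0"
begin

abbreviation "Pos \<equiv> {x \<in> {a<..<b}. 0 < u x}"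
abbreviation "m s \<equiv> trunc \<delta> s"
definition "m1 s = \<delta>\<^sup>2 / (s + \<delta>)\<^sup>2"
definition "m2 s = - 2 * \<delta>\<^sup>2 / (s + \<delta>) ^ 3"

definition "integrand x = - \<phi> x * m (u x) * d x * z x - 5/3 * \<phi>' x * m (u x) * d x * w x - 1/3 * m (u x) * \<phi>'' x * (d x)\<^sup>2"

definition "A x = - \<phi> x * m (u x) * d x"
definition "A1 x = - (\<phi>' x * m (u x) * d x + \<phi> x * m1 (u x) * (d x)\<^sup>2 + \<phi> x * m (u x) * w x)"
definition "C x = \<phi> x * m1 (u x) * (d x) ^ 3 / 3 - \<phi>' x * (d x)\<^sup>2 * m (u x) / 3"
definition "C1 x = \<phi>' x * m1 (u x) * (d x) ^ 3 / 3 + \<phi> x * m2 (u x) * (d x) ^ 4 / 3 + \<phi> x * m1 (u x) * (d x)\<^sup>2 * w x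
   - \<phi>'' x * (d x)\<^sup>2 * m (u x) / 3 - 2 / 3 * \<phi>' x * d x * w x * m (u x) - \<phi>' x * (d x) ^ 3 * m1 (u x) / 3"
definition "F x = A x * w x + C x"

lemma uc: "continuous_on {a..b} u"
  using ud by (rule DERIV_continuous_on)

lemma open_Pos: "open Pos"
proof -
  have "continuous_on {a<..<b} u" by (rule continuous_on_subset[OF uc]) auto
  then have "open ({a<..<b} \<inter> u -` {0<..})" by (intro continuous_open_preimage) auto
  also have "{a<..<b} \<inter> u -` {0<..} = Pos" by auto
  finally show ?thesis .
qed

lemma u_at: "x \<in> {a<..<b} \<Longrightarrow> (u has_real_derivative d x) (at x)"
  using ud[of x] at_within_Icc_at[of a x b] by simp

lemma A_deriv: "x \<in> Pos \<Longrightarrow> (A has_real_derivative A1 x) (at x)"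
  and C_deriv: "x \<in> Pos \<Longrightarrow> (C has_real_derivative C1 x) (at x)"
proof -
  assume x: "x \<in> Pos"
  then have ux: "(u has_real_derivative d x) (at x)" and dx: "(d has_real_derivative w x) (at x)"
    using u_at dw by auto
  have mu: "((\<lambda>x. m (u x)) has_real_derivative m1 (u x) * d x) (at x)"
    and mu1: "((\<lambda>x. m1 (u x)) has_real_derivative m2 (u x) * d x) (at x)"
    using x \<delta> DERIV_chain2[OF trunc_has_derivative(1) ux] DERIV_chain2[OF trunc_has_derivative(2) ux]
    by (auto simp: m1_def m2_def)
  show "(A has_real_derivative A1 x) (at x)"
    unfolding A_def A1_def
    by (rule DERIV_cong[OF DERIV_mult[OF DERIV_mult[OF DERIV_minus[OF \<phi>d(1)] mu] dx]])
       (simp add: algebra_simps power2_eq_square)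
  show "(C has_real_derivative C1 x) (at x)"
    unfolding C_def C1_def
    by (rule DERIV_cong[OF DERIV_diff[OF DERIV_cdivide[OF DERIV_mult[OF DERIV_mult[OF \<phi>d(1) mu1] DERIV_power[OF dx, of 3]]]
          DERIV_cdivide[OF DERIV_mult[OF DERIV_mult[OF \<phi>d(2) DERIV_power[OF dx, of 2]] mu]]]])
       (simp add: field_simps power2_eq_square power3_eq_cube power4_eq_xxxx)
qed

lemma F_increment_le:
  assumes xy: "x \<le> y" "{x..y} \<subseteq> Pos"
  shows "set_integrable lborel {x..y} integrand" "F y - F x \<le> (LBINT s:{x..y}. integrand s)"
proof -
  let ?S = "{x..y}"
  have z: "set_integrable lborel ?S z" using wz[OF xy] by blast
  have sub: "?S \<subseteq> {a..b}" using xy by auto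
  have conts: "continuous_on ?S u" "continuous_on ?S d" "continuous_on ?S w"
    "continuous_on ?S \<phi>" "continuous_on ?S \<phi>'" "continuous_on ?S \<phi>''"
    using continuous_on_subset[OF uc sub] continuous_on_subset[OF dc sub] continuous_on_subset[OF wc xy(2)]
      continuous_on_subset[OF \<phi>c, of ?S] DERIV_continuous_on[of ?S \<phi> \<phi>'] DERIV_continuous_on[of ?S \<phi>' \<phi>'']
      \<phi>d[THEN DERIV_subset] by auto
  have nz: "\<And>s. s \<in> ?S \<Longrightarrow> u s + \<delta> \<noteq> 0" using u0 sub \<delta> by (metis add_nonneg_pos less_numeral_extra(3) subsetD)
  have mc: "continuous_on ?S (\<lambda>s. m (u s))" "continuous_on ?S (\<lambda>s. m1 (u s))" "continuous_on ?S (\<lambda>s. m2 (u s))"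
    unfolding trunc_def m1_def m2_def using nz by (intro continuous_intros conts; auto)+
  note cs = continuous_intros conts mc
  have Ac: "continuous_on ?S A" and A1c: "continuous_on ?S A1"
    unfolding A_def A1_def by (intro cs; simp)+
  define q1 where "q1 s = - 5/3 * \<phi>' s * m (u s) * d s * w s - 1/3 * m (u s) * \<phi>'' s * (d s)\<^sup>2" for s
  have q1c: "continuous_on ?S q1" unfolding q1_def by (intro cs)
  have Az: "set_integrable lborel ?S (\<lambda>s. A s * z s)" by (rule set_integrable_continuous_mult[OF z Ac])
  have q1i: "set_integrable lborel ?S q1" by (rule borel_integrable_atLeastAtMost'[OF q1c])
  have ig: "integrand = (\<lambda>s. A s * z s + q1 s)"
    by (auto simp: integrand_def A_def q1_def)
  show "set_integrable lborel ?S integrand" unfolding ig using Az q1i by simp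
  define D where "D s = A s * w s - (LBINT r:{x..s}. A r * z r) + C s" for s
  have Dd: "(D has_real_derivative A1 s * w s + C1 s) (at s within ?S)" if s: "s \<in> ?S" for s
    unfolding D_def
  proof (rule DERIV_add)
    show "((\<lambda>s. A s * w s - (LBINT r:{x..s}. A r * z r)) has_real_derivative A1 s * w s) (at s within ?S)"
    proof (rule has_real_derivative_product_AC[OF z _ _ A1c s])
      fix p q assume "x \<le> p" "p \<le> q" "q \<le> y"
      moreover from this have "{p..q} \<subseteq> ?S" by auto
      then have "{p..q} \<subseteq> Pos" using xy(2) by (rule subset_trans)
      ultimately show "w q - w p = (LBINT s:{p..q}. z s)" using wz[of p q] by blast
    next
      fix p assume "p \<in> ?S" then show "(A has_real_derivative A1 p) (at p within ?S)"
        using A_deriv[of p] xy(2) by (blast intro: DERIV_subset)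
    qed
    show "(C has_real_derivative C1 s) (at s within ?S)"
      using C_deriv[of s] xy(2) s by (blast intro: DERIV_subset)
  qed
  have qle: "A1 s * w s + C1 s \<le> q1 s" if s: "s \<in> ?S" for s
  proof -
    have us: "0 \<le> u s" using u0 s sub by auto
    have "A1 s * w s + C1 s = q1 s - \<phi> s * m (u s) * (w s)\<^sup>2 + \<phi> s * m2 (u s) * (d s) ^ 4 / 3"
      unfolding A1_def C1_def q1_def by (simp add: algebra_simps power2_eq_square)
    moreover have "0 \<le> \<phi> s * m (u s) * (w s)\<^sup>2"
      using \<phi>0 trunc_bounds(1)[OF \<delta> us] by simp
    moreover have "\<phi> s * m2 (u s) * (d s) ^ 4 / 3 \<le> 0"
    proof -
      have "m2 (u s) \<le> 0" unfolding m2_def using \<delta> us by (intro divide_nonpos_nonneg) auto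
      then have "\<phi> s * m2 (u s) \<le> 0" using \<phi>0 by (simp add: mult_nonneg_nonpos)
      then show ?thesis by (simp add: mult_nonpos_nonneg)
    qed
    ultimately show ?thesis by linarith
  qed
  have "((\<lambda>s. A1 s * w s + C1 s) has_integral (D y - D x)) ?S"
    by (rule fundamental_theorem_of_calculus[OF xy(1)])
       (use Dd in \<open>simp add: has_real_derivative_iff_has_vector_derivative\<close>)
  moreover have "(q1 has_integral (LBINT s:?S. q1 s)) ?S"
    using set_borel_integral_eq_integral[OF q1i] by (simp add: has_integral_integral)
  ultimately have "D y - D x \<le> (LBINT s:?S. q1 s)"
    by (rule has_integral_le) (use qle in auto)
  moreover have "D y - D x = F y - F x - (LBINT s:?S. A s * z s)"
    by (simp add: D_def F_def set_integral_at_point)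
  ultimately show "F y - F x \<le> (LBINT s:?S. integrand s)"
    unfolding ig using Az q1i by simp
qed

lemma bound: obtains K where "0 < K" "\<And>x. x \<in> {a..b} \<Longrightarrow> \<bar>d x\<bar> \<le> K"
  "\<And>x. x \<in> {a..b} \<Longrightarrow> \<bar>\<phi> x\<bar> \<le> K" "\<And>x. x \<in> {a..b} \<Longrightarrow> \<bar>\<phi>' x\<bar> \<le> K" "\<And>x. x \<in> {a..b} \<Longrightarrow> \<bar>u x\<bar> \<le> K"
proof -
  obtain K1 where 1: "\<And>x. x \<in> {a..b} \<Longrightarrow> \<bar>d x\<bar> \<le> K1" using continuous_on_Icc_bounded[OF dc] by blast
  obtain K2 where 2: "\<And>x. x \<in> {a..b} \<Longrightarrow> \<bar>\<phi> x\<bar> \<le> K2"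
    using continuous_on_Icc_bounded[OF DERIV_continuous_on[OF \<phi>d(1)[THEN DERIV_subset]]] by blast
  obtain K3 where 3: "\<And>x. x \<in> {a..b} \<Longrightarrow> \<bar>\<phi>' x\<bar> \<le> K3"
    using continuous_on_Icc_bounded[OF DERIV_continuous_on[OF \<phi>d(2)[THEN DERIV_subset]]] by blast
  obtain K4 where 4: "\<And>x. x \<in> {a..b} \<Longrightarrow> \<bar>u x\<bar> \<le> K4" using continuous_on_Icc_bounded[OF uc] by blast
  show thesis
    by (rule that[of "max 1 (max (max K1 K2) (max K3 K4))"]) (use 1 2 3 4 in \<open>force simp: le_max_iff_disj\<close>)+
qed

lemma F_bound:
  assumes "x \<in> {a..b}" "\<bar>\<phi> x\<bar> \<le> K" "\<bar>\<phi>' x\<bar> \<le> K" "\<bar>u x\<bar> \<le> K"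
  shows "\<bar>F x\<bar> \<le> K * \<bar>u x * d x * w x\<bar> + (K * \<bar>d x\<bar> ^ 3 + K * K * \<bar>d x\<bar>\<^sup>2)"
proof -
  have ux: "0 \<le> u x" using u0 assms by auto
  note mb = trunc_bounds[OF \<delta> ux]
  have m1: "0 \<le> m1 (u x)" "m1 (u x) \<le> 1"
    using \<delta> ux by (auto simp: m1_def divide_le_eq_1 intro!: power_mono)
  have "\<bar>A x * w x\<bar> = \<bar>\<phi> x\<bar> * (m (u x) * \<bar>d x * w x\<bar>)"
    using mb by (simp add: A_def abs_mult)
  also have "\<dots> \<le> K * (u x * \<bar>d x * w x\<bar>)"
    using mb assms by (intro mult_mono) auto
  also have "\<dots> = K * \<bar>u x * d x * w x\<bar>" using ux by (simp add: abs_mult)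
  finally have 1: "\<bar>A x * w x\<bar> \<le> K * \<bar>u x * d x * w x\<bar>" .
  have 2: "\<bar>\<phi> x * m1 (u x) * (d x) ^ 3 / 3\<bar> \<le> K * \<bar>d x\<bar> ^ 3"
  proof -
    have "\<bar>\<phi> x\<bar> * m1 (u x) * \<bar>d x\<bar> ^ 3 \<le> K * 1 * \<bar>d x\<bar> ^ 3"
      using m1 assms by (intro mult_mono) auto
    moreover have "0 \<le> \<bar>\<phi> x\<bar> * m1 (u x) * \<bar>d x\<bar> ^ 3" using m1 by simp
    moreover have "\<bar>\<phi> x * m1 (u x) * (d x) ^ 3 / 3\<bar> = \<bar>\<phi> x\<bar> * m1 (u x) * \<bar>d x\<bar> ^ 3 / 3"
      using m1 by (simp add: abs_mult power_abs)
    ultimately show ?thesis by linarith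
  qed
  have 3: "\<bar>\<phi>' x * (d x)\<^sup>2 * m (u x) / 3\<bar> \<le> K * K * \<bar>d x\<bar>\<^sup>2"
  proof -
    have "\<bar>\<phi>' x\<bar> * (d x)\<^sup>2 * m (u x) \<le> K * (d x)\<^sup>2 * K"
      using mb assms by (intro mult_mono) auto
    moreover have "0 \<le> \<bar>\<phi>' x\<bar> * (d x)\<^sup>2 * m (u x)" using mb by simp
    moreover have "\<bar>\<phi>' x * (d x)\<^sup>2 * m (u x) / 3\<bar> = \<bar>\<phi>' x\<bar> * (d x)\<^sup>2 * m (u x) / 3"
      using mb by (simp add: abs_mult)
    moreover have "K * (d x)\<^sup>2 * K = K * K * \<bar>d x\<bar>\<^sup>2" by simp
    ultimately show ?thesis by linarith
  qed
  show ?thesis unfolding F_def C_def using 1 2 3 by linarith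
qed

lemma d_zero:
  assumes "x \<in> {a<..<b}" "u x = 0" shows "d x = 0"
proof (rule DERIV_local_min[OF u_at[OF assms(1)]])
  show "0 < min (x - a) (b - x)" using assms by auto
  show "\<forall>y. \<bar>x - y\<bar> < min (x - a) (b - x) \<longrightarrow> u x \<le> u y"
    using u0 assms by (auto simp: abs_if split: if_splits)
qed

lemma d_small:
  assumes x: "x \<in> {a..b}" "d x = 0" and e: "0 < e" and K: "0 < K"
  obtains r where "0 < r" "\<And>y. y \<in> {a..b} \<Longrightarrow> \<bar>y - x\<bar> < r \<Longrightarrow> K * \<bar>d y\<bar> ^ 3 + K * K * \<bar>d y\<bar>\<^sup>2 < e"
proof -
  have "continuous_on {a..b} (\<lambda>y. K * \<bar>d y\<bar> ^ 3 + K * K * \<bar>d y\<bar>\<^sup>2)"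
    by (intro continuous_intros dc)
  then obtain r where "0 < r" "\<And>y. y \<in> {a..b} \<Longrightarrow> dist y x < r \<Longrightarrow>
      dist (K * \<bar>d y\<bar> ^ 3 + K * K * \<bar>d y\<bar>\<^sup>2) (K * \<bar>d x\<bar> ^ 3 + K * K * \<bar>d x\<bar>\<^sup>2) < e"
    unfolding continuous_on_iff using x(1) e by metis
  then show thesis using that[of r] x(2) K by (auto simp: dist_real_def)
qed

lemma u_lip:
  assumes "\<And>x. x \<in> {a..b} \<Longrightarrow> \<bar>d x\<bar> \<le> K" "x \<in> {a..b}" "y \<in> {a..b}"
  shows "\<bar>u x - u y\<bar> \<le> K * \<bar>x - y\<bar>"
  using field_differentiable_bound[of "{a..b}" u d K x y] ud assms by (simp add: convex_real_interval)

lemma F_small_left: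
  assumes C: "\<alpha> < \<beta>" "{\<alpha><..<\<beta>} \<subseteq> Pos" "a \<le> \<alpha>" "\<beta> \<le> b" "\<alpha> \<notin> Pos" and e: "0 < e" and \<eta>: "\<alpha> < \<eta>" "\<eta> \<le> \<beta>"
  shows "\<exists>x\<in>{\<alpha><..<\<eta>}. \<bar>F x\<bar> < e"
proof (cases "\<alpha> = a")
  case True
  define x where "x = (a + min a' \<eta>) / 2"
  have "x \<in> {\<alpha><..<\<eta>}" "x \<notin> {a'..b'}" using True \<eta> supp by (auto simp: x_def min_def)
  moreover from this have "F x = 0" using supp(3)[of x] by (auto simp: F_def A_def C_def)
  ultimately show ?thesis using e by (intro bexI[of _ x]) simp_all
next
  case False
  have \<alpha>: "\<alpha> \<in> {a<..<b}" using False C by auto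
  have u\<alpha>: "u \<alpha> = 0" using C(5) \<alpha> u0[of \<alpha>] by auto
  obtain K where K: "0 < K" "\<And>x. x \<in> {a..b} \<Longrightarrow> \<bar>d x\<bar> \<le> K" "\<And>x. x \<in> {a..b} \<Longrightarrow> \<bar>\<phi> x\<bar> \<le> K"
    "\<And>x. x \<in> {a..b} \<Longrightarrow> \<bar>\<phi>' x\<bar> \<le> K" "\<And>x. x \<in> {a..b} \<Longrightarrow> \<bar>u x\<bar> \<le> K" using bound by blast
  obtain r where r: "0 < r" "\<And>y. y \<in> {a..b} \<Longrightarrow> \<bar>y - \<alpha>\<bar> < r \<Longrightarrow> K * \<bar>d y\<bar> ^ 3 + K * K * \<bar>d y\<bar>\<^sup>2 < e / 2"
    using d_small[of \<alpha> "e/2" K] d_zero[OF \<alpha> u\<alpha>] \<alpha> e K(1) by auto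
  define \<theta> where "\<theta> = min \<eta> (\<alpha> + r)"
  have \<theta>: "\<alpha> < \<theta>" "\<theta> \<le> \<beta>" "\<theta> \<le> \<eta>" "\<theta> \<le> \<alpha> + r" using \<eta> r by (auto simp: \<theta>_def)
  have "{\<alpha><..<\<theta>} \<subseteq> {\<alpha><..<\<beta>}" using \<theta> by auto
  then have sub: "{\<alpha><..<\<theta>} \<subseteq> Pos" using C(2) by (rule subset_trans)
  have "\<exists>x\<in>{\<alpha><..<\<theta>}. \<bar>u x * d x * w x\<bar> < e / (2 * K)"
  proof (rule exists_small_flux_left[OF \<theta>(1), where K=K])
    show "0 < e / (2 * K)" using e K by simp
    fix x assume x: "x \<in> {\<alpha><..<\<theta>}"
    then have xP: "x \<in> Pos" using sub by blast
    show "0 < u x \<and> u x \<le> K * (x - \<alpha>)"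
      using u_lip[OF K(2), of x \<alpha>] u\<alpha> \<alpha> x xP by auto
    show "(d has_real_derivative w x) (at x)" using xP dw by auto
    show "\<bar>d x\<bar> \<le> K" using K(2) xP by auto
  next
    show "continuous_on {\<alpha><..<\<theta>} w" by (rule continuous_on_subset[OF wc sub])
  qed
  then obtain x where x: "x \<in> {\<alpha><..<\<theta>}" "\<bar>u x * d x * w x\<bar> < e / (2 * K)" by blast
  have xab: "x \<in> {a..b}" using x sub by force
  have "\<bar>F x\<bar> \<le> K * \<bar>u x * d x * w x\<bar> + (K * \<bar>d x\<bar> ^ 3 + K * K * \<bar>d x\<bar>\<^sup>2)"
    by (rule F_bound) (use K xab in auto)
  also have "\<dots> < K * (e / (2 * K)) + e / 2"
    using x(2) K(1) r(2)[OF xab] x(1) \<theta> by (intro add_strict_mono mult_strict_left_mono) auto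
  also have "\<dots> = e" using K(1) by simp
  finally show ?thesis using x \<theta> by auto
qed

lemma F_small_right:
  assumes C: "\<alpha> < \<beta>" "{\<alpha><..<\<beta>} \<subseteq> Pos" "a \<le> \<alpha>" "\<beta> \<le> b" "\<beta> \<notin> Pos" and e: "0 < e" and \<eta>: "\<eta> < \<beta>" "\<alpha> \<le> \<eta>"
  shows "\<exists>x\<in>{\<eta><..<\<beta>}. \<bar>F x\<bar> < e"
proof (cases "\<beta> = b")
  case True
  define x where "x = (b + max b' \<eta>) / 2"
  have "x \<in> {\<eta><..<\<beta>}" "x \<notin> {a'..b'}" using True \<eta> supp by (auto simp: x_def max_def)
  moreover from this have "F x = 0" using supp(3)[of x] by (auto simp: F_def A_def C_def)
  ultimately show ?thesis using e by (intro bexI[of _ x]) simp_all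
next
  case False
  have \<beta>: "\<beta> \<in> {a<..<b}" using False C by auto
  have u\<beta>: "u \<beta> = 0" using C(5) \<beta> u0[of \<beta>] by auto
  obtain K where K: "0 < K" "\<And>x. x \<in> {a..b} \<Longrightarrow> \<bar>d x\<bar> \<le> K" "\<And>x. x \<in> {a..b} \<Longrightarrow> \<bar>\<phi> x\<bar> \<le> K"
    "\<And>x. x \<in> {a..b} \<Longrightarrow> \<bar>\<phi>' x\<bar> \<le> K" "\<And>x. x \<in> {a..b} \<Longrightarrow> \<bar>u x\<bar> \<le> K" using bound by blast
  obtain r where r: "0 < r" "\<And>y. y \<in> {a..b} \<Longrightarrow> \<bar>y - \<beta>\<bar> < r \<Longrightarrow> K * \<bar>d y\<bar> ^ 3 + K * K * \<bar>d y\<bar>\<^sup>2 < e / 2"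
    using d_small[of \<beta> "e/2" K] d_zero[OF \<beta> u\<beta>] \<beta> e K(1) by auto
  define \<theta> where "\<theta> = max \<eta> (\<beta> - r)"
  have \<theta>: "\<theta> < \<beta>" "\<alpha> \<le> \<theta>" "\<eta> \<le> \<theta>" "\<beta> - r \<le> \<theta>" using \<eta> r by (auto simp: \<theta>_def)
  have "{\<theta><..<\<beta>} \<subseteq> {\<alpha><..<\<beta>}" using \<theta> by auto
  then have sub: "{\<theta><..<\<beta>} \<subseteq> Pos" using C(2) by (rule subset_trans)
  have "\<exists>x\<in>{\<theta><..<\<beta>}. \<bar>u x * d x * w x\<bar> < e / (2 * K)"
  proof (rule exists_small_flux_right[OF \<theta>(1), where K=K])
    show "0 < e / (2 * K)" using e K by simp
    fix x assume x: "x \<in> {\<theta><..<\<beta>}"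
    then have xP: "x \<in> Pos" using sub by blast
    show "0 < u x \<and> u x \<le> K * (\<beta> - x)"
      using u_lip[OF K(2), of x \<beta>] u\<beta> \<beta> x xP by auto
    show "(d has_real_derivative w x) (at x)" using xP dw by auto
    show "\<bar>d x\<bar> \<le> K" using K(2) xP by auto
  next
    show "continuous_on {\<theta><..<\<beta>} w" by (rule continuous_on_subset[OF wc sub])
  qed
  then obtain x where x: "x \<in> {\<theta><..<\<beta>}" "\<bar>u x * d x * w x\<bar> < e / (2 * K)" by blast
  have xab: "x \<in> {a..b}" using x sub by force
  have "\<bar>F x\<bar> \<le> K * \<bar>u x * d x * w x\<bar> + (K * \<bar>d x\<bar> ^ 3 + K * K * \<bar>d x\<bar>\<^sup>2)"
    by (rule F_bound) (use K xab in auto)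
  also have "\<dots> < K * (e / (2 * K)) + e / 2"
    using x(2) K(1) r(2)[OF xab] x(1) \<theta> by (intro add_strict_mono mult_strict_left_mono) auto
  also have "\<dots> = e" using K(1) by simp
  finally show ?thesis using x \<theta> by auto
qed

lemma component_nonneg:
  assumes C: "\<alpha> < \<beta>" "{\<alpha><..<\<beta>} \<subseteq> Pos" "a \<le> \<alpha>" "\<beta> \<le> b" "\<alpha> \<notin> Pos" "\<beta> \<notin> Pos"
    and gi: "set_integrable lborel {\<alpha><..<\<beta>} integrand"
  shows "0 \<le> (LBINT x:{\<alpha><..<\<beta>}. integrand x)"
proof -
  define c where "c = (\<alpha> + \<beta>) / 2"
  have c: "\<alpha> < c" "c < \<beta>" using C by (auto simp: c_def)
  have "\<exists>x\<in>{\<alpha><..<min c (\<alpha> + 1 / Suc n)}. \<bar>F x\<bar> < 1 / Suc n" for n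
    by (rule F_small_left[OF C(1-5)]) (use c in auto)
  then obtain X where X: "\<And>n. X n \<in> {\<alpha><..<min c (\<alpha> + 1 / Suc n)}" "\<And>n. \<bar>F (X n)\<bar> < 1 / Suc n" by metis
  have "\<exists>x\<in>{max c (\<beta> - 1 / Suc n)<..<\<beta>}. \<bar>F x\<bar> < 1 / Suc n" for n
    by (rule F_small_right[OF C(1-4) C(6)]) (use c in auto)
  then obtain Y where Y: "\<And>n. Y n \<in> {max c (\<beta> - 1 / Suc n)<..<\<beta>}" "\<And>n. \<bar>F (Y n)\<bar> < 1 / Suc n" by metis
  have in_f: "\<bar>F (Y n)\<bar> + \<bar>F (X n)\<bar> \<le> 2 / Suc n" for n
    using X(2)[of n] Y(2)[of n] by simp
  have low: "- (2 / Suc n) \<le> (LBINT x:{X n..Y n}. integrand x)" for n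
  proof -
    have "X n \<le> Y n" "{X n..Y n} \<subseteq> {\<alpha><..<\<beta>}" using X(1)[of n] Y(1)[of n] by auto
    then show ?thesis using F_increment_le(2)[of "X n" "Y n"] C(2) in_f[of n] by (smt (verit) subset_trans)
  qed
  have lim: "(\<lambda>n. LBINT x:{X n..Y n}. integrand x) \<longlonglongrightarrow> (LBINT x:{\<alpha><..<\<beta>}. integrand x)"
    unfolding set_lebesgue_integral_def
  proof (rule integral_dominated_convergence[where w="\<lambda>x. norm (indicator {\<alpha><..<\<beta>} x *\<^sub>R integrand x)"])
    show "integrable lborel (\<lambda>x. norm (indicator {\<alpha><..<\<beta>} x *\<^sub>R integrand x))"
      using gi unfolding set_integrable_def by (rule integrable_norm)
    show m: "(\<lambda>x. indicator {\<alpha><..<\<beta>} x *\<^sub>R integrand x) \<in> borel_measurable lborel"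
      using gi unfolding set_integrable_def by (rule borel_measurable_integrable)
    fix n
    have sub: "{X n..Y n} \<subseteq> {\<alpha><..<\<beta>}" using X(1)[of n] Y(1)[of n] by auto
    show "(\<lambda>x. indicator {X n..Y n} x *\<^sub>R integrand x) \<in> borel_measurable lborel"
      using set_integrable_subset[OF gi _ sub] unfolding set_integrable_def by auto
    show "AE x in lborel. norm (indicator {X n..Y n} x *\<^sub>R integrand x) \<le> norm (indicator {\<alpha><..<\<beta>} x *\<^sub>R integrand x)"
      using sub by (intro AE_I2) (auto simp: subset_eq split: split_indicator)
  next
    show "AE x in lborel. (\<lambda>n. indicator {X n..Y n} x *\<^sub>R integrand x) \<longlonglongrightarrow> indicator {\<alpha><..<\<beta>} x *\<^sub>R integrand x"
    proof (intro AE_I2 tendsto_scaleR tendsto_const)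
      fix x
      show "(\<lambda>n. indicator {X n..Y n} x) \<longlonglongrightarrow> indicat_real {\<alpha><..<\<beta>} x"
      proof (cases "x \<in> {\<alpha><..<\<beta>}")
        case False
        then have "x \<notin> {X n..Y n}" for n using X(1)[of n] Y(1)[of n] by auto
        then show ?thesis using False by simp
      next
        case True
        have "(\<lambda>n. 1 / real (Suc n)) \<longlonglongrightarrow> 0" using LIMSEQ_inverse_real_of_nat by (simp add: inverse_eq_divide)
        moreover have "0 < min (x - \<alpha>) (\<beta> - x)" using True by simp
        ultimately have "\<forall>\<^sub>F n in sequentially. 1 / real (Suc n) < min (x - \<alpha>) (\<beta> - x)"
          by (rule order_tendstoD)
        then have "\<forall>\<^sub>F n in sequentially. indicat_real {X n..Y n} x = indicat_real {\<alpha><..<\<beta>} x"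
        proof eventually_elim
          case (elim n)
          then have "x \<in> {X n..Y n}" using X(1)[of n] Y(1)[of n] by auto
          then show ?case using True by simp
        qed
        then show ?thesis by (rule tendsto_eventually)
      qed
    qed
  qed
  have "(\<lambda>n. - (2 / real (Suc n))) \<longlonglongrightarrow> 0"
    using tendsto_mult_right_zero[OF LIMSEQ_inverse_real_of_nat, of "-2"] by (simp add: inverse_eq_divide)
  then show ?thesis using lim low by (intro LIMSEQ_le[of _ 0]) auto
qed

theorem integral_nonneg:
  assumes gi: "set_integrable lborel Pos integrand"
  shows "0 \<le> (LBINT x:Pos. integrand x)"
proof (rule set_integral_nonneg_components[OF open_Pos gi])
  fix C assume C: "C \<in> components Pos"
  have "Pos \<subseteq> {a<..<b}" by auto
  from bounded_component_interval[OF open_Pos this C] obtain \<alpha> \<beta> where *: "\<alpha> < \<beta>" "C = {\<alpha><..<\<beta>}" "a \<le> \<alpha>" "\<beta> \<le> b" "\<alpha> \<notin> Pos" "\<beta> \<notin> Pos"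
    by blast
  have sub: "C \<subseteq> Pos" by (rule in_components_subset[OF C])
  have "set_integrable lborel C integrand" by (rule set_integrable_subset[OF gi _ sub]) (simp add: *)
  then show "0 \<le> (LBINT x:C. integrand x)"
    using component_nonneg[OF *(1) _ *(3-6)] sub unfolding *(2) by blast
qed

end

subsection \<open>The negative Sobolev space\<close>

lemma test_fun_bounds:
  fixes \<phi> :: "'a::euclidean_space \<Rightarrow> real"
  assumes "test_fun U \<phi>"
  shows "\<exists>C>0. \<forall>x. \<bar>\<phi> x\<bar> \<le> C"
proof -
  define K where "K = closure {p. \<phi> p \<noteq> 0}"
  have K: "compact K" and sm: "smooth \<phi>" using assms by (auto simp: test_fun_def K_def)
  have cp: "compact (\<phi> ` K)"
    by (rule compact_continuous_image[OF continuous_on_subset[OF smooth_continuous[OF sm]] K]) simp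
  then obtain C where C: "\<forall>y\<in>\<phi> ` K. norm y \<le> C" using compact_imp_bounded[OF cp] unfolding bounded_iff by blast
  have "\<bar>\<phi> x\<bar> \<le> max 1 C" for x
  proof (cases "x \<in> K")
    case True then show ?thesis using C by auto
  next
    case False then have "\<phi> x = 0" using closure_subset[of "{p. \<phi> p \<noteq> 0}"] by (auto simp: K_def)
    then show ?thesis by simp
  qed
  then show ?thesis by (intro exI[of _ "max 1 C"]) auto
qed

lemma test_fun_zero_outside:
  assumes "test_fun U \<phi>" "x \<notin> closure {p. \<phi> p \<noteq> 0}"
  shows "\<phi> x = 0" "pd v \<phi> x = 0"
proof -
  show "\<phi> x = 0" using assms(2) closure_subset[of "{p. \<phi> p \<noteq> 0}"] by auto
  have "((\<lambda>_. 0) has_derivative (\<lambda>_. 0)) (at x)" by simp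
  then have "(\<phi> has_derivative (\<lambda>_. 0)) (at x)"
  proof (rule has_derivative_transform_within_open)
    show "open (- closure {p. \<phi> p \<noteq> 0})" by (intro open_Compl closed_closure)
    show "0 = \<phi> y" if "y \<in> - closure {p. \<phi> p \<noteq> 0}" for y using that closure_subset[of "{p. \<phi> p \<noteq> 0}"] by auto
  qed (use assms(2) in auto)
  then show "pd v \<phi> x = 0" by (rule pd_eqI)
qed

lemma test_fun_pd:
  assumes "test_fun U \<phi>" "v \<in> Basis" shows "test_fun U (pd v \<phi>)"
proof (rule test_funI[where K="closure {p. \<phi> p \<noteq> 0}"])
  show "smooth (pd v \<phi>)" using assms unfolding test_fun_def by (intro smooth_pd) auto
  show "compact (closure {p. \<phi> p \<noteq> 0})" "closure {p. \<phi> p \<noteq> 0} \<subseteq> U"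
    using assms(1) unfolding test_fun_def by auto
  show "pd v \<phi> x = 0" if "x \<notin> closure {p. \<phi> p \<noteq> 0}" for x
    by (rule test_fun_zero_outside(2)[OF assms(1) that])
qed

lemma deriv_eq_pd: fixes \<phi> :: "real \<Rightarrow> real" shows "smooth \<phi> \<Longrightarrow> deriv \<phi> = pd 1 \<phi>"
  using DERIV_imp_deriv[OF smooth_has_real_derivative] by blast

lemma smooth_measurable [measurable_dest]:
  fixes \<phi> :: "'a::euclidean_space \<Rightarrow> real" shows "smooth \<phi> \<Longrightarrow> \<phi> \<in> borel_measurable borel"
  by (intro borel_measurable_continuous_onI smooth_continuous)

lemma set_integrable_mult_bounded:
  fixes f g :: "'a \<Rightarrow> real"
  assumes f: "set_integrable M A f" and g: "g \<in> borel_measurable M" "\<And>x. \<bar>g x\<bar> \<le> C"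
  shows "set_integrable M A (\<lambda>x. f x * g x)" "\<bar>LINT x:A|M. f x * g x\<bar> \<le> C * (LINT x:A|M. \<bar>f x\<bar>)"
proof -
  have m: "(\<lambda>x. indicator A x *\<^sub>R f x) \<in> borel_measurable M"
    using f by (simp add: set_integrable_def)
  have e: "(\<lambda>x. indicator A x *\<^sub>R (f x * g x)) = (\<lambda>x. (indicator A x *\<^sub>R f x) * g x)" by auto
  have bd: "\<bar>f x * g x\<bar> \<le> C * \<bar>f x\<bar>" for x
    using mult_left_mono[OF g(2)[of x], of "\<bar>f x\<bar>"] by (simp add: abs_mult mult.commute)
  show i: "set_integrable M A (\<lambda>x. f x * g x)"
  proof (rule set_integrable_bound)
    show "set_integrable M A (\<lambda>x. C * f x)" using f by simp
    show "set_borel_measurable M A (\<lambda>x. f x * g x)"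
      unfolding set_borel_measurable_def e using m g(1) by (rule borel_measurable_times)
    show "AE x in M. x \<in> A \<longrightarrow> norm (f x * g x) \<le> norm (C * f x)"
    proof (intro AE_I2 impI)
      fix x
      have "C * \<bar>f x\<bar> \<le> \<bar>C\<bar> * \<bar>f x\<bar>" by (intro mult_right_mono) auto
      then show "norm (f x * g x) \<le> norm (C * f x)"
        using bd[of x] by (simp add: abs_mult)
    qed
  qed
  have "\<bar>LINT x:A|M. f x * g x\<bar> \<le> (LINT x:A|M. \<bar>f x * g x\<bar>)"
    using integral_norm_bound[of M "\<lambda>x. indicator A x *\<^sub>R (f x * g x)"]
    by (simp add: set_lebesgue_integral_def abs_mult)
  also have "\<dots> \<le> (LINT x:A|M. C * \<bar>f x\<bar>)"
    by (rule set_integral_mono) (use set_integrable_abs[OF i] set_integrable_abs[OF f] bd in auto)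
  finally show "\<bar>LINT x:A|M. f x * g x\<bar> \<le> C * (LINT x:A|M. \<bar>f x\<bar>)" by simp
qed

lemma Wm11_norm_le:
  assumes "Wm11_rep U F f0 f1"
  shows "Wm11_norm U F \<le> (LBINT x:U. \<bar>f0 x\<bar>) + (LBINT x:U. \<bar>f1 x\<bar>)"
  unfolding Wm11_norm_def
proof (rule cInf_lower)
  show "bdd_below {(LBINT x:U. \<bar>f0 x\<bar>) + (LBINT x:U. \<bar>f1 x\<bar>) |f0 f1. Wm11_rep U F f0 f1}"
    by (rule bdd_belowI[of _ 0]) (auto simp: set_lebesgue_integral_def)
qed (use assms in blast)

lemma Wm11_norm_greatest:
  assumes "F \<in> Wm11 U"
    and "\<And>f0 f1. Wm11_rep U F f0 f1 \<Longrightarrow> c \<le> (LBINT x:U. \<bar>f0 x\<bar>) + (LBINT x:U. \<bar>f1 x\<bar>)"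
  shows "c \<le> Wm11_norm U F"
  unfolding Wm11_norm_def by (rule cInf_greatest) (use assms in \<open>auto simp: Wm11_def\<close>)

lemma Wm11_norm_nonneg: "F \<in> Wm11 U \<Longrightarrow> 0 \<le> Wm11_norm U F"
  by (rule Wm11_norm_greatest) (auto simp: set_lebesgue_integral_def)

lemma Wm11_rep_diff:
  assumes "open U" and F: "Wm11_rep U F f0 f1" and G: "Wm11_rep U G g0 g1"
  shows "Wm11_rep U (\<lambda>\<phi>. F \<phi> - G \<phi>) (\<lambda>x. f0 x - g0 x) (\<lambda>x. f1 x - g1 x)"
  unfolding Wm11_rep_def
proof (intro conjI allI impI)
  show "set_integrable lborel U (\<lambda>x. f0 x - g0 x)" "set_integrable lborel U (\<lambda>x. f1 x - g1 x)"
    using F G by (auto simp: Wm11_rep_def)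
  fix \<phi> :: "real \<Rightarrow> real" assume t: "test_fun U \<phi>"
  then have sm: "smooth \<phi>" by (simp add: test_fun_def)
  obtain C where C: "\<And>x. \<bar>\<phi> x\<bar> \<le> C" using test_fun_bounds[OF t] by blast
  obtain D where D: "\<And>x. \<bar>deriv \<phi> x\<bar> \<le> D"
    using test_fun_bounds[OF test_fun_pd[OF t, of 1]] by (auto simp: deriv_eq_pd[OF sm])
  have m: "\<phi> \<in> borel_measurable lborel" "deriv \<phi> \<in> borel_measurable lborel"
    using smooth_measurable[OF sm] smooth_measurable[OF smooth_pd[OF sm, of 1]] by (auto simp: deriv_eq_pd[OF sm])
  have i: "set_integrable lborel U (\<lambda>x. f0 x * \<phi> x)" "set_integrable lborel U (\<lambda>x. g0 x * \<phi> x)"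
    "set_integrable lborel U (\<lambda>x. f1 x * deriv \<phi> x)" "set_integrable lborel U (\<lambda>x. g1 x * deriv \<phi> x)"
    using F G by (auto simp: Wm11_rep_def intro!: set_integrable_mult_bounded m C D)
  show "F \<phi> - G \<phi> = (LBINT x:U. (f0 x - g0 x) * \<phi> x) - (LBINT x:U. (f1 x - g1 x) * deriv \<phi> x)"
    using F G t i by (simp add: Wm11_rep_def left_diff_distrib)
qed

lemma Wm11_diff:
  assumes U: "open U" and F: "F \<in> Wm11 U" and G: "G \<in> Wm11 U"
  shows "(\<lambda>\<phi>. F \<phi> - G \<phi>) \<in> Wm11 U"
    "Wm11_norm U (\<lambda>\<phi>. F \<phi> - G \<phi>) \<le> Wm11_norm U F + Wm11_norm U G"
proof -
  show "(\<lambda>\<phi>. F \<phi> - G \<phi>) \<in> Wm11 U" using Wm11_rep_diff[OF U] F G unfolding Wm11_def by blast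
  have "Wm11_norm U (\<lambda>\<phi>. F \<phi> - G \<phi>) - Wm11_norm U G \<le> Wm11_norm U F"
  proof (rule Wm11_norm_greatest[OF F])
    fix f0 f1 assume f: "Wm11_rep U F f0 f1"
    have "Wm11_norm U (\<lambda>\<phi>. F \<phi> - G \<phi>) - ((LBINT x:U. \<bar>f0 x\<bar>) + (LBINT x:U. \<bar>f1 x\<bar>)) \<le> Wm11_norm U G"
    proof (rule Wm11_norm_greatest[OF G])
      fix g0 g1 assume g: "Wm11_rep U G g0 g1"
      have i: "set_integrable lborel U f0" "set_integrable lborel U f1" "set_integrable lborel U g0" "set_integrable lborel U g1"
        using f g by (auto simp: Wm11_rep_def)
      have tri: "(LBINT x:U. \<bar>p x - q x\<bar>) \<le> (LBINT x:U. \<bar>p x\<bar>) + (LBINT x:U. \<bar>q x\<bar>)"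
        if "set_integrable lborel U p" "set_integrable lborel U q" for p q :: "real \<Rightarrow> real"
      proof -
        note a = set_integrable_abs[OF that(1)] set_integrable_abs[OF that(2)]
        have "(LBINT x:U. \<bar>p x - q x\<bar>) \<le> (LBINT x:U. \<bar>p x\<bar> + \<bar>q x\<bar>)"
          by (rule set_integral_mono[OF set_integrable_abs]) (use that a in \<open>auto intro: abs_triangle_ineq4\<close>)
        then show ?thesis using a by simp
      qed
      show "Wm11_norm U (\<lambda>\<phi>. F \<phi> - G \<phi>) - ((LBINT x:U. \<bar>f0 x\<bar>) + (LBINT x:U. \<bar>f1 x\<bar>)) \<le> (LBINT x:U. \<bar>g0 x\<bar>) + (LBINT x:U. \<bar>g1 x\<bar>)"
        using Wm11_norm_le[OF Wm11_rep_diff[OF U f g]] tri[OF i(1,3)] tri[OF i(2,4)] by linarith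
    qed
    then show "Wm11_norm U (\<lambda>\<phi>. F \<phi> - G \<phi>) - Wm11_norm U G \<le> (LBINT x:U. \<bar>f0 x\<bar>) + (LBINT x:U. \<bar>f1 x\<bar>)"
      by linarith
  qed
  then show "Wm11_norm U (\<lambda>\<phi>. F \<phi> - G \<phi>) \<le> Wm11_norm U F + Wm11_norm U G" by linarith
qed

lemma Wm11_zero: "(\<lambda>_. 0) \<in> Wm11 U" "Wm11_norm U (\<lambda>_. 0) = 0"
proof -
  have r: "Wm11_rep U (\<lambda>_. 0) (\<lambda>_. 0) (\<lambda>_. 0)" by (simp add: Wm11_rep_def set_integrable_def)
  then show z: "(\<lambda>_. 0) \<in> Wm11 U" by (auto simp: Wm11_def)
  show "Wm11_norm U (\<lambda>_. 0) = 0"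
    using Wm11_norm_le[OF r] Wm11_norm_nonneg[OF z] by (simp add: set_lebesgue_integral_def)
qed

lemma Wm11_norm_diff_commute:
  assumes U: "open U" and F: "F \<in> Wm11 U" and G: "G \<in> Wm11 U"
  shows "Wm11_norm U (\<lambda>\<phi>. F \<phi> - G \<phi>) = Wm11_norm U (\<lambda>\<phi>. G \<phi> - F \<phi>)"
proof -
  have "Wm11_norm U (\<lambda>\<phi>. F \<phi> - G \<phi>) \<le> Wm11_norm U (\<lambda>\<phi>. G \<phi> - F \<phi>)" if "F \<in> Wm11 U" "G \<in> Wm11 U" for F G
    using Wm11_diff(2)[OF U Wm11_zero(1) Wm11_diff(1)[OF U that(2,1)]] by (simp add: Wm11_zero)
  from this[OF F G] this[OF G F] show ?thesis by simp
qed

lemma Wm11_norm_diff_diff_le: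
  assumes U: "open U" and W: "A \<in> Wm11 U" "B \<in> Wm11 U" "C \<in> Wm11 U" "D \<in> Wm11 U"
  shows "\<bar>Wm11_norm U (\<lambda>\<phi>. A \<phi> - B \<phi>) - Wm11_norm U (\<lambda>\<phi>. C \<phi> - D \<phi>)\<bar>
    \<le> Wm11_norm U (\<lambda>\<phi>. A \<phi> - C \<phi>) + Wm11_norm U (\<lambda>\<phi>. B \<phi> - D \<phi>)"
proof -
  have "Wm11_norm U (\<lambda>\<phi>. A \<phi> - B \<phi>) \<le> Wm11_norm U (\<lambda>\<phi>. A \<phi> - C \<phi>) + (Wm11_norm U (\<lambda>\<phi>. B \<phi> - D \<phi>) + Wm11_norm U (\<lambda>\<phi>. C \<phi> - D \<phi>))"
    if "A \<in> Wm11 U" "B \<in> Wm11 U" "C \<in> Wm11 U" "D \<in> Wm11 U" for A B C D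
  proof -
    have e: "(\<lambda>\<phi>. A \<phi> - B \<phi>) = (\<lambda>\<phi>. (A \<phi> - C \<phi>) - ((B \<phi> - D \<phi>) - (C \<phi> - D \<phi>)))" by auto
    have "Wm11_norm U (\<lambda>\<phi>. A \<phi> - B \<phi>) \<le> Wm11_norm U (\<lambda>\<phi>. A \<phi> - C \<phi>) + Wm11_norm U (\<lambda>\<phi>. (B \<phi> - D \<phi>) - (C \<phi> - D \<phi>))"
      by (subst e) (intro Wm11_diff U that)
    also have "Wm11_norm U (\<lambda>\<phi>. (B \<phi> - D \<phi>) - (C \<phi> - D \<phi>)) \<le> Wm11_norm U (\<lambda>\<phi>. B \<phi> - D \<phi>) + Wm11_norm U (\<lambda>\<phi>. C \<phi> - D \<phi>)"
      by (intro Wm11_diff U that)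
    finally show ?thesis by simp
  qed
  from this[OF W] this[OF W(3,4,1,2)] show ?thesis
    using Wm11_norm_diff_commute[OF U W(1,3)] Wm11_norm_diff_commute[OF U W(2,4)] by linarith
qed

lemma Wm11_pairing_bound:
  assumes "test_fun U \<phi>"
  shows "\<exists>C. \<forall>F\<in>Wm11 U. \<bar>F \<phi>\<bar> \<le> C * Wm11_norm U F"
proof -
  have sm: "smooth \<phi>" using assms by (simp add: test_fun_def)
  obtain C1 where C1: "0 < C1" "\<And>x. \<bar>\<phi> x\<bar> \<le> C1" using test_fun_bounds[OF assms] by blast
  obtain C2 where C2: "0 < C2" "\<And>x. \<bar>deriv \<phi> x\<bar> \<le> C2"
    using test_fun_bounds[OF test_fun_pd[OF assms, of 1]] by (auto simp: deriv_eq_pd[OF sm])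
  have m: "\<phi> \<in> borel_measurable lborel" "deriv \<phi> \<in> borel_measurable lborel"
    using smooth_measurable[OF sm] smooth_measurable[OF smooth_pd[OF sm, of 1]] by (auto simp: deriv_eq_pd[OF sm])
  define C where "C = max C1 C2"
  have C: "0 < C" "\<And>x. \<bar>\<phi> x\<bar> \<le> C" "\<And>x. \<bar>deriv \<phi> x\<bar> \<le> C"
    using C1 C2 by (auto simp: C_def le_max_iff_disj)
  have "\<bar>F \<phi>\<bar> \<le> C * Wm11_norm U F" if F: "F \<in> Wm11 U" for F
  proof -
    have "\<bar>F \<phi>\<bar> / C \<le> Wm11_norm U F"
    proof (rule Wm11_norm_greatest[OF F])
      fix f0 f1 assume f: "Wm11_rep U F f0 f1"
      then have "F \<phi> = (LBINT x:U. f0 x * \<phi> x) - (LBINT x:U. f1 x * deriv \<phi> x)"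
        using assms by (simp add: Wm11_rep_def)
      moreover have "\<bar>LBINT x:U. f0 x * \<phi> x\<bar> \<le> C * (LBINT x:U. \<bar>f0 x\<bar>)"
        by (rule set_integrable_mult_bounded) (use f m C in \<open>auto simp: Wm11_rep_def\<close>)
      moreover have "\<bar>LBINT x:U. f1 x * deriv \<phi> x\<bar> \<le> C * (LBINT x:U. \<bar>f1 x\<bar>)"
        by (rule set_integrable_mult_bounded) (use f m C in \<open>auto simp: Wm11_rep_def\<close>)
      ultimately have "\<bar>F \<phi>\<bar> \<le> C * ((LBINT x:U. \<bar>f0 x\<bar>) + (LBINT x:U. \<bar>f1 x\<bar>))"
        unfolding distrib_left by linarith
      then show "\<bar>F \<phi>\<bar> / C \<le> (LBINT x:U. \<bar>f0 x\<bar>) + (LBINT x:U. \<bar>f1 x\<bar>)"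
        using C(1) by (simp add: divide_le_eq mult.commute)
    qed
    then show ?thesis using C(1) by (simp add: divide_le_eq mult.commute)
  qed
  then show ?thesis by blast
qed

lemma Wm11_simple_norm_measurable:
  assumes s: "Wm11_simple U T s" and s': "Wm11_simple U T s'"
  shows "(\<lambda>t. if t \<in> {0<..<T} then Wm11_norm U (\<lambda>\<phi>. s t \<phi> - s' t \<phi>) else 0) \<in> borel_measurable lborel"
    (is "?N \<in> _")
proof (rule measurableI)
  fix B :: "real set" assume B: "B \<in> sets borel"
  let ?I = "{0<..<T}"
  have fin: "finite (s ` ?I)" "finite (s' ` ?I)"
    and ms: "\<And>F. {t \<in> ?I. s t = F} \<in> sets lborel" "\<And>F. {t \<in> ?I. s' t = F} \<in> sets lborel"
    using s s' by (auto simp: Wm11_simple_def)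
  have "?N -` B = (if 0 \<in> B then - ?I else {}) \<union>
    (\<Union>F\<in>s ` ?I. \<Union>F'\<in>s' ` ?I. if Wm11_norm U (\<lambda>\<phi>. F \<phi> - F' \<phi>) \<in> B then {t \<in> ?I. s t = F} \<inter> {t \<in> ?I. s' t = F'} else {})"
    by (auto split: if_splits)
  also have "\<dots> \<in> sets lborel"
  proof (intro sets.Un sets.finite_UN fin)
    show "(if 0 \<in> B then - ?I else {}) \<in> sets lborel" by auto
    show "(if Wm11_norm U (\<lambda>\<phi>. F \<phi> - F' \<phi>) \<in> B then {t \<in> ?I. s t = F} \<inter> {t \<in> ?I. s' t = F'} else {}) \<in> sets lborel" for F F'
      using sets.Int[OF ms(1)[of F] ms(2)[of F']] by simp
  qed
  finally show "?N -` B \<inter> space lborel \<in> sets lborel" by simp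
qed simp

lemma Wm11_norm_diff_AE_measurable:
  assumes U: "open U" and G: "Lp_Wm11 p U T G" and G': "Lp_Wm11 p U T G'"
  shows "\<exists>h\<in>borel_measurable lborel. AE t in lborel. t \<in> {0<..<T} \<longrightarrow> Wm11_norm U (\<lambda>\<phi>. G t \<phi> - G' t \<phi>) = h t"
proof -
  from G obtain s where s: "\<And>j::nat. Wm11_simple U T (s j)"
    "AE t in lborel. t \<in> {0<..<T} \<longrightarrow> (\<lambda>j. Wm11_norm U (\<lambda>\<phi>. s j t \<phi> - G t \<phi>)) \<longlonglongrightarrow> 0"
    by (auto simp: Lp_Wm11_def Wm11_strongly_measurable_def)
  from G' obtain s' where s': "\<And>j::nat. Wm11_simple U T (s' j)"
    "AE t in lborel. t \<in> {0<..<T} \<longrightarrow> (\<lambda>j. Wm11_norm U (\<lambda>\<phi>. s' j t \<phi> - G' t \<phi>)) \<longlonglongrightarrow> 0"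
    by (auto simp: Lp_Wm11_def Wm11_strongly_measurable_def)
  define N where "N j t = (if t \<in> {0<..<T} then Wm11_norm U (\<lambda>\<phi>. s j t \<phi> - s' j t \<phi>) else 0)" for j t
  have [measurable]: "N j \<in> borel_measurable lborel" for j
    unfolding N_def by (rule Wm11_simple_norm_measurable[OF s(1) s'(1)])
  have GW: "AE t in lborel. t \<in> {0<..<T} \<longrightarrow> G t \<in> Wm11 U" "AE t in lborel. t \<in> {0<..<T} \<longrightarrow> G' t \<in> Wm11 U"
    using G G' by (auto simp: Lp_Wm11_def)
  have "AE t in lborel. t \<in> {0<..<T} \<longrightarrow> Wm11_norm U (\<lambda>\<phi>. G t \<phi> - G' t \<phi>) = lim (\<lambda>j. N j t)"
    using s(2) s'(2) GW
  proof (eventually_elim, intro impI)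
    fix t assume t: "t \<in> {0<..<T}"
      and 1: "t \<in> {0<..<T} \<longrightarrow> (\<lambda>j. Wm11_norm U (\<lambda>\<phi>. s j t \<phi> - G t \<phi>)) \<longlonglongrightarrow> 0"
      and 2: "t \<in> {0<..<T} \<longrightarrow> (\<lambda>j. Wm11_norm U (\<lambda>\<phi>. s' j t \<phi> - G' t \<phi>)) \<longlonglongrightarrow> 0"
      and W: "t \<in> {0<..<T} \<longrightarrow> G t \<in> Wm11 U" "t \<in> {0<..<T} \<longrightarrow> G' t \<in> Wm11 U"
    have sW: "s j t \<in> Wm11 U" "s' j t \<in> Wm11 U" for j
      using s(1)[of j] s'(1)[of j] t by (auto simp: Wm11_simple_def)
    have "(\<lambda>j. N j t - Wm11_norm U (\<lambda>\<phi>. G t \<phi> - G' t \<phi>)) \<longlonglongrightarrow> 0"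
    proof (rule Lim_null_comparison)
      show "(\<lambda>j. Wm11_norm U (\<lambda>\<phi>. s j t \<phi> - G t \<phi>) + Wm11_norm U (\<lambda>\<phi>. s' j t \<phi> - G' t \<phi>)) \<longlonglongrightarrow> 0"
        using tendsto_add[of _ 0 sequentially _ 0] 1 2 t by auto
      show "\<forall>\<^sub>F j in sequentially. norm (N j t - Wm11_norm U (\<lambda>\<phi>. G t \<phi> - G' t \<phi>)) \<le>
          Wm11_norm U (\<lambda>\<phi>. s j t \<phi> - G t \<phi>) + Wm11_norm U (\<lambda>\<phi>. s' j t \<phi> - G' t \<phi>)"
        using t W Wm11_norm_diff_diff_le[OF U sW] by (intro always_eventually allI) (simp add: N_def)
    qed
    then have "(\<lambda>j. N j t) \<longlonglongrightarrow> Wm11_norm U (\<lambda>\<phi>. G t \<phi> - G' t \<phi>)" by (simp add: LIM_zero_iff)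
    then show "Wm11_norm U (\<lambda>\<phi>. G t \<phi> - G' t \<phi>) = lim (\<lambda>j. N j t)" by (simp add: limI)
  qed
  moreover have "(\<lambda>t. lim (\<lambda>j. N j t)) \<in> borel_measurable lborel" by (rule borel_measurable_lim_metric) measurable
  ultimately show ?thesis by (intro bexI[of _ "\<lambda>t. lim (\<lambda>j. N j t)"])
qed

lemma tendsto_Lp_Wm11_AE_subseq:
  assumes U: "open U" and p: "1 \<le> p"
    and conv: "\<And>T. 0 < T \<Longrightarrow> tendsto_Lp_Wm11 p U T G G'"
  shows "\<exists>k. (\<forall>j. j \<le> k j) \<and> (AE t in lborel. 0 < t \<longrightarrow>
    (\<forall>\<phi>. test_fun U \<phi> \<longrightarrow> (\<lambda>j::nat. G (k j) t \<phi>) \<longlonglongrightarrow> G' t \<phi>))"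
proof -
  define T where "T j = real (Suc j)" for j
  have T: "0 < T j" for j by (simp add: T_def)
  define N where "N k t = Wm11_norm U (\<lambda>\<phi>. G k t \<phi> - G' t \<phi>)" for k t
  have "\<exists>k\<ge>j. (\<integral>\<^sup>+ t\<in>{0<..<T j}. ennreal (N k t powr p) \<partial>lborel) < ennreal ((1/2) ^ j)" for j
  proof -
    have "(\<lambda>k. \<integral>\<^sup>+ t\<in>{0<..<T j}. ennreal (N k t powr p) \<partial>lborel) \<longlonglongrightarrow> 0"
      using conv[OF T[of j]] by (auto simp: tendsto_Lp_Wm11_def N_def)
    then have "\<forall>\<^sub>F k in sequentially. (\<integral>\<^sup>+ t\<in>{0<..<T j}. ennreal (N k t powr p) \<partial>lborel) < ennreal ((1/2) ^ j)"
      by (rule order_tendstoD) simp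
    then obtain n where "\<And>k. n \<le> k \<Longrightarrow> (\<integral>\<^sup>+ t\<in>{0<..<T j}. ennreal (N k t powr p) \<partial>lborel) < ennreal ((1/2) ^ j)"
      unfolding eventually_sequentially by blast
    then show ?thesis by (intro exI[of _ "max j n"]) simp
  qed
  then obtain k where k: "\<And>j. j \<le> k j"
    "\<And>j. (\<integral>\<^sup>+ t\<in>{0<..<T j}. ennreal (N (k j) t powr p) \<partial>lborel) < ennreal ((1/2) ^ j)" by metis
  have L: "Lp_Wm11 p U (T j) (G i)" "Lp_Wm11 p U (T j) G'" for i j
    using conv[OF T[of j]] by (auto simp: tendsto_Lp_Wm11_def)
  have "\<exists>h\<in>borel_measurable lborel. AE t in lborel. t \<in> {0<..<T j} \<longrightarrow> N (k j) t = h t" for j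
    unfolding N_def by (rule Wm11_norm_diff_AE_measurable[OF U L])
  then obtain h where h[measurable]: "\<And>j. h j \<in> borel_measurable lborel"
    and hN: "\<And>j. AE t in lborel. t \<in> {0<..<T j} \<longrightarrow> N (k j) t = h j t" by metis
  define H where "H j t = indicator {0<..<T j} t * (h j t powr p)" for j t
  have [measurable]: "H j \<in> borel_measurable lborel" for j unfolding H_def by measurable
  have Hj: "(\<integral>\<^sup>+ t. ennreal (H j t) \<partial>lborel) \<le> ennreal ((1/2) ^ j)" for j
  proof -
    have "(\<integral>\<^sup>+ t. ennreal (H j t) \<partial>lborel) = (\<integral>\<^sup>+ t\<in>{0<..<T j}. ennreal (N (k j) t powr p) \<partial>lborel)"
      using hN[of j] by (intro nn_integral_cong_AE) (auto simp: H_def split: split_indicator elim!: eventually_mono)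
    then show ?thesis using k(2)[of j] by simp
  qed
  have "(\<integral>\<^sup>+ t. (\<Sum>j. ennreal (H j t)) \<partial>lborel) = (\<Sum>j. \<integral>\<^sup>+ t. ennreal (H j t) \<partial>lborel)"
    by (rule nn_integral_suminf) measurable
  also have "\<dots> \<le> (\<Sum>j. ennreal ((1/2) ^ j))"
    by (intro suminf_le Hj) auto
  also have "\<dots> < \<infinity>"
    by (subst suminf_ennreal2) (auto intro: summable_geometric)
  finally have "AE t in lborel. (\<Sum>j. ennreal (H j t)) \<noteq> \<infinity>"
    by (intro nn_integral_PInf_AE) auto
  moreover have "AE t in lborel. \<forall>j. t \<in> {0<..<T j} \<longrightarrow> N (k j) t = h j t"
    using hN by (simp add: AE_all_countable)
  moreover have "AE t in lborel. \<forall>j i. (t \<in> {0<..<T j} \<longrightarrow> G i t \<in> Wm11 U) \<and> (t \<in> {0<..<T j} \<longrightarrow> G' t \<in> Wm11 U)"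
    unfolding AE_all_countable using L unfolding Lp_Wm11_def by (intro allI AE_conjI) blast+
  ultimately have "AE t in lborel. 0 < t \<longrightarrow> (\<forall>\<phi>. test_fun U \<phi> \<longrightarrow> (\<lambda>j. G (k j) t \<phi>) \<longlonglongrightarrow> G' t \<phi>)"
  proof (eventually_elim, intro impI allI)
    fix t \<phi> assume fin: "(\<Sum>j. ennreal (H j t)) \<noteq> \<infinity>" and Nh: "\<forall>j. t \<in> {0<..<T j} \<longrightarrow> N (k j) t = h j t"
      and W: "\<forall>j i. (t \<in> {0<..<T j} \<longrightarrow> G i t \<in> Wm11 U) \<and> (t \<in> {0<..<T j} \<longrightarrow> G' t \<in> Wm11 U)"
      and t: "0 < t" and \<phi>: "test_fun U \<phi>"
    obtain J :: nat where J: "t < real J" using reals_Archimedean2 by blast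
    have tJ: "t \<in> {0<..<T j}" if "J \<le> j" for j using that J t by (auto simp: T_def)
    have GW: "G i t \<in> Wm11 U" "G' t \<in> Wm11 U" for i using W tJ[of J] by auto
    have "summable (\<lambda>j. H j t)"
      by (rule summable_suminf_not_top) (use fin in \<open>auto simp: H_def\<close>)
    then have "(\<lambda>j. H j t) \<longlonglongrightarrow> 0" by (rule summable_LIMSEQ_zero)
    moreover have "\<forall>\<^sub>F j in sequentially. H j t = N (k j) t powr p"
      unfolding eventually_sequentially using tJ Nh by (intro exI[of _ J]) (auto simp: H_def)
    ultimately have Np: "(\<lambda>j. N (k j) t powr p) \<longlonglongrightarrow> 0" by (rule Lim_transform_eventually)
    have Nn: "0 \<le> N i t" for i unfolding N_def by (intro Wm11_norm_nonneg Wm11_diff U GW)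
    have "(\<lambda>j. (N (k j) t powr p) powr (1/p)) \<longlonglongrightarrow> 0"
      by (rule tendsto_zero_powrI[OF Np tendsto_const]) (use p in auto)
    then have N0: "(\<lambda>j. N (k j) t) \<longlonglongrightarrow> 0" using p Nn by (simp add: powr_powr)
    obtain C where C: "\<And>F. F \<in> Wm11 U \<Longrightarrow> \<bar>F \<phi>\<bar> \<le> C * Wm11_norm U F" using Wm11_pairing_bound[OF \<phi>] by blast
    have "(\<lambda>j. G (k j) t \<phi> - G' t \<phi>) \<longlonglongrightarrow> 0"
    proof (rule Lim_null_comparison)
      show "(\<lambda>j. C * N (k j) t) \<longlonglongrightarrow> 0" using tendsto_mult_right_zero[OF N0] .
      show "\<forall>\<^sub>F j in sequentially. norm (G (k j) t \<phi> - G' t \<phi>) \<le> C * N (k j) t"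
        using C[OF Wm11_diff(1)[OF U GW]] by (intro always_eventually) (auto simp: N_def)
    qed
    then show "(\<lambda>j. G (k j) t \<phi>) \<longlonglongrightarrow> G' t \<phi>" by (simp add: LIM_zero_iff)
  qed
  with k(1) show ?thesis by blast
qed

subsection \<open>Convergence of midpoint-convex selections\<close>

text \<open>Minimising the \<open>L\<^sup>2\<close> norm over \<open>C N\<close> yields, by the parallelogram law, a Cauchy sequence.\<close>
lemma midpoint_convex_AE_convergent:
  fixes C :: "nat \<Rightarrow> ('a \<Rightarrow> real) set"
  assumes "sigma_finite_measure M"
    and ne: "\<And>n. C n \<noteq> {}" and anti: "\<And>m n. m \<le> n \<Longrightarrow> C n \<subseteq> C m"
    and meas: "\<And>n g. g \<in> C n \<Longrightarrow> g \<in> borel_measurable M"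
    and bd: "\<And>n g x. g \<in> C n \<Longrightarrow> \<bar>g x\<bar> \<le> K"
    and mid: "\<And>n g h. g \<in> C n \<Longrightarrow> h \<in> C n \<Longrightarrow> (\<lambda>x. (g x + h x) / 2) \<in> C n"
  shows "\<exists>g. (\<forall>n. g n \<in> C n) \<and> (AE x in M. convergent (\<lambda>n. g n x))"
proof -
  interpret sigma_finite_measure M by fact
  obtain w0 :: "'a \<Rightarrow> ennreal" where w0: "w0 \<in> borel_measurable M" "integral\<^sup>N M w0 \<noteq> \<infinity>"
    "\<And>x. x \<in> space M \<Longrightarrow> 0 < w0 x \<and> w0 x < \<infinity>"
    using Ex_finite_integrable_function by blast
  define w where "w x = enn2real (w0 x)" for x
  have [measurable]: "w \<in> borel_measurable M" unfolding w_def using w0(1) by measurable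
  have wpos: "0 < w x" if "x \<in> space M" for x
    using w0(3)[OF that] by (auto simp: w_def enn2real_positive_iff)
  have wn: "0 \<le> w x" for x by (simp add: w_def)
  have wi: "integrable M w"
  proof (rule integrableI_nonneg)
    have "(\<integral>\<^sup>+x. ennreal (w x) \<partial>M) = integral\<^sup>N M w0"
      by (rule nn_integral_cong) (use w0(3) in \<open>force simp: w_def\<close>)
    then show "(\<integral>\<^sup>+x. ennreal (w x) \<partial>M) < \<infinity>" using w0(2) by (simp add: less_top)
  qed (auto simp: wn)
  have K: "0 \<le> K" using ne[of 0] bd by (meson abs_ge_zero equals0I order_trans)
  define Q where "Q g = (\<integral>x. (g x)\<^sup>2 * w x \<partial>M)" for g :: "'a \<Rightarrow> real"
  have sqi: "integrable M (\<lambda>x. (g x)\<^sup>2 * w x)" if [measurable]: "g \<in> borel_measurable M" and "\<And>x. \<bar>g x\<bar> \<le> L" for g L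
  proof (rule Bochner_Integration.integrable_bound[of _ "\<lambda>x. L\<^sup>2 * w x"])
    show "AE x in M. norm ((g x)\<^sup>2 * w x) \<le> norm (L\<^sup>2 * w x)"
    proof (rule AE_I2)
      fix x
      have "(g x)\<^sup>2 \<le> L\<^sup>2" using that(2)[of x] by (simp add: abs_le_square_iff[symmetric])
      then show "norm ((g x)\<^sup>2 * w x) \<le> norm (L\<^sup>2 * w x)"
        using wn[of x] by (simp add: abs_mult mult_right_mono)
    qed
  qed (use wi in auto)
  have Qn: "0 \<le> Q g" for g unfolding Q_def by (intro integral_nonneg_AE AE_I2) (simp add: wn)
  define W where "W = (\<integral>x. w x \<partial>M)"
  have W: "0 \<le> W" unfolding W_def by (intro integral_nonneg_AE AE_I2) (simp add: wn)
  have QK: "Q g \<le> K\<^sup>2 * W" if "g \<in> C n" for g n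
  proof -
    have "Q g \<le> (\<integral>x. K\<^sup>2 * w x \<partial>M)" unfolding Q_def
      using bd[OF that] wn
      by (intro integral_mono sqi[OF meas[OF that] bd[OF that]]) (auto intro!: mult_right_mono wi simp: abs_le_square_iff[symmetric] K)
    then show ?thesis by (simp add: W_def)
  qed
  define d where "d n = Inf (Q ` C n)" for n
  have bdd: "bdd_below (Q ` C n)" for n using Qn by (intro bdd_belowI[of _ 0]) auto
  have dle: "d n \<le> Q g" if "g \<in> C n" for n g unfolding d_def using that bdd by (intro cInf_lower) auto
  have dK: "d n \<le> K\<^sup>2 * W" for n using ne[of n] dle QK by (meson equals0I order_trans)
  have bda: "bdd_above (range d)" using dK by (intro bdd_aboveI[of _ "K\<^sup>2 * W"]) auto
  define D where "D = (SUP n. d n)"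
  have dD: "d n \<le> D" for n unfolding D_def by (rule cSUP_upper[OF _ bda]) simp
  have dmono: "d m \<le> d n" if "m \<le> n" for m n
    unfolding d_def by (rule cInf_superset_mono) (use ne[of n] bdd anti[OF that] in auto)
  have "\<exists>N g. j \<le> N \<and> g \<in> C N \<and> D - (1/4) ^ j < d N \<and> Q g < D + (1/4) ^ j" for j :: nat
  proof -
    have "D - (1/4) ^ j < (SUP n. d n)" by (simp add: D_def[symmetric])
    then obtain N where N: "D - (1/4) ^ j < d N" using less_cSUP_iff[OF _ bda] by auto
    define N' where "N' = max j N"
    have "d N' < D + (1/4) ^ j" using dD[of N'] by (smt (verit) zero_less_power zero_less_divide_1_iff)
    then obtain y where "y \<in> Q ` C N'" "y < D + (1/4) ^ j"
      using cInf_less_iff[of "Q ` C N'"] ne[of N'] bdd unfolding d_def by auto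
    then show ?thesis using N dmono[of N N'] by (intro exI[of _ N']) (auto simp: N'_def)
  qed
  then obtain N G where NG: "\<And>j. j \<le> N j" "\<And>j. G j \<in> C (N j)" "\<And>j. D - (1/4) ^ j < d (N j)" "\<And>j. Q (G j) < D + (1/4) ^ j"
    by metis
  have Gm[measurable]: "G j \<in> borel_measurable M" for j using meas[OF NG(2)] .
  have Gb: "\<bar>G j x\<bar> \<le> K" for j x using bd[OF NG(2)] .
  have close: "(\<integral>x. (G i x - G j x)\<^sup>2 * w x \<partial>M) \<le> 8 * (1/4) ^ n" if ij: "n \<le> i" "n \<le> j" for i j n
  proof -
    define m where "m = min (N i) (N j)"
    have le: "(1/4) ^ i \<le> ((1/4) ^ n :: real)" "(1/4) ^ j \<le> ((1/4) ^ n :: real)"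
      using ij by (auto intro: power_decreasing)
    have dm: "D - (1/4) ^ n < d m" 
    proof -
      have "D - (1/4) ^ n < d (N i)" "D - (1/4) ^ n < d (N j)" using NG(3)[of i] NG(3)[of j] le by linarith+
      then show ?thesis by (simp add: m_def min_def)
    qed
    have "(\<lambda>x. (G i x + G j x) / 2) \<in> C m"
      using NG(2)[of i] NG(2)[of j] anti[of m "N i"] anti[of m "N j"] by (intro mid) (auto simp: m_def)
    from dle[OF this] have Qm: "D - (1/4) ^ n < Q (\<lambda>x. (G i x + G j x) / 2)" using dm by linarith
    have bm: "\<bar>(G i x + G j x) / 2\<bar> \<le> K" for x using Gb[of i x] Gb[of j x] abs_triangle_ineq[of "G i x" "G j x"] by simp
    have "(\<integral>x. (G i x - G j x)\<^sup>2 * w x \<partial>M) = (\<integral>x. 2 * ((G i x)\<^sup>2 * w x) + 2 * ((G j x)\<^sup>2 * w x) - 4 * (((G i x + G j x) / 2)\<^sup>2 * w x) \<partial>M)"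
      by (intro Bochner_Integration.integral_cong) (auto simp: power2_eq_square field_simps)
    also have "\<dots> = 2 * Q (G i) + 2 * Q (G j) - 4 * Q (\<lambda>x. (G i x + G j x) / 2)"
      unfolding Q_def using sqi[OF Gm Gb, of i] sqi[OF Gm Gb, of j] sqi[OF _ bm] by simp
    finally show ?thesis using NG(4)[of i] NG(4)[of j] le Qm by linarith
  qed
  have L1: "(\<integral>x. norm (G i x * w x - G j x * w x) \<partial>M) \<le> (1/2) ^ n * (W / 2 + 4)" if ij: "n \<le> i" "n \<le> j" for i j n
  proof -
    define l :: real where "l = (1/2) ^ n"
    have l: "0 < l" "(1/4) ^ n = l * l" by (simp_all add: l_def power_mult_distrib[symmetric])
    have b2: "\<bar>G i x - G j x\<bar> \<le> 2 * K" for x using Gb[of i x] Gb[of j x] by linarith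
    have i2: "integrable M (\<lambda>x. (G i x - G j x)\<^sup>2 * w x)" by (rule sqi[OF _ b2]) measurable
    have amgm: "\<bar>s\<bar> \<le> l / 2 + s\<^sup>2 / (2 * l)" for s :: real
    proof -
      have "0 \<le> (\<bar>s\<bar> - l)\<^sup>2" by simp
      then show ?thesis using l(1) by (simp add: power2_eq_square field_simps)
    qed
    have i1: "integrable M (\<lambda>x. G i x * w x)" for i
      by (rule Bochner_Integration.integrable_bound[of _ "\<lambda>x. K * w x"])
         (use wi Gb[of i] wn K in \<open>auto simp: abs_mult intro!: mult_right_mono AE_I2\<close>)
    have "(\<integral>x. norm (G i x * w x - G j x * w x) \<partial>M) \<le> (\<integral>x. l / 2 * w x + 1 / (2 * l) * ((G i x - G j x)\<^sup>2 * w x) \<partial>M)"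
    proof (rule integral_mono)
      show "integrable M (\<lambda>x. norm (G i x * w x - G j x * w x))" using i1[of i] i1[of j] by simp
      show "integrable M (\<lambda>x. l / 2 * w x + 1 / (2 * l) * ((G i x - G j x)\<^sup>2 * w x))" using wi i2 by simp
      fix x
      have "norm (G i x * w x - G j x * w x) = \<bar>G i x - G j x\<bar> * w x"
        using wn[of x] by (simp add: abs_mult left_diff_distrib[symmetric])
      also have "\<dots> \<le> (l / 2 + (G i x - G j x)\<^sup>2 / (2 * l)) * w x" by (intro mult_right_mono amgm wn)
      finally show "norm (G i x * w x - G j x * w x) \<le> l / 2 * w x + 1 / (2 * l) * ((G i x - G j x)\<^sup>2 * w x)"
        by (simp add: distrib_right)
    qed
    also have "\<dots> = l / 2 * W + 1 / (2 * l) * (\<integral>x. (G i x - G j x)\<^sup>2 * w x \<partial>M)"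
      using wi i2 by (simp add: W_def)
    also have "\<dots> \<le> l / 2 * W + 1 / (2 * l) * (8 * (l * l))"
      using close[OF ij] l by (intro add_left_mono mult_left_mono) auto
    also have "\<dots> = l * (W / 2 + 4)" using l(1) by (simp add: field_simps)
    finally show ?thesis unfolding l_def .
  qed
  obtain r where r: "strict_mono r" "AE x in M. Cauchy (\<lambda>i. G (r i) x * w x)"
  proof (rule cauchy_L1_AE_cauchy_subseq[of M "\<lambda>n x. G n x * w x"])
    show "integrable M (\<lambda>x. G n x * w x)" for n
      by (rule Bochner_Integration.integrable_bound[of _ "\<lambda>x. K * w x"])
         (use wi Gb[of n] wn K in \<open>auto simp: abs_mult intro!: mult_right_mono AE_I2\<close>)
    fix e :: real assume e: "0 < e"
    have "(\<lambda>n. (1/2) ^ n * (W / 2 + 4)) \<longlonglongrightarrow> 0 * (W / 2 + 4)"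
      by (intro tendsto_intros LIMSEQ_realpow_zero) auto
    then have "\<forall>\<^sub>F n in sequentially. (1/2) ^ n * (W / 2 + 4) < e"
      using e by (intro order_tendstoD) auto
    then obtain n where n: "(1/2) ^ n * (W / 2 + 4) < e" by (auto simp: eventually_sequentially)
    show "\<exists>N. \<forall>i\<ge>N. \<forall>j\<ge>N. (\<integral>x. norm (G i x * w x - G j x * w x) \<partial>M) < e"
      using L1[of n] n by (intro exI[of _ n]) (auto intro: le_less_trans)
  qed
  show ?thesis
  proof (intro exI[of _ "\<lambda>n. G (r n)"] conjI allI)
    fix n
    have "n \<le> N (r n)" using seq_suble[OF r(1), of n] NG(1)[of "r n"] by linarith
    then show "G (r n) \<in> C n" using NG(2)[of "r n"] anti[of n "N (r n)"] by auto
  next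
    show "AE x in M. convergent (\<lambda>n. G (r n) x)"
      using r(2) AE_space
    proof eventually_elim
      fix x assume "Cauchy (\<lambda>i. G (r i) x * w x)" and x: "x \<in> space M"
      then obtain L where "(\<lambda>i. G (r i) x * w x) \<longlonglongrightarrow> L"
        by (auto simp: Cauchy_convergent_iff convergent_def)
      then have "(\<lambda>i. G (r i) x * w x / w x) \<longlonglongrightarrow> L / w x" using wpos[OF x] by (intro tendsto_divide tendsto_const) auto
      then show "convergent (\<lambda>n. G (r n) x)" using wpos[OF x] by (auto simp: convergent_def)
    qed
  qed
qed

subsection \<open>Estimates for a single solution\<close>

lemma loc_integrable_measurable:
  fixes f :: "'a::euclidean_space \<Rightarrow> real"
  assumes U: "open U" and f: "loc_integrable U f"
  shows "set_borel_measurable lborel U f"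
proof -
  obtain D where D: "countable D" "D \<subseteq> Pow U" "\<And>X. X \<in> D \<Longrightarrow> \<exists>a b. X = cbox a b" "\<Union>D = U"
    using open_countable_Union_open_cbox[OF U] by metis
  define K where "K n = (\<Union>X\<in>{X\<in>D. to_nat_on D X < n}. X)" for n :: nat
  have "finite {X\<in>D. to_nat_on D X < n}" for n
    by (rule inj_on_finite[of "to_nat_on D" _ "{..<n}"])
       (use inj_on_to_nat_on[OF D(1)] in \<open>auto intro: inj_on_subset\<close>)
  then have Kc: "compact (K n)" for n
    unfolding K_def using D(3) by (intro compact_UN) (auto intro: compact_cbox)
  have KU: "K n \<subseteq> U" for n using D(4) by (auto simp: K_def)
  with Kc f have Ki: "set_integrable lborel (K n) f" for n by (auto simp: loc_integrable_def)
  have "(\<lambda>x. indicator U x *\<^sub>R f x) \<in> borel_measurable lborel"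
  proof (rule borel_measurable_LIMSEQ_real)
    show "(\<lambda>x. indicator (K n) x *\<^sub>R f x) \<in> borel_measurable lborel" for n
      using Ki[of n] unfolding set_integrable_def by (rule borel_measurable_integrable)
    fix x
    show "(\<lambda>n. indicator (K n) x *\<^sub>R f x) \<longlonglongrightarrow> indicator U x *\<^sub>R f x"
    proof (cases "x \<in> U")
      case True
      then obtain X where X: "X \<in> D" "x \<in> X" using D(4) by blast
      have "\<forall>\<^sub>F n in sequentially. indicator (K n) x *\<^sub>R f x = indicator U x *\<^sub>R f x"
        unfolding eventually_sequentially using X True
        by (intro exI[of _ "Suc (to_nat_on D X)"]) (auto simp: K_def intro!: indicator_eq_1_iff[THEN iffD2])
      then show ?thesis by (rule tendsto_eventually)
    next
      case False
      then have "x \<notin> K n" for n using KU[of n] by blast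
      then show ?thesis using False by simp
    qed
  qed
  then show ?thesis by (simp add: set_borel_measurable_def)
qed

lemma set_integrable_nn_integral_bound:
  fixes f :: "'a \<Rightarrow> real"
  assumes m: "set_borel_measurable M A f" and nn: "\<And>x. x \<in> A \<Longrightarrow> 0 \<le> f x"
    and b: "(\<integral>\<^sup>+x\<in>A. ennreal (f x) \<partial>M) \<le> ennreal c" and c: "0 \<le> c"
  shows "set_integrable M A f" "(LINT x:A|M. f x) \<le> c"
proof -
  have e: "(\<integral>\<^sup>+x. ennreal (indicator A x *\<^sub>R f x) \<partial>M) = (\<integral>\<^sup>+x\<in>A. ennreal (f x) \<partial>M)"
    by (intro nn_integral_cong) (auto split: split_indicator)
  have n: "AE x in M. 0 \<le> indicator A x *\<^sub>R f x" using nn by (auto split: split_indicator)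
  show i: "set_integrable M A f"
    unfolding set_integrable_def
    by (rule integrableI_nonneg[OF m[unfolded set_borel_measurable_def] n])
       (use b e in \<open>auto simp: less_top[symmetric] top_unique\<close>)
  have "ennreal (LINT x:A|M. f x) \<le> ennreal c"
    using nn_integral_eq_integral[OF i[unfolded set_integrable_def] n] b
    unfolding e[symmetric] set_lebesgue_integral_def by (simp only:)
  then show "(LINT x:A|M. f x) \<le> c" using c by (simp add: ennreal_le_iff)
qed

lemma bump_support: "bump \<alpha> \<beta> j x \<noteq> 0 \<Longrightarrow> \<alpha> < x \<and> x < \<beta>"
  using bump_zero[of x \<alpha> \<beta> j] by auto

lemma weak_deriv_eq_C1:
  fixes f g d :: "real \<Rightarrow> real"
  assumes wd: "weak_deriv {a<..<b} 1 f g" and dc: "continuous_on {a..b} d"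
    and fd: "\<And>x. x \<in> {a..b} \<Longrightarrow> (f has_real_derivative d x) (at x within {a..b})"
  shows "AE x in lborel. x \<in> {a<..<b} \<longrightarrow> g x = d x"
proof -
  have seg: "(LBINT x:{\<alpha><..<\<beta>}. g x - d x) = 0" and gd: "set_integrable lborel {\<alpha>..\<beta>} (\<lambda>x. g x - d x)"
    if ab: "a < \<alpha>" "\<alpha> \<le> \<beta>" "\<beta> < b" for \<alpha> \<beta>
  proof -
    have sub: "{\<alpha>..\<beta>} \<subseteq> {a..b}" "{\<alpha>..\<beta>} \<subseteq> {a<..<b}" using ab by auto
    have gi: "set_integrable lborel {\<alpha>..\<beta>} g"
      using wd sub(2) unfolding weak_deriv_def loc_integrable_def by auto
    have di: "set_integrable lborel {\<alpha>..\<beta>} d"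
      by (rule borel_integrable_atLeastAtMost'[OF continuous_on_subset[OF dc sub(1)]])
    show gd: "set_integrable lborel {\<alpha>..\<beta>} (\<lambda>x. g x - d x)" using gi di by simp
    have fc: "continuous_on {\<alpha>..\<beta>} f" by (rule continuous_on_subset[OF DERIV_continuous_on[OF fd] sub(1)])
    have bc: "continuous_on {\<alpha>..\<beta>} (bump \<alpha> \<beta> j)" "continuous_on {\<alpha>..\<beta>} (pd 1 (bump \<alpha> \<beta> j))" for j
      by (rule continuous_on_subset[OF smooth_continuous]; simp add: smooth_bump smooth_pd)+
    have z: "(LBINT x:{\<alpha>..\<beta>}. bump \<alpha> \<beta> j x * (g x - d x)) = 0" for j
    proof -
      let ?p = "bump \<alpha> \<beta> j"
      have tf: "test_fun {a<..<b} ?p"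
        by (rule test_funI[of _ "{\<alpha>..\<beta>}"]) (use sub in \<open>auto simp: smooth_bump bump_zero\<close>)
      have pz: "?p x = 0" "pd 1 ?p x = 0" if "x \<notin> {\<alpha>..\<beta>}" for x
      proof -
        have "closure {p. ?p p \<noteq> 0} \<subseteq> {\<alpha>..\<beta>}"
          by (rule closure_minimal) (auto dest: bump_support)
        then have "x \<notin> closure {p. ?p p \<noteq> 0}" using that by blast
        then show "?p x = 0" "pd 1 ?p x = 0" using test_fun_zero_outside[OF tf, of x] by auto
      qed
      have "(LBINT x:{a<..<b}. f x * pd 1 ?p x) = - (LBINT x:{a<..<b}. g x * ?p x)"
        using wd tf unfolding weak_deriv_def by blast
      moreover have "(LBINT x:{a<..<b}. f x * pd 1 ?p x) = (LBINT x:{\<alpha>..\<beta>}. f x * pd 1 ?p x)"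
        unfolding set_lebesgue_integral_def
        by (intro Bochner_Integration.integral_cong) (use pz sub in \<open>auto split: split_indicator\<close>)
      moreover have "(LBINT x:{a<..<b}. g x * ?p x) = (LBINT x:{\<alpha>..\<beta>}. ?p x * g x)"
        unfolding set_lebesgue_integral_def
        by (intro Bochner_Integration.integral_cong) (use pz sub in \<open>auto split: split_indicator\<close>)
      moreover have "(LBINT x:{\<alpha>..\<beta>}. f x * pd 1 ?p x) + (LBINT x:{\<alpha>..\<beta>}. ?p x * d x) = 0"
      proof -
        have i1: "set_integrable lborel {\<alpha>..\<beta>} (\<lambda>x. f x * pd 1 ?p x)"
          by (rule borel_integrable_atLeastAtMost') (intro continuous_intros fc bc)
        have i2: "set_integrable lborel {\<alpha>..\<beta>} (\<lambda>x. ?p x * d x)" by (rule set_integrable_continuous_mult[OF di bc(1)])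
        have "((\<lambda>x. f x * pd 1 ?p x + ?p x * d x) has_integral f \<beta> * ?p \<beta> - f \<alpha> * ?p \<alpha>) {\<alpha>..\<beta>}"
        proof (rule fundamental_theorem_of_calculus[OF ab(2)])
          fix x assume x: "x \<in> {\<alpha>..\<beta>}"
          have "(f has_real_derivative d x) (at x within {\<alpha>..\<beta>})"
            by (rule DERIV_subset[OF fd sub(1)]) (use x sub in auto)
          from DERIV_mult[OF this DERIV_subset[OF smooth_has_real_derivative[OF smooth_bump]]]
          show "((\<lambda>x. f x * ?p x) has_vector_derivative f x * pd 1 ?p x + ?p x * d x) (at x within {\<alpha>..\<beta>})"
            by (simp add: has_real_derivative_iff_has_vector_derivative[symmetric] algebra_simps)
        qed
        then have "integral {\<alpha>..\<beta>} (\<lambda>x. f x * pd 1 ?p x + ?p x * d x) = 0"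
          by (simp add: integral_unique bump_zero)
        moreover have "(LBINT x:{\<alpha>..\<beta>}. f x * pd 1 ?p x + ?p x * d x) = integral {\<alpha>..\<beta>} (\<lambda>x. f x * pd 1 ?p x + ?p x * d x)"
          by (rule set_borel_integral_eq_integral(2)[OF set_integral_add(1)[OF i1 i2]])
        ultimately show ?thesis using i1 i2 by simp
      qed
      ultimately show ?thesis
        using set_integrable_continuous_mult[OF gi bc(1)] set_integrable_continuous_mult[OF di bc(1)]
        by (simp add: right_diff_distrib)
    qed
    have "(\<lambda>j. LBINT x:{\<alpha>..\<beta>}. bump \<alpha> \<beta> j x * (g x - d x)) \<longlonglongrightarrow> (LBINT x:{\<alpha><..<\<beta>}. g x - d x)"
      unfolding set_lebesgue_integral_def
    proof (rule integral_dominated_convergence[where w="\<lambda>x. \<bar>indicator {\<alpha>..\<beta>} x *\<^sub>R (g x - d x)\<bar>"])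
      show "integrable lborel (\<lambda>x. \<bar>indicator {\<alpha>..\<beta>} x *\<^sub>R (g x - d x)\<bar>)"
        using gd unfolding set_integrable_def by (rule integrable_abs)
      show "(\<lambda>x. indicator {\<alpha>..\<beta>} x *\<^sub>R (bump \<alpha> \<beta> j x * (g x - d x))) \<in> borel_measurable lborel" for j
        using set_integrable_continuous_mult[OF gd bc(1)] unfolding set_integrable_def by (rule borel_measurable_integrable)
      show "(\<lambda>x. indicator {\<alpha><..<\<beta>} x *\<^sub>R (g x - d x)) \<in> borel_measurable lborel"
      proof -
        have "set_integrable lborel {\<alpha><..<\<beta>} (\<lambda>x. g x - d x)" by (rule set_integrable_subset[OF gd]) auto
        then show ?thesis unfolding set_integrable_def by (rule borel_measurable_integrable)
      qed
      show "AE x in lborel. norm (indicator {\<alpha>..\<beta>} x *\<^sub>R (bump \<alpha> \<beta> j x * (g x - d x))) \<le> \<bar>indicator {\<alpha>..\<beta>} x *\<^sub>R (g x - d x)\<bar>" for j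
        by (intro AE_I2) (auto simp: abs_mult bump_nonneg bump_le_1 mult_left_le_one_le split: split_indicator)
      show "AE x in lborel. (\<lambda>j. indicator {\<alpha>..\<beta>} x *\<^sub>R (bump \<alpha> \<beta> j x * (g x - d x))) \<longlonglongrightarrow> indicator {\<alpha><..<\<beta>} x *\<^sub>R (g x - d x)"
      proof (rule AE_I2)
        fix x
        have "(\<lambda>j. indicator {\<alpha>..\<beta>} x *\<^sub>R (bump \<alpha> \<beta> j x * (g x - d x))) \<longlonglongrightarrow> indicator {\<alpha>..\<beta>} x *\<^sub>R (indicator {\<alpha><..<\<beta>} x * (g x - d x))"
          by (intro tendsto_intros bump_tendsto)
        moreover have "indicator {\<alpha>..\<beta>} x *\<^sub>R (indicator {\<alpha><..<\<beta>} x * (g x - d x)) = indicator {\<alpha><..<\<beta>} x *\<^sub>R (g x - d x)"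
          by (auto split: split_indicator)
        ultimately show "(\<lambda>j. indicator {\<alpha>..\<beta>} x *\<^sub>R (bump \<alpha> \<beta> j x * (g x - d x))) \<longlonglongrightarrow> indicator {\<alpha><..<\<beta>} x *\<^sub>R (g x - d x)"
          by metis
      qed
    qed
    then show "(LBINT x:{\<alpha><..<\<beta>}. g x - d x) = 0" unfolding z by (simp add: LIMSEQ_const_iff)
  qed
  have "AE x in lborel. \<forall>k::nat. x \<in> {a + 1 / Suc k<..<b - 1 / Suc k} \<longrightarrow> g x - d x = 0"
    unfolding AE_all_countable
  proof
    fix k :: nat
    show "AE x in lborel. x \<in> {a + 1 / Suc k<..<b - 1 / Suc k} \<longrightarrow> g x - d x = 0"
    proof (cases "a + 1 / Suc k \<le> b - 1 / Suc k")
      case True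
      have pos: "0 < 1 / real (Suc k)" by simp
      show ?thesis
      proof (rule AE_eq_0_if_interval_integrals_0)
        show "set_integrable lborel {a + 1 / Suc k<..<b - 1 / Suc k} (\<lambda>x. g x - d x)"
          by (rule set_integrable_subset[OF gd[of "a + 1 / Suc k" "b - 1 / Suc k"]]) (use True pos in auto)
        show "(LBINT x:{\<alpha><..<\<beta>}. g x - d x) = 0" if "a + 1 / Suc k \<le> \<alpha>" "\<alpha> < \<beta>" "\<beta> \<le> b - 1 / Suc k" for \<alpha> \<beta>
          by (rule seg) (use that pos in linarith)+
      qed
    qed auto
  qed
  then show ?thesis
  proof eventually_elim
    case (elim x)
    show ?case
    proof
      assume x: "x \<in> {a<..<b}"
      obtain k where "inverse (real (Suc k)) < min (x - a) (b - x)" using reals_Archimedean[of "min (x - a) (b - x)"] x by auto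
      then have "x \<in> {a + 1 / Suc k<..<b - 1 / Suc k}" by (simp add: inverse_eq_divide)
      with elim show "g x = d x" by force
    qed
  qed
qed

lemma dissipation_pointwise_bound:
  fixes q L \<delta> :: real
  assumes q: "0 < q" "q \<le> 2" "q ^ 4 * L = 1" and v: "0 < v" and C: "\<bar>f0\<bar> \<le> C" "\<bar>f1\<bar> \<le> C" "\<bar>f2\<bar> \<le> C"
    and \<delta>: "\<delta> = q\<^sup>2" and r: "r\<^sup>2 \<le> R\<^sup>2 * mob" and mob: "v ^ 3 \<le> mob" and R: "0 \<le> R"
  shows "- v1 * (v * v3) * f0 - (- r * v3) * f1
    \<ge> (- f0 * trunc \<delta> v * v1 * v3 - 5/3 * f1 * trunc \<delta> v * v1 * v2 - 1/3 * trunc \<delta> v * f2 * v1\<^sup>2)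
      - C * (3 + R) * q * (v1\<^sup>2 + v * v2\<^sup>2 + 1 + L * mob * v3\<^sup>2)"
proof -
  have \<delta>p: "0 < \<delta>" using q \<delta> by simp
  have C0: "0 \<le> C" using C(1) by linarith
  have L: "L = 1 / q ^ 4" using q by (simp add: field_simps)
  have Lp: "0 < L" using q by (simp add: L)
  have mobp: "0 < mob" using v mob by (meson less_le_trans zero_less_power)
  note tb = trunc_bounds[OF \<delta>p less_imp_le[OF v]]
  define s where "s = sqrt v"
  have s: "0 < s" "v = s\<^sup>2" using v by (auto simp: s_def)
  have tq: "trunc \<delta> v \<le> q * s"
  proof (rule power2_le_imp_le)
    have "(trunc \<delta> v)\<^sup>2 \<le> \<delta> * v" unfolding power2_eq_square using tb v by (intro mult_mono) auto
    then show "(trunc \<delta> v)\<^sup>2 \<le> (q * s)\<^sup>2" by (simp add: \<delta> s power_mult_distrib)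
  qed (use q s in simp)
  define E where "E = v1\<^sup>2 + v * v2\<^sup>2 + 1 + L * mob * v3\<^sup>2"
  have e1: "0 \<le> v1\<^sup>2" "0 \<le> v * v2\<^sup>2" "0 \<le> L * mob * v3\<^sup>2" using v Lp mobp by auto
  have A: "\<bar>f1 * trunc \<delta> v * v1 * v2\<bar> \<le> C * q * (v1\<^sup>2 + v * v2\<^sup>2) / 2"
  proof -
    have "2 * (s * (\<bar>v1\<bar> * \<bar>v2\<bar>)) \<le> v1\<^sup>2 + v * v2\<^sup>2"
      using zero_le_power2[of "\<bar>v1\<bar> - s * \<bar>v2\<bar>"] by (simp add: power2_eq_square s(2) algebra_simps)
    moreover have "\<bar>f1\<bar> * trunc \<delta> v * (\<bar>v1\<bar> * \<bar>v2\<bar>) \<le> C * (q * s) * (\<bar>v1\<bar> * \<bar>v2\<bar>)"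
      using tb tq C C0 by (intro mult_right_mono mult_mono) auto
    moreover have "\<bar>f1 * trunc \<delta> v * v1 * v2\<bar> = \<bar>f1\<bar> * trunc \<delta> v * (\<bar>v1\<bar> * \<bar>v2\<bar>)"
      using tb by (simp add: abs_mult)
    moreover have "C * q * (2 * (s * (\<bar>v1\<bar> * \<bar>v2\<bar>))) \<le> C * q * (v1\<^sup>2 + v * v2\<^sup>2)"
      using calculation(1) C0 q by (intro mult_left_mono) auto
    moreover have "C * q * (2 * (s * (\<bar>v1\<bar> * \<bar>v2\<bar>))) = 2 * (C * (q * s) * (\<bar>v1\<bar> * \<bar>v2\<bar>))" by simp
    ultimately show ?thesis by linarith
  qed
  have B: "\<bar>trunc \<delta> v * f2 * v1\<^sup>2\<bar> \<le> 2 * (C * q * v1\<^sup>2)"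
  proof -
    have "trunc \<delta> v \<le> q * q" using tb(3) by (simp add: \<delta> power2_eq_square)
    moreover have "q * q \<le> 2 * q" using q by (intro mult_right_mono) auto
    ultimately have "trunc \<delta> v \<le> 2 * q" by linarith
    then have "trunc \<delta> v * \<bar>f2\<bar> * v1\<^sup>2 \<le> (2 * q) * C * v1\<^sup>2"
      using tb C q by (intro mult_right_mono mult_mono) auto
    then show ?thesis using tb by (simp add: abs_mult mult_ac)
  qed
  have D: "\<bar>f0 * (v - trunc \<delta> v) * v1 * v3\<bar> \<le> C * q * (v1\<^sup>2 + L * mob * v3\<^sup>2) / 2"
  proof -
    have vm: "v - trunc \<delta> v = v\<^sup>2 / (v + \<delta>)" using v \<delta>p by (simp add: trunc_def field_simps power2_eq_square)
    have "2 * (q * s) \<le> v + \<delta>" using zero_le_power2[of "q - s"] by (simp add: \<delta> s power2_eq_square algebra_simps)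
    then have qs: "q * s \<le> v + \<delta>" using q s by (smt (verit) mult_pos_pos)
    have "v\<^sup>2 / (v + \<delta>) \<le> v\<^sup>2 / (q * s)" using qs q s \<delta>p by (intro divide_left_mono mult_pos_pos) (auto intro!: add_pos_pos)
    also have "\<dots> = s ^ 3 / q" using s q by (simp add: field_simps power2_eq_square power3_eq_cube)
    finally have vms: "v - trunc \<delta> v \<le> s ^ 3 / q" by (simp add: vm)
    have ag: "2 * (s ^ 3 / q * (\<bar>v1\<bar> * \<bar>v3\<bar>)) \<le> q * (v1\<^sup>2 + L * mob * v3\<^sup>2)"
    proof -
      have "0 \<le> (q * \<bar>v1\<bar> - s ^ 3 / q * \<bar>v3\<bar>)\<^sup>2 / q" using q by simp
      also have "\<dots> = q * v1\<^sup>2 + q * (L * s ^ 6 * v3\<^sup>2) - 2 * (s ^ 3 / q * (\<bar>v1\<bar> * \<bar>v3\<bar>))"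
        using q(1) by (simp add: L field_simps power2_eq_square power3_eq_cube eval_nat_numeral)
      also have "s ^ 6 = v ^ 3" by (simp add: s(2) power_mult[symmetric])
      finally have "2 * (s ^ 3 / q * (\<bar>v1\<bar> * \<bar>v3\<bar>)) \<le> q * v1\<^sup>2 + q * (L * v ^ 3 * v3\<^sup>2)" by simp
      moreover have "q * (L * v ^ 3 * v3\<^sup>2) \<le> q * (L * mob * v3\<^sup>2)"
        using q Lp mob by (intro mult_left_mono mult_right_mono) auto
      ultimately show ?thesis unfolding distrib_left by linarith
    qed
    have d1: "\<bar>f0\<bar> * (v - trunc \<delta> v) * (\<bar>v1\<bar> * \<bar>v3\<bar>) \<le> C * (s ^ 3 / q) * (\<bar>v1\<bar> * \<bar>v3\<bar>)"
      using tb vms C C0 by (intro mult_right_mono mult_mono) auto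
    have d2: "2 * (C * (s ^ 3 / q) * (\<bar>v1\<bar> * \<bar>v3\<bar>)) \<le> C * q * (v1\<^sup>2 + L * mob * v3\<^sup>2)"
    proof -
      have "C * (2 * (s ^ 3 / q * (\<bar>v1\<bar> * \<bar>v3\<bar>))) \<le> C * (q * (v1\<^sup>2 + L * mob * v3\<^sup>2))"
        using ag C0 by (rule mult_left_mono)
      then show ?thesis by (simp only: mult_ac)
    qed
    have d3: "\<bar>f0 * (v - trunc \<delta> v) * v1 * v3\<bar> = \<bar>f0\<bar> * (v - trunc \<delta> v) * (\<bar>v1\<bar> * \<bar>v3\<bar>)"
      using tb by (simp add: abs_mult)
    have aux: "x \<le> y / 2" if "x \<le> z" "2 * z \<le> y" for x y z :: real using that by simp
    show ?thesis unfolding d3 by (rule aux[OF d1 d2])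
  qed
  have G: "\<bar>r * v3 * f1\<bar> \<le> C * R * (q * (1 + L * mob * v3\<^sup>2))"
  proof -
    have rb: "\<bar>r\<bar> \<le> R * sqrt mob"
    proof (rule power2_le_imp_le)
      have "(R * sqrt mob)\<^sup>2 = R\<^sup>2 * mob" using mobp by (simp add: power_mult_distrib)
      then show "\<bar>r\<bar>\<^sup>2 \<le> (R * sqrt mob)\<^sup>2" using r by simp
      show "0 \<le> R * sqrt mob" using R mobp by simp
    qed
    have ag: "sqrt mob * \<bar>v3\<bar> \<le> q * (1 + L * mob * v3\<^sup>2)"
    proof -
      define y where "y = sqrt mob * \<bar>v3\<bar>"
      have y2: "y\<^sup>2 = mob * v3\<^sup>2" using mobp by (simp add: y_def power_mult_distrib)
      have y0: "0 \<le> y" using mobp by (simp add: y_def)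
      have "0 \<le> (q\<^sup>2 - y)\<^sup>2 / q ^ 3" using q by simp
      also have "\<dots> = q * (1 + L * y\<^sup>2) - 2 * (y / q)"
        using q(1) by (simp add: L field_simps power2_eq_square power3_eq_cube eval_nat_numeral)
      finally have "2 * (y / q) \<le> q * (1 + L * y\<^sup>2)" by simp
      moreover have "y \<le> 2 * (y / q)" using q y0 mult_right_mono[OF q(2) y0] by (simp add: field_simps)
      ultimately have "y \<le> q * (1 + L * y\<^sup>2)" by linarith
      then have "y \<le> q * (1 + L * (mob * v3\<^sup>2))" by (simp only: y2)
      then show ?thesis by (simp only: y_def mult.assoc)
    qed
    have "\<bar>r\<bar> * \<bar>v3\<bar> * \<bar>f1\<bar> \<le> (R * sqrt mob) * \<bar>v3\<bar> * C"
      using rb C R mobp by (intro mult_mono) auto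
    also have "\<dots> = C * R * (sqrt mob * \<bar>v3\<bar>)" by simp
    also have "\<dots> \<le> C * R * (q * (1 + L * mob * v3\<^sup>2))" using ag C0 R by (intro mult_left_mono) auto
    finally show ?thesis by (simp add: abs_mult)
  qed
  define X where "X = C * q"
  have X: "0 \<le> X" using C0 q by (simp add: X_def)
  define a1 a2 a3 where "a1 = X * v1\<^sup>2" and "a2 = X * (v * v2\<^sup>2)" and "a3 = X * (L * mob * v3\<^sup>2)"
  have a: "0 \<le> a1" "0 \<le> a2" "0 \<le> a3" using X e1 by (simp_all add: a1_def a2_def a3_def)
  have A': "\<bar>f1 * trunc \<delta> v * v1 * v2\<bar> \<le> (a1 + a2) / 2" using A by (simp add: a1_def a2_def X_def distrib_left)
  have B': "\<bar>trunc \<delta> v * f2 * v1\<^sup>2\<bar> \<le> 2 * a1" using B by (simp add: a1_def X_def)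
  have D': "\<bar>f0 * (v - trunc \<delta> v) * v1 * v3\<bar> \<le> (a1 + a3) / 2" using D by (simp add: a1_def a3_def X_def distrib_left)
  have G': "\<bar>r * v3 * f1\<bar> \<le> R * (X + a3)" using G by (simp add: a3_def X_def distrib_left mult_ac)
  have "C * (3 + R) * q * E = (3 + R) * (a1 + a2 + X + a3)"
    by (simp add: E_def a1_def a2_def a3_def X_def algebra_simps)
  also have "\<dots> = 3 * (a1 + a2 + X + a3) + R * (a1 + a2) + R * (X + a3)" by (simp add: algebra_simps)
  finally have E: "3 * (a1 + a2 + X + a3) + R * (X + a3) \<le> C * (3 + R) * q * E" using a R by simp
  have split: "- v1 * (v * v3) * f0 = - f0 * trunc \<delta> v * v1 * v3 - f0 * (v - trunc \<delta> v) * v1 * v3"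
    by (simp add: algebra_simps)
  have aux: "p0 - 5/3 * p1 - 1/3 * p2 - Z \<le> p0 - p3 + p4"
    if "\<bar>p1\<bar> \<le> (a1 + a2) / 2" "\<bar>p2\<bar> \<le> 2 * a1" "\<bar>p3\<bar> \<le> (a1 + a3) / 2" "\<bar>p4\<bar> \<le> G"
      "3 * (a1 + a2 + X + a3) + G \<le> Z" for p0 p1 p2 p3 p4 G Z :: real
    using that a X by (simp add: abs_le_iff field_simps) linarith
  have "- f0 * trunc \<delta> v * v1 * v3 - 5/3 * (f1 * trunc \<delta> v * v1 * v2) - 1/3 * (trunc \<delta> v * f2 * v1\<^sup>2) - C * (3 + R) * q * E
    \<le> - f0 * trunc \<delta> v * v1 * v3 - f0 * (v - trunc \<delta> v) * v1 * v3 + r * v3 * f1"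
    by (rule aux[OF A' B' D' G' E])
  then show ?thesis unfolding split E_def by (simp add: mult.assoc)
qed

lemma Bfun_scaled_le:
  assumes n: "0 < n" "n < 3" and e: "0 < \<epsilon>" "\<epsilon> \<le> 1/2" and s: "s \<le> M" and M: "1 \<le> M"
  shows "Beps n \<epsilon> s \<le> 1 + (Bfun n 1 + ln M) / \<bar>ln \<epsilon>\<bar>"
proof -
  have L: "0 < \<bar>ln \<epsilon>\<bar>" "\<bar>ln \<epsilon>\<bar> = - ln \<epsilon>" using e by auto
  have M1: "1 \<le> M / \<epsilon>" using M e by (simp add: le_divide_eq)
  have "Bfun n (s / \<epsilon>) \<le> Bfun n (M / \<epsilon>)"
    using Bfun_mono[OF n] s e by (auto simp: mono_def divide_right_mono)
  also have "\<dots> \<le> Bfun n 1 + ln (M / \<epsilon>)" by (rule Bfun_le_ln[OF n M1])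
  also have "ln (M / \<epsilon>) = ln M + \<bar>ln \<epsilon>\<bar>" using M e L by (simp add: ln_div)
  finally show ?thesis using L(1) by (simp add: Beps_def field_simps)
qed

lemma Beps_nonneg: "0 \<le> Beps n \<epsilon> s"
  by (simp add: Beps_def Bfun_nonneg)

lemma abs_ln_ge: "0 < (\<epsilon>::real) \<Longrightarrow> \<epsilon> \<le> 1/2 \<Longrightarrow> 1/2 \<le> \<bar>ln \<epsilon>\<bar>"
proof -
  assume e: "0 < \<epsilon>" "\<epsilon> \<le> 1/2"
  then have "ln \<epsilon> \<le> ln (1/2)" using e by simp
  also have "\<dots> = - ln 2" by (simp add: ln_div)
  finally show ?thesis using ln2_ge_two_thirds by linarith
qed

locale thin_film =
  fixes a b n \<epsilon> E0 :: real and u ux uxx uxxx :: "real \<times> real \<Rightarrow> real"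
  assumes ab: "a < b" and n: "0 < n" "n < 3" and eps: "0 < \<epsilon>" "\<epsilon> \<le> 1/2" and E0: "0 \<le> E0"
    and cont: "continuous_on ({0..} \<times> {a..b}) u"
    and nn: "\<And>p. p \<in> {0..} \<times> {a..b} \<Longrightarrow> 0 \<le> u p"
    and uxm: "set_borel_measurable lborel ({0<..} \<times> {a<..<b}) ux"
    and h1: "\<And>t. 0 < t \<Longrightarrow> H1 {a<..<b} (\<lambda>x. u (t, x)) (\<lambda>x. ux (t, x))"
    and wd: "weak_deriv (positivity_set a b u) (0, 1) ux uxx" "weak_deriv (positivity_set a b u) (0, 1) uxx uxxx"
    and u3: "\<And>T. 0 < T \<Longrightarrow> Lp 2 (positivity_set a b u \<inter> {0<..<T} \<times> {a<..<b}) (\<lambda>p. u p * uxxx p)"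
    and mass: "\<And>t. 0 < t \<Longrightarrow> (LBINT x:{a<..<b}. u (t, x)) = 1"
    and energy: "\<And>t. 0 < t \<Longrightarrow> (\<integral>\<^sup>+ x\<in>{a<..<b}. ennreal ((ux (t, x))\<^sup>2 / 2) \<partial>lborel)
          + (\<integral>\<^sup>+ p\<in>positivity_set a b u \<inter> {0<..<t} \<times> {a<..<b}. ennreal (\<bar>ln \<epsilon>\<bar> * mobility n \<epsilon> (u p) * (uxxx p)\<^sup>2) \<partial>lborel)
         \<le> ennreal (E0 / 2)"
    and entropy: "\<And>t. 0 < t \<Longrightarrow> (\<integral>\<^sup>+ p\<in>positivity_set a b u \<inter> {0<..<t} \<times> {a<..<b}. ennreal (u p * (uxx p)\<^sup>2) \<partial>lborel)
       \<le> (\<integral>\<^sup>+ x\<in>{a<..<b}. ennreal (rho_eps n \<epsilon> u (t, x)) \<partial>lborel)"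
    and C1: "AE t in lborel. 0 < t \<longrightarrow>
         (\<exists>d. continuous_on {a..b} d \<and>
           (\<forall>x\<in>{a..b}. ((\<lambda>y. u (t, y)) has_real_derivative d x) (at x within {a..b})))"
    and rho_eq: "\<And>\<phi>. test_fun ({0<..} \<times> {a<..<b}) \<phi> \<Longrightarrow>
         - (LBINT p:{0<..} \<times> {a<..<b}. rho_eps n \<epsilon> u p * pd (1, 0) \<phi> p)
         = (LBINT p:{0<..} \<times> {a<..<b}. Teps a b u ux uxxx p * \<phi> p)
           - (LBINT p:{0<..} \<times> {a<..<b}. Reps a b n \<epsilon> u uxxx p * pd (0, 1) \<phi> p)"
begin

abbreviation "\<Omega> \<equiv> {a<..<b}"
abbreviation Q :: "(real \<times> real) set" where "Q \<equiv> {0<..} \<times> {a<..<b}"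
abbreviation "P \<equiv> positivity_set a b u"
abbreviation "S T \<equiv> P \<inter> {0<..<T} \<times> {a<..<b}"
abbreviation "L \<equiv> \<bar>ln \<epsilon>\<bar>"
abbreviation "mob p \<equiv> mobility n \<epsilon> (u p)"

lemma P_eq: "P = Q \<inter> u -` {0<..}"
  by (auto simp: positivity_set_def)

lemma contQ: "continuous_on Q u"
  by (rule continuous_on_subset[OF cont]) auto

lemma open_Q: "open Q" by (intro open_Times) auto

lemma open_P: "open P"
  unfolding P_eq by (rule continuous_open_preimage[OF contQ open_Q]) auto

lemma PQ: "P \<subseteq> Q" by (auto simp: P_eq)

lemma sets_PQ [measurable]: "P \<in> sets borel" "Q \<in> sets borel"
  using open_P open_Q by auto

lemma sets_S [measurable]: "S T \<in> sets borel"
  using open_P by (intro sets.Int) (auto intro!: borel_open open_Times)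

lemma Lpos: "1/2 \<le> L" using abs_ln_ge[OF eps] .

definition "gu p = indicator Q p * u p"
definition "gux p = indicator Q p * ux p"
definition "guxx p = indicator P p * uxx p"
definition "guxxx p = indicator P p * uxxx p"
definition "gtail p = indicator {0<..} (gu p / \<epsilon>) * tail n (gu p / \<epsilon>)"

lemma g_measurable [measurable]:
  "gu \<in> borel_measurable borel" "gux \<in> borel_measurable borel" "guxx \<in> borel_measurable borel" "guxxx \<in> borel_measurable borel"
  "gtail \<in> borel_measurable borel"
proof -
  show gu: "gu \<in> borel_measurable borel"
    using borel_measurable_continuous_on_indicator[OF _ contQ] open_Q by (simp add: gu_def[abs_def])
  show "gux \<in> borel_measurable borel"
    using uxm by (simp add: gux_def[abs_def] set_borel_measurable_def)
  show "guxx \<in> borel_measurable borel"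
    using loc_integrable_measurable[OF open_P, of uxx] wd by (simp add: guxx_def[abs_def] set_borel_measurable_def weak_deriv_def)
  show "guxxx \<in> borel_measurable borel"
    using loc_integrable_measurable[OF open_P, of uxxx] wd by (simp add: guxxx_def[abs_def] set_borel_measurable_def weak_deriv_def)
  have "(\<lambda>x. indicator {0<..} x * tail n x) \<in> borel_measurable borel"
    using tail_measurable_pos[of n] by (simp add: set_borel_measurable_def)
  moreover have "(\<lambda>p. gu p / \<epsilon>) \<in> borel_measurable borel" using gu by measurable
  ultimately show "gtail \<in> borel_measurable borel"
    unfolding gtail_def[abs_def] by (rule measurable_compose[rotated])
qed

lemma on_S: "p \<in> S T \<Longrightarrow> gu p = u p" "p \<in> S T \<Longrightarrow> gux p = ux p" "p \<in> S T \<Longrightarrow> guxx p = uxx p"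
  "p \<in> S T \<Longrightarrow> guxxx p = uxxx p" "p \<in> S T \<Longrightarrow> 0 < u p"
  "p \<in> S T \<Longrightarrow> tail n (u p / \<epsilon>) = gtail p"
  using PQ eps by (auto simp: gu_def gux_def guxx_def guxxx_def P_eq gtail_def)

lemma sets_Times [measurable]: "{0<..<T::real} \<times> \<Omega> \<in> sets borel"
  by (intro borel_open open_Times) auto

lemma set_measurable_S:
  fixes f g :: "real \<times> real \<Rightarrow> real"
  assumes "g \<in> borel_measurable borel" "\<And>p. p \<in> S T \<Longrightarrow> f p = g p"
  shows "set_borel_measurable lborel (S T) f"
proof -
  have "(\<lambda>p. indicator (S T) p *\<^sub>R f p) = (\<lambda>p. indicator (S T) p * g p)"
    using assms(2) by (auto split: split_indicator)
  then show ?thesis using assms(1) unfolding set_borel_measurable_def by simp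
qed

lemma ux_sq:
  assumes "0 < t"
  shows "set_integrable lborel \<Omega> (\<lambda>x. (ux (t, x))\<^sup>2)" "(LBINT x:\<Omega>. (ux (t, x))\<^sup>2) \<le> E0"
    "(\<integral>\<^sup>+ x\<in>\<Omega>. ennreal ((ux (t, x))\<^sup>2) \<partial>lborel) \<le> ennreal E0"
proof -
  have m: "set_borel_measurable lborel \<Omega> (\<lambda>x. ux (t, x))"
    using h1[OF assms] by (simp add: H1_def Lp_def)
  have "(\<lambda>x. indicator \<Omega> x *\<^sub>R (ux (t, x))\<^sup>2) = (\<lambda>x. (indicator \<Omega> x *\<^sub>R ux (t, x))\<^sup>2)"
    by (auto split: split_indicator)
  then have m2: "set_borel_measurable lborel \<Omega> (\<lambda>x. (ux (t, x))\<^sup>2)"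
    using m unfolding set_borel_measurable_def by simp
  have m3: "set_borel_measurable lborel \<Omega> (\<lambda>x. (ux (t, x))\<^sup>2 / 2)"
    using borel_measurable_times[OF borel_measurable_const[of "1/2"] m2[unfolded set_borel_measurable_def]]
    by (simp add: set_borel_measurable_def)
  have "(\<integral>\<^sup>+ x\<in>\<Omega>. ennreal ((ux (t, x))\<^sup>2 / 2) \<partial>lborel) \<le> ennreal (E0 / 2)"
    by (rule order_trans[OF add_increasing2[OF zero_le order_refl] energy[OF assms]])
  from set_integrable_nn_integral_bound[OF m3 _ this] E0
  have i: "set_integrable lborel \<Omega> (\<lambda>x. (ux (t, x))\<^sup>2 / 2)" and le: "(LBINT x:\<Omega>. (ux (t, x))\<^sup>2 / 2) \<le> E0 / 2"
    by auto
  show i2: "set_integrable lborel \<Omega> (\<lambda>x. (ux (t, x))\<^sup>2)" using set_integrable_mult_right[OF i, of 2] by simp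
  show le2: "(LBINT x:\<Omega>. (ux (t, x))\<^sup>2) \<le> E0" using le by simp
  have "(\<integral>\<^sup>+ x\<in>\<Omega>. ennreal ((ux (t, x))\<^sup>2) \<partial>lborel) = (\<integral>\<^sup>+ x. ennreal (indicator \<Omega> x *\<^sub>R (ux (t, x))\<^sup>2) \<partial>lborel)"
    by (intro nn_integral_cong) (auto split: split_indicator)
  also have "\<dots> = ennreal (LBINT x:\<Omega>. (ux (t, x))\<^sup>2)"
    unfolding set_lebesgue_integral_def
    by (rule nn_integral_eq_integral[OF i2[unfolded set_integrable_def]]) auto
  finally show "(\<integral>\<^sup>+ x\<in>\<Omega>. ennreal ((ux (t, x))\<^sup>2) \<partial>lborel) \<le> ennreal E0" using le2 by (simp add: ennreal_leI)
qed

lemma S_ux_sq: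
  assumes "0 < T"
  shows "set_integrable lborel (S T) (\<lambda>p. (ux p)\<^sup>2)" "(LBINT p:S T. (ux p)\<^sup>2) \<le> T * E0"
proof -
  have "(\<integral>\<^sup>+ p\<in>S T. ennreal ((ux p)\<^sup>2) \<partial>lborel) \<le> (\<integral>\<^sup>+ p. ennreal ((gux p)\<^sup>2) * indicator ({0<..<T} \<times> \<Omega>) p \<partial>lborel)"
    by (intro nn_integral_mono) (auto simp: gux_def split: split_indicator)
  also have "\<dots> = (\<integral>\<^sup>+ p. ennreal ((gux p)\<^sup>2) * indicator ({0<..<T} \<times> \<Omega>) p \<partial>(lborel \<Otimes>\<^sub>M lborel))"
    by (simp add: lborel_prod)
  also have "\<dots> = (\<integral>\<^sup>+ t. \<integral>\<^sup>+ x. ennreal ((gux (t, x))\<^sup>2) * indicator ({0<..<T} \<times> \<Omega>) (t, x) \<partial>lborel \<partial>lborel)"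
    by (subst lborel.nn_integral_fst[symmetric]) (auto simp: lborel_prod intro!: borel_open open_Times)
  also have "\<dots> \<le> (\<integral>\<^sup>+ t. ennreal E0 * indicator {0<..<T} t \<partial>lborel)"
  proof (intro nn_integral_mono)
    fix t
    show "(\<integral>\<^sup>+ x. ennreal ((gux (t, x))\<^sup>2) * indicator ({0<..<T} \<times> \<Omega>) (t, x) \<partial>lborel) \<le> ennreal E0 * indicator {0<..<T} t"
    proof (cases "t \<in> {0<..<T}")
      case True
      then have "(\<integral>\<^sup>+ x. ennreal ((gux (t, x))\<^sup>2) * indicator ({0<..<T} \<times> \<Omega>) (t, x) \<partial>lborel) = (\<integral>\<^sup>+ x\<in>\<Omega>. ennreal ((ux (t, x))\<^sup>2) \<partial>lborel)"
        by (intro nn_integral_cong) (auto simp: gux_def split: split_indicator)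
      then show ?thesis using ux_sq(3)[of t] True by simp
    next
      case False
      then have "(\<integral>\<^sup>+ x. ennreal ((gux (t, x))\<^sup>2) * indicator ({0<..<T} \<times> \<Omega>) (t, x) \<partial>lborel) = (\<integral>\<^sup>+ (x::real). 0 \<partial>lborel)"
        by (intro nn_integral_cong) (auto split: split_indicator)
      then show ?thesis by simp
    qed
  qed
  also have "\<dots> = ennreal (T * E0)"
    using assms E0 by (subst nn_integral_cmult_indicator) (auto simp: ennreal_mult'[symmetric] mult.commute)
  finally have b: "(\<integral>\<^sup>+ p\<in>S T. ennreal ((ux p)\<^sup>2) \<partial>lborel) \<le> ennreal (T * E0)" .
  have m: "set_borel_measurable lborel (S T) (\<lambda>p. (ux p)\<^sup>2)"
    by (rule set_measurable_S[of "\<lambda>p. (gux p)\<^sup>2"]) (auto simp: on_S)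
  show "set_integrable lborel (S T) (\<lambda>p. (ux p)\<^sup>2)" "(LBINT p:S T. (ux p)\<^sup>2) \<le> T * E0"
    using set_integrable_nn_integral_bound[OF m _ b] assms E0 by auto
qed

definition "M = max 1 (1 / (b - a) + ((b - a) + E0) / 2)"

lemma u_le_M:
  assumes t: "0 < t" and x: "x \<in> {a..b}" shows "u (t, x) \<le> M"
proof -
  have "AE t in lborel. 0 < t \<longrightarrow> (\<forall>y\<in>{a..b}. u (t, y) \<le> M)"
    using C1
  proof (eventually_elim, intro impI)
    fix t assume "0 < t \<longrightarrow> (\<exists>d. continuous_on {a..b} d \<and>
           (\<forall>x\<in>{a..b}. ((\<lambda>y. u (t, y)) has_real_derivative d x) (at x within {a..b})))" and t: "0 < t"
    then obtain d where dc: "continuous_on {a..b} d"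
      and ud: "\<And>x. x \<in> {a..b} \<Longrightarrow> ((\<lambda>y. u (t, y)) has_real_derivative d x) (at x within {a..b})" by blast
    have wdt: "weak_deriv \<Omega> 1 (\<lambda>x. u (t, x)) (\<lambda>x. ux (t, x))" using h1[OF t] by (simp add: H1_def)
    have ae: "AE x in lborel. x \<in> \<Omega> \<longrightarrow> ux (t, x) = d x" by (rule weak_deriv_eq_C1[OF wdt dc ud])
    have d2c: "continuous_on {a..b} (\<lambda>x. (d x)\<^sup>2)" by (intro continuous_intros dc)
    have d2i: "set_integrable lborel {a..b} (\<lambda>x. (d x)\<^sup>2)" by (rule borel_integrable_atLeastAtMost'[OF d2c])
    have "(LBINT x:{a..b}. (d x)\<^sup>2) = (LBINT x:\<Omega>. (ux (t, x))\<^sup>2)"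
    proof -
      have "AE x in lborel. indicator {a..b} x *\<^sub>R (d x)\<^sup>2 = indicator \<Omega> x *\<^sub>R (ux (t, x))\<^sup>2"
        using ae AE_lborel_singleton[of a] AE_lborel_singleton[of b]
        by eventually_elim (auto split: split_indicator)
      then show ?thesis unfolding set_lebesgue_integral_def
        using borel_measurable_integrable[OF d2i[unfolded set_integrable_def]]
          borel_measurable_integrable[OF ux_sq(1)[OF t, unfolded set_integrable_def]]
        by (intro integral_cong_AE)
    qed
    then have d2: "(LBINT x:{a..b}. (d x)\<^sup>2) \<le> E0" using ux_sq(2)[OF t] by simp
    define h where "h = ((b - a) + E0) / 2"
    have i1: "set_integrable lborel {a..b} (\<lambda>x. 1::real)" by (rule borel_integrable_atLeastAtMost') simp
    have hi: "(LBINT s:{a..b}. (1 + (d s)\<^sup>2) / 2) \<le> h"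
      using d2 d2i i1 ab by (simp add: h_def set_integral_const)
    have osc: "u (t, z) - u (t, y) \<le> h" if yz: "y \<in> {a..b}" "z \<in> {a..b}" for y z
    proof -
      define lo hi where "lo = min y z" and "hi = max y z"
      have lh: "lo \<le> hi" "{lo..hi} \<subseteq> {a..b}" using yz by (auto simp: lo_def hi_def)
      have "((\<lambda>s. d s) has_integral u (t, hi) - u (t, lo)) {lo..hi}"
        by (rule fundamental_theorem_of_calculus[OF lh(1)])
           (use lh(2) in \<open>auto simp: has_real_derivative_iff_has_vector_derivative[symmetric] intro!: DERIV_subset[OF ud lh(2)]\<close>)
      moreover have di: "set_integrable lborel {lo..hi} d"
        by (rule borel_integrable_atLeastAtMost'[OF continuous_on_subset[OF dc lh(2)]])
      ultimately have eq: "(LBINT s:{lo..hi}. d s) = u (t, hi) - u (t, lo)"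
        using set_borel_integral_eq_integral(2)[OF di] by (simp add: integral_unique)
      have g2: "set_integrable lborel {a..b} (\<lambda>s. (1 + (d s)\<^sup>2) / 2)" using d2i i1 by simp
      have "\<bar>LBINT s:{lo..hi}. d s\<bar> \<le> (LBINT s:{lo..hi}. \<bar>d s\<bar>)"
        using integral_norm_bound[of lborel "\<lambda>x. indicator {lo..hi} x *\<^sub>R d x"] by (simp add: set_lebesgue_integral_def abs_mult)
      also have "\<dots> \<le> (LBINT s:{lo..hi}. (1 + (d s)\<^sup>2) / 2)"
      proof (rule set_integral_mono[OF set_integrable_abs[OF di] set_integrable_subset[OF g2 _ lh(2)]])
        show "\<bar>d s\<bar> \<le> (1 + (d s)\<^sup>2) / 2" for s
          using zero_le_power2[of "\<bar>d s\<bar> - 1"] by (simp add: power2_eq_square algebra_simps)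
      qed simp
      also have "\<dots> \<le> (LBINT s:{a..b}. (1 + (d s)\<^sup>2) / 2)"
        using g2 set_integrable_subset[OF g2 _ lh(2)] lh(2) unfolding set_integrable_def set_lebesgue_integral_def
        by (intro integral_mono) (auto split: split_indicator)
      finally have "\<bar>u (t, hi) - u (t, lo)\<bar> \<le> h" using hi unfolding eq by simp
      then show ?thesis by (auto simp: lo_def hi_def min_def max_def split: if_splits)
    qed
    show "\<forall>y\<in>{a..b}. u (t, y) \<le> M"
    proof
      fix z assume z: "z \<in> {a..b}"
      have uc: "continuous_on {a..b} (\<lambda>y. u (t, y))" by (rule DERIV_continuous_on[OF ud])
      have ui: "set_integrable lborel \<Omega> (\<lambda>y. u (t, y))"
        by (rule set_integrable_subset[OF borel_integrable_atLeastAtMost'[OF uc]]) auto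
      have hc: "set_integrable lborel \<Omega> (\<lambda>y. u (t, z) - h)"
        by (rule set_integrable_subset[OF borel_integrable_atLeastAtMost'[of a b]]) auto
      have "(LBINT y:\<Omega>. u (t, z) - h) \<le> (LBINT y:\<Omega>. u (t, y))"
      proof (rule set_integral_mono[OF hc ui])
        show "u (t, z) - h \<le> u (t, y)" if "y \<in> \<Omega>" for y using osc[of y z] z that by auto
      qed
      then have "(b - a) * (u (t, z) - h) \<le> 1" using mass[OF t] ab by (simp add: set_integral_const)
      then have "u (t, z) - h \<le> 1 / (b - a)" using ab by (simp add: le_divide_eq mult.commute)
      then show "u (t, z) \<le> M" by (simp add: M_def h_def le_max_iff_disj)
    qed
  qed
  then have ae: "AE s\<in>{0<..} in lebesgue. s \<in> {s \<in> {0..}. u (s, x) \<le> M}"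
    using x by (intro AE_completion) (auto elim!: eventually_mono)
  have "closed {s \<in> {0..}. u (s, x) \<le> M}"
  proof -
    have "continuous_on {0..} (\<lambda>s. u (s, x))"
      by (rule continuous_on_compose2[OF cont]) (use x in \<open>auto intro!: continuous_intros\<close>)
    then have "closed ({0..} \<inter> (\<lambda>s. u (s, x)) -` {..M})" by (intro continuous_closed_preimage) auto
    also have "{0..} \<inter> (\<lambda>s. u (s, x)) -` {..M} = {s \<in> {0..}. u (s, x) \<le> M}" by auto
    finally show ?thesis .
  qed
  from mem_closed_if_AE_lebesgue_open[OF _ this ae, of t] t show ?thesis by auto
qed

definition "Rmax = 1 + (Bfun n 1 + ln M) / L"

lemma M_ge: "1 \<le> M" by (simp add: M_def)

lemma rho_bounds: "0 < t \<Longrightarrow> x \<in> {a..b} \<Longrightarrow> 0 \<le> rho_eps n \<epsilon> u (t, x) \<and> rho_eps n \<epsilon> u (t, x) \<le> Rmax"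
  unfolding rho_eps_def Rmax_def by (intro conjI Beps_nonneg Bfun_scaled_le n eps u_le_M M_ge)

lemma Rmax_le: "1 \<le> Rmax" "Rmax \<le> 1 + 2 * (Bfun n 1 + ln M)"
proof -
  have 0: "0 \<le> Bfun n 1 + ln M" using M_ge Bfun_nonneg by simp
  then show "1 \<le> Rmax" by (simp add: Rmax_def)
  have "(Bfun n 1 + ln M) / L \<le> (Bfun n 1 + ln M) / (1/2)" using 0 Lpos by (intro divide_left_mono) auto
  then show "Rmax \<le> 1 + 2 * (Bfun n 1 + ln M)" by (simp add: Rmax_def)
qed

lemma S_uxx_sq:
  assumes "0 < T"
  shows "set_integrable lborel (S T) (\<lambda>p. u p * (uxx p)\<^sup>2)" "(LBINT p:S T. u p * (uxx p)\<^sup>2) \<le> (b - a) * Rmax"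
proof -
  have "(\<integral>\<^sup>+ x\<in>\<Omega>. ennreal (rho_eps n \<epsilon> u (T, x)) \<partial>lborel) \<le> (\<integral>\<^sup>+ x. ennreal Rmax * indicator \<Omega> x \<partial>lborel)"
    using rho_bounds[OF assms] by (intro nn_integral_mono) (auto split: split_indicator intro!: ennreal_leI)
  also have "\<dots> = ennreal ((b - a) * Rmax)"
    using ab Rmax_le(1) by (subst nn_integral_cmult_indicator) (auto simp: ennreal_mult'[symmetric] mult.commute)
  finally have b: "(\<integral>\<^sup>+ p\<in>S T. ennreal (u p * (uxx p)\<^sup>2) \<partial>lborel) \<le> ennreal ((b - a) * Rmax)"
    using entropy[OF assms] by (rule order_trans[rotated])
  have m: "set_borel_measurable lborel (S T) (\<lambda>p. u p * (uxx p)\<^sup>2)"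
    by (rule set_measurable_S[of "\<lambda>p. gu p * (guxx p)\<^sup>2"]) (auto simp: on_S)
  have nn': "0 \<le> u p * (uxx p)\<^sup>2" if "p \<in> S T" for p using on_S(5)[OF that] by simp
  show "set_integrable lborel (S T) (\<lambda>p. u p * (uxx p)\<^sup>2)" "(LBINT p:S T. u p * (uxx p)\<^sup>2) \<le> (b - a) * Rmax"
    using set_integrable_nn_integral_bound[OF m nn' b] ab Rmax_le(1) by auto
qed

lemma mob_nonneg: "p \<in> S T \<Longrightarrow> (u p) ^ 3 \<le> mob p" "p \<in> S T \<Longrightarrow> 0 < mob p"
  using on_S(5)[of p T] by (auto simp: mobility_def intro!: add_nonneg_pos)

lemma S_uxxx_sq:
  assumes "0 < T"
  shows "set_integrable lborel (S T) (\<lambda>p. L * mob p * (uxxx p)\<^sup>2)" "(LBINT p:S T. L * mob p * (uxxx p)\<^sup>2) \<le> E0 / 2"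
proof -
  have b: "(\<integral>\<^sup>+ p\<in>S T. ennreal (L * mob p * (uxxx p)\<^sup>2) \<partial>lborel) \<le> ennreal (E0 / 2)"
    by (rule order_trans[OF add_increasing[OF zero_le order_refl] energy[OF assms]])
  have m: "set_borel_measurable lborel (S T) (\<lambda>p. L * mob p * (uxxx p)\<^sup>2)"
    by (rule set_measurable_S[of "\<lambda>p. L * (\<epsilon> powr (3 - n) * gu p powr n + gu p ^ 3) * (guxxx p)\<^sup>2"])
       (auto simp: on_S mobility_def)
  have nn': "0 \<le> L * mob p * (uxxx p)\<^sup>2" if "p \<in> S T" for p using mob_nonneg(2)[OF that] by simp
  show "set_integrable lborel (S T) (\<lambda>p. L * mob p * (uxxx p)\<^sup>2)" "(LBINT p:S T. L * mob p * (uxxx p)\<^sup>2) \<le> E0 / 2"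
    using set_integrable_nn_integral_bound[OF m nn' b] E0 by auto
qed

lemma S_uuxxx_sq: "0 < T \<Longrightarrow> set_integrable lborel (S T) (\<lambda>p. (u p * uxxx p)\<^sup>2)"
  using u3[of T] by (simp add: Lp_def)

lemma S_measure:
  assumes "0 < T"
  shows "set_integrable lborel (S T) (\<lambda>p. 1::real)" "(LBINT p:S T. 1::real) \<le> T * (b - a)"
proof -
  have "(\<integral>\<^sup>+ p\<in>S T. ennreal 1 \<partial>lborel) \<le> (\<integral>\<^sup>+ p. indicator ({0<..<T} \<times> \<Omega>) p \<partial>lborel)"
    by (intro nn_integral_mono) (auto split: split_indicator)
  also have "\<dots> = emeasure (lborel \<Otimes>\<^sub>M lborel) ({0<..<T} \<times> \<Omega>)"
    by (subst nn_integral_indicator) (auto simp: lborel_prod intro!: borel_open open_Times)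
  also have "\<dots> = emeasure lborel {0<..<T} * emeasure lborel \<Omega>"
    by (rule lborel.emeasure_pair_measure_Times) auto
  also have "\<dots> = ennreal (T * (b - a))" using assms ab by (simp add: ennreal_mult')
  finally have b: "(\<integral>\<^sup>+ p\<in>S T. ennreal 1 \<partial>lborel) \<le> ennreal (T * (b - a))" .
  have m: "set_borel_measurable lborel (S T) (\<lambda>p. 1::real)"
    by (rule set_measurable_S[of "\<lambda>p. 1"]) auto
  show "set_integrable lborel (S T) (\<lambda>p. 1::real)" "(LBINT p:S T. 1::real) \<le> T * (b - a)"
    using set_integrable_nn_integral_bound[OF m _ b] assms ab by auto
qed

end

lemma compact_in_open_interval:
  fixes K :: "real set"
  assumes "compact K" "K \<subseteq> {a<..<b}" "a < b"
  obtains a' b' where "a < a'" "b' < b" "K \<subseteq> {a'..b'}"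
proof (cases "K = {}")
  case True
  then show thesis using that[of "(a+b)/2" "(a+b)/2"] assms by auto
next
  case False
  obtain x where x: "x \<in> K" "\<And>y. y \<in> K \<Longrightarrow> x \<le> y" using compact_attains_inf[OF assms(1) False] by blast
  obtain z where z: "z \<in> K" "\<And>y. y \<in> K \<Longrightarrow> y \<le> z" using compact_attains_sup[OF assms(1) False] by blast
  show thesis by (rule that[of x z]) (use x z assms(2) in auto)
qed

lemma smooth_slice_derivative:
  fixes \<phi> :: "real \<times> real \<Rightarrow> real"
  assumes "smooth \<phi>"
  shows "((\<lambda>x. \<phi> (t, x)) has_real_derivative pd (0, 1) \<phi> (t, x)) (at x)"
proof -
  have "((\<lambda>x. (t, x)) has_derivative (\<lambda>h. (0, h))) (at x)"
    by (auto intro!: derivative_eq_intros)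
  from has_derivative_compose[OF this smooth_has_derivative[OF assms]]
  have *: "((\<lambda>x. \<phi> (t, x)) has_derivative (\<lambda>h. pd (0, h) \<phi> (t, x))) (at x)" .
  have lin: "linear (\<lambda>v. pd v \<phi> (t, x))"
    by (rule has_derivative_linear[OF smooth_has_derivative[OF assms]])
  have "pd (0, h) \<phi> (t, x) = pd (0, 1) \<phi> (t, x) * h" for h
  proof -
    have "pd (h *\<^sub>R (0, 1)) \<phi> (t, x) = h *\<^sub>R pd (0, 1) \<phi> (t, x)" by (rule linear_scale[OF lin])
    moreover have "h *\<^sub>R (0, 1) = (0 :: real, h)" by simp
    ultimately show ?thesis by (simp only: real_scaleR_def mult.commute)
  qed
  then have "(\<lambda>h. pd (0, h) \<phi> (t, x)) = (*) (pd (0, 1) \<phi> (t, x))" by (rule ext)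
  with * show ?thesis unfolding has_field_derivative_def by (simp only:)
qed

lemma abs_mult_le_sum_squares: "\<bar>y\<bar> * \<bar>z\<bar> \<le> y\<^sup>2 + (z\<^sup>2 :: real)"
proof -
  have "2 * \<bar>y\<bar> * \<bar>z\<bar> \<le> y\<^sup>2 + z\<^sup>2" using sum_squares_bound[of "\<bar>y\<bar>" "\<bar>z\<bar>"] by simp
  moreover have "0 \<le> \<bar>y\<bar> * \<bar>z\<bar>" by simp
  ultimately show ?thesis by linarith
qed

context thin_film
begin

context
  fixes \<phi> :: "real \<times> real \<Rightarrow> real" and C T :: real
  assumes \<phi>: "test_fun Q \<phi>" and \<phi>0: "\<And>p. 0 \<le> \<phi> p" and T: "0 < T"
    and \<phi>T: "\<And>p. T \<le> fst p \<Longrightarrow> \<phi> p = 0 \<and> pd (0,1) \<phi> p = 0"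
    and C: "\<And>p. \<bar>\<phi> p\<bar> \<le> C" "\<And>p. \<bar>pd (0,1) \<phi> p\<bar> \<le> C" "\<And>p. \<bar>pd (0,1) (pd (0,1) \<phi>) p\<bar> \<le> C"
begin

abbreviation "\<phi>x \<equiv> pd (0,1) \<phi>"
abbreviation "\<phi>xx \<equiv> pd (0,1) (pd (0,1) \<phi>)"

lemma smooths: "smooth \<phi>" "smooth \<phi>x" "smooth \<phi>xx"
proof -
  show 1: "smooth \<phi>" using \<phi> by (simp add: test_fun_def)
  have B: "(0, 1) \<in> (Basis :: (real \<times> real) set)" by (simp add: Basis_prod_def)
  show 2: "smooth \<phi>x" by (rule smooth_pd[OF 1 B])
  show "smooth \<phi>xx" by (rule smooth_pd[OF 2 B])
qed

lemma smooths_measurable [measurable]: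
  "\<phi> \<in> borel_measurable borel" "\<phi>x \<in> borel_measurable borel" "\<phi>xx \<in> borel_measurable borel"
  using smooths by (auto intro: smooth_measurable)

lemma C0: "0 \<le> C" using C(1)[of 0] by linarith

definition "integ \<delta> p = - \<phi> p * trunc \<delta> (u p) * ux p * uxxx p - 5/3 * \<phi>x p * trunc \<delta> (u p) * ux p * uxx p
  - 1/3 * trunc \<delta> (u p) * \<phi>xx p * (ux p)\<^sup>2"

lemma integ_integrable:
  assumes \<delta>: "0 < \<delta>"
  shows "set_integrable lborel (S T) (integ \<delta>)"
proof (rule set_integrable_bound)
  show "set_integrable lborel (S T) (\<lambda>p. C * ((ux p)\<^sup>2 + (u p * uxxx p)\<^sup>2) + 5/3 * C * ((ux p)\<^sup>2 + \<delta> * (u p * (uxx p)\<^sup>2)) + C * \<delta> * (ux p)\<^sup>2)"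
    using S_ux_sq(1)[OF T] S_uuxxx_sq[OF T] S_uxx_sq(1)[OF T] by (intro set_integral_add set_integrable_mult_right)
  show "set_borel_measurable lborel (S T) (integ \<delta>)"
    by (rule set_measurable_S[of "\<lambda>p. - \<phi> p * (\<delta> * gu p / (gu p + \<delta>)) * gux p * guxxx p - 5/3 * \<phi>x p * (\<delta> * gu p / (gu p + \<delta>)) * gux p * guxx p
  - 1/3 * (\<delta> * gu p / (gu p + \<delta>)) * \<phi>xx p * (gux p)\<^sup>2"]) (auto simp: on_S integ_def trunc_def)
  show "AE p in lborel. p \<in> S T \<longrightarrow> norm (integ \<delta> p) \<le> norm (C * ((ux p)\<^sup>2 + (u p * uxxx p)\<^sup>2) + 5/3 * C * ((ux p)\<^sup>2 + \<delta> * (u p * (uxx p)\<^sup>2)) + C * \<delta> * (ux p)\<^sup>2)"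
  proof (intro AE_I2 impI)
    fix p assume p: "p \<in> S T"
    have up: "0 \<le> u p" using on_S(5)[OF p] by simp
    define m where "m = trunc \<delta> (u p)"
    have m: "0 \<le> m" "m \<le> u p" "m \<le> \<delta>" using trunc_bounds[OF \<delta> up] by (auto simp: m_def)
    note ag = abs_mult_le_sum_squares
    have 1: "\<bar>\<phi> p * m * ux p * uxxx p\<bar> \<le> C * ((ux p)\<^sup>2 + (u p * uxxx p)\<^sup>2)"
    proof -
      have "\<bar>\<phi> p * m * ux p * uxxx p\<bar> = \<bar>\<phi> p\<bar> * (\<bar>ux p\<bar> * (m * \<bar>uxxx p\<bar>))" using m by (simp add: abs_mult mult_ac)
      also have "\<dots> \<le> C * (\<bar>ux p\<bar> * \<bar>u p * uxxx p\<bar>)"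
        using m C(1)[of p] up C0 by (intro mult_mono) (auto simp: abs_mult intro!: mult_right_mono)
      also have "\<dots> \<le> C * ((ux p)\<^sup>2 + (u p * uxxx p)\<^sup>2)" using C0 by (intro mult_left_mono ag)
      finally show ?thesis .
    qed
    have 2: "\<bar>\<phi>x p * m * ux p * uxx p\<bar> \<le> C * ((ux p)\<^sup>2 + \<delta> * (u p * (uxx p)\<^sup>2))"
    proof -
      have "\<bar>\<phi>x p * m * ux p * uxx p\<bar> = \<bar>\<phi>x p\<bar> * (\<bar>ux p\<bar> * \<bar>m * uxx p\<bar>)" by (simp add: abs_mult mult_ac)
      also have "\<dots> \<le> C * ((ux p)\<^sup>2 + (m * uxx p)\<^sup>2)" using C(2)[of p] C0 by (intro mult_mono ag) auto
      also have "\<dots> \<le> C * ((ux p)\<^sup>2 + \<delta> * (u p * (uxx p)\<^sup>2))"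
      proof -
        have "m * m \<le> \<delta> * u p" using m up \<delta> by (intro mult_mono) auto
        then have "(m * uxx p)\<^sup>2 \<le> \<delta> * u p * (uxx p)\<^sup>2"
          by (simp add: power_mult_distrib mult_right_mono power2_eq_square[of m])
        then show ?thesis using C0 by (intro mult_left_mono add_left_mono) (auto simp: mult.assoc)
      qed
      finally show ?thesis .
    qed
    have 3: "\<bar>m * \<phi>xx p * (ux p)\<^sup>2\<bar> \<le> C * \<delta> * (ux p)\<^sup>2"
    proof -
      have "m * \<bar>\<phi>xx p\<bar> \<le> \<delta> * C" using m C(3)[of p] \<delta> by (intro mult_mono) auto
      from mult_right_mono[OF this, of "(ux p)\<^sup>2"] show ?thesis using m by (simp add: abs_mult mult_ac)
    qed
    have pos: "0 \<le> C * \<delta> * (ux p)\<^sup>2" "0 \<le> C * ((ux p)\<^sup>2 + (u p * uxxx p)\<^sup>2)" "0 \<le> C * ((ux p)\<^sup>2 + \<delta> * (u p * (uxx p)\<^sup>2))"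
      using C0 \<delta> up by auto
    have tri: "\<bar>- x1 - 5/3 * x2 - 1/3 * x3\<bar> \<le> y1 + 5/3 * y2 + y3"
      if "\<bar>x1\<bar> \<le> y1" "\<bar>x2\<bar> \<le> y2" "\<bar>x3\<bar> \<le> y3" for x1 x2 x3 y1 y2 y3 :: real using that by linarith
    have "integ \<delta> p = - (\<phi> p * m * ux p * uxxx p) - 5/3 * (\<phi>x p * m * ux p * uxx p) - 1/3 * (m * \<phi>xx p * (ux p)\<^sup>2)"
      by (simp add: integ_def m_def)
    then have "\<bar>integ \<delta> p\<bar> \<le> C * ((ux p)\<^sup>2 + (u p * uxxx p)\<^sup>2) + 5/3 * (C * ((ux p)\<^sup>2 + \<delta> * (u p * (uxx p)\<^sup>2))) + C * \<delta> * (ux p)\<^sup>2"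
      using tri[OF 1 2 3] by simp
    then show "norm (integ \<delta> p) \<le> norm (C * ((ux p)\<^sup>2 + (u p * uxxx p)\<^sup>2) + 5/3 * C * ((ux p)\<^sup>2 + \<delta> * (u p * (uxx p)\<^sup>2)) + C * \<delta> * (ux p)\<^sup>2)"
      using pos by (simp add: mult.assoc)
  qed
qed

lemma integ_slice_nonneg:
  assumes t: "0 < t" "t < T" and \<delta>: "0 < \<delta>"
    and dc: "continuous_on {a..b} d"
    and ud: "\<And>x. x \<in> {a..b} \<Longrightarrow> ((\<lambda>y. u (t, y)) has_real_derivative d x) (at x within {a..b})"
    and ae1: "AE x in lborel. x \<in> \<Omega> \<longrightarrow> ux (t, x) = d x"
    and dw: "\<And>x. (t, x) \<in> P \<Longrightarrow> (d has_real_derivative w x) (at x)"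
    and wc: "continuous_on {x. (t, x) \<in> P} w"
    and ae2: "AE x in lborel. (t, x) \<in> P \<longrightarrow> uxx (t, x) = w x"
    and wz: "\<And>x y. x \<le> y \<Longrightarrow> {x..y} \<subseteq> {x. (t, x) \<in> P} \<Longrightarrow>
          set_integrable lborel {x..y} (\<lambda>s. uxxx (t, s)) \<and> w y - w x = (LBINT s:{x..y}. uxxx (t, s))"
    and i: "integrable lborel (\<lambda>x. indicator (S T) (t, x) * integ \<delta> (t, x))"
  shows "0 \<le> (\<integral>x. indicator (S T) (t, x) * integ \<delta> (t, x) \<partial>lborel)"
proof -
  have Pt: "{x. (t, x) \<in> P} = {x \<in> \<Omega>. 0 < u (t, x)}" using t by (auto simp: positivity_set_def)
  define K where "K = snd ` closure {p. \<phi> p \<noteq> 0}"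
  have "compact K" unfolding K_def
    using \<phi> by (intro compact_continuous_image continuous_intros) (simp add: test_fun_def)
  moreover have "K \<subseteq> \<Omega>" unfolding K_def using \<phi> by (auto simp: test_fun_def)
  ultimately obtain a' b' where ab': "a < a'" "b' < b" "K \<subseteq> {a'..b'}"
    using compact_in_open_interval[OF _ _ ab] by metis
  interpret sl: slice a b \<delta> a' b' "\<lambda>x. u (t, x)" d w "\<lambda>x. uxxx (t, x)" "\<lambda>x. \<phi> (t, x)" "\<lambda>x. \<phi>x (t, x)" "\<lambda>x. \<phi>xx (t, x)"
  proof
    show "0 \<le> u (t, x)" if "x \<in> {a..b}" for x using nn[of "(t, x)"] t that by simp
    show "(d has_real_derivative w x) (at x)" if "x \<in> \<Omega>" "0 < u (t, x)" for x
      using dw[of x] that t by (auto simp: positivity_set_def)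
    show "continuous_on {x \<in> \<Omega>. 0 < u (t, x)} w" using wc by (simp add: Pt)
    show "set_integrable lborel {x..y} (\<lambda>x. uxxx (t, x)) \<and> w y - w x = (LBINT s:{x..y}. uxxx (t, s))"
      if "x \<le> y" "{x..y} \<subseteq> {x \<in> \<Omega>. 0 < u (t, x)}" for x y using wz[of x y] that by (simp add: Pt)
    show "((\<lambda>x. \<phi> (t, x)) has_real_derivative \<phi>x (t, x)) (at x)" for x by (rule smooth_slice_derivative[OF smooths(1)])
    show "((\<lambda>x. \<phi>x (t, x)) has_real_derivative \<phi>xx (t, x)) (at x)" for x by (rule smooth_slice_derivative[OF smooths(2)])
    show "continuous_on UNIV (\<lambda>x. \<phi>xx (t, x))"
      by (rule continuous_on_compose2[OF smooth_continuous[OF smooths(3)]]) (auto intro!: continuous_intros)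
    show "\<phi> (t, x) = 0 \<and> \<phi>x (t, x) = 0" if x: "x \<notin> {a'..b'}" for x
    proof -
      have "(t, x) \<notin> closure {p. \<phi> p \<noteq> 0}" using x ab'(3) by (force simp: K_def)
      then show ?thesis using test_fun_zero_outside[OF \<phi>] by blast
    qed
  qed (use ab \<delta> dc ud \<phi>0 ab' in auto)
  let ?Pos = "{x \<in> \<Omega>. 0 < u (t, x)}"
  have oP: "open ?Pos" by (rule sl.open_Pos)
  have St: "indicator (S T) (t, x) = (indicator ?Pos x :: real)" for x
    using t by (auto simp: positivity_set_def split: split_indicator)
  define D W Z V where "D x = indicator \<Omega> x * d x" and "W x = indicator ?Pos x * w x"
    and "Z x = guxxx (t, x)" and "V x = gu (t, x)" for x
  have [measurable]: "D \<in> borel_measurable borel" "W \<in> borel_measurable borel" "Z \<in> borel_measurable borel" "V \<in> borel_measurable borel"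
  proof -
    have "continuous_on \<Omega> d" by (rule continuous_on_subset[OF dc]) auto
    then show "D \<in> borel_measurable borel" unfolding D_def[abs_def]
      using borel_measurable_continuous_on_indicator[of \<Omega> d] by simp
    have "continuous_on ?Pos w" using wc unfolding Pt .
    from borel_measurable_continuous_on_indicator[OF borel_open[OF oP] this]
    show "W \<in> borel_measurable borel" unfolding W_def[abs_def] real_scaleR_def .
    have m: "(\<lambda>x. (t, x)) \<in> borel \<rightarrow>\<^sub>M (borel :: (real \<times> real) measure)"
      by (intro borel_measurable_continuous_onI continuous_intros)
    show "Z \<in> borel_measurable borel" "V \<in> borel_measurable borel"
      unfolding Z_def[abs_def] V_def[abs_def] by (rule measurable_compose[OF m g_measurable(4)] measurable_compose[OF m g_measurable(1)])+
  qed
  have [measurable]: "(\<lambda>x. \<phi> (t, x)) \<in> borel_measurable borel" "(\<lambda>x. \<phi>x (t, x)) \<in> borel_measurable borel" "(\<lambda>x. \<phi>xx (t, x)) \<in> borel_measurable borel"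
  proof -
    have m: "(\<lambda>x. (t, x)) \<in> borel \<rightarrow>\<^sub>M (borel :: (real \<times> real) measure)"
      by (intro borel_measurable_continuous_onI continuous_intros)
    show "(\<lambda>x. \<phi> (t, x)) \<in> borel_measurable borel" "(\<lambda>x. \<phi>x (t, x)) \<in> borel_measurable borel"
      "(\<lambda>x. \<phi>xx (t, x)) \<in> borel_measurable borel"
      by (rule measurable_compose[OF m smooths_measurable(1)] measurable_compose[OF m smooths_measurable(2)]
          measurable_compose[OF m smooths_measurable(3)])+
  qed
  have [measurable]: "?Pos \<in> sets borel" using oP by simp
  have eqm: "(\<lambda>x. indicator ?Pos x *\<^sub>R sl.integrand x) = (\<lambda>x. indicator ?Pos x *
     (- \<phi> (t, x) * (\<delta> * V x / (V x + \<delta>)) * D x * Z x - 5/3 * \<phi>x (t, x) * (\<delta> * V x / (V x + \<delta>)) * D x * W x - 1/3 * (\<delta> * V x / (V x + \<delta>)) * \<phi>xx (t, x) * (D x)\<^sup>2))"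
  proof
    fix x show "indicator ?Pos x *\<^sub>R sl.integrand x = indicator ?Pos x *
     (- \<phi> (t, x) * (\<delta> * V x / (V x + \<delta>)) * D x * Z x - 5/3 * \<phi>x (t, x) * (\<delta> * V x / (V x + \<delta>)) * D x * W x - 1/3 * (\<delta> * V x / (V x + \<delta>)) * \<phi>xx (t, x) * (D x)\<^sup>2)"
    proof (cases "x \<in> ?Pos")
      case True
      then have "(t, x) \<in> P" using t by (auto simp: positivity_set_def)
      then show ?thesis using True t
        by (simp add: sl.integrand_def D_def W_def Z_def V_def guxxx_def gu_def trunc_def)
    qed simp
  qed
  have m1: "(\<lambda>x. indicator ?Pos x *\<^sub>R sl.integrand x) \<in> borel_measurable lborel"
    unfolding eqm by measurable
  have ae: "AE x in lborel. indicator (S T) (t, x) * integ \<delta> (t, x) = indicator ?Pos x *\<^sub>R sl.integrand x"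
    using ae1 ae2
  proof eventually_elim
    case (elim x)
    show ?case
    proof (cases "x \<in> ?Pos")
      case True
      then have "(t, x) \<in> P" "x \<in> \<Omega>" using t by (auto simp: positivity_set_def)
      then show ?thesis using elim True unfolding St by (simp add: integ_def sl.integrand_def)
    qed (simp add: St)
  qed
  have "integrable lborel (\<lambda>x. indicator ?Pos x *\<^sub>R sl.integrand x)"
    using integrable_cong_AE_imp[OF i m1] ae by (auto elim!: eventually_mono)
  then have "0 \<le> (LBINT x:?Pos. sl.integrand x)"
    by (intro sl.integral_nonneg) (simp add: set_integrable_def)
  also have "\<dots> = (\<integral>x. indicator (S T) (t, x) * integ \<delta> (t, x) \<partial>lborel)"
    unfolding set_lebesgue_integral_def
    by (rule integral_cong_AE[OF m1 borel_measurable_integrable[OF i]]) (use ae in \<open>auto elim!: eventually_mono\<close>)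
  finally show ?thesis .
qed

lemma integ_nonneg:
  assumes \<delta>: "0 < \<delta>"
  shows "0 \<le> (LBINT p:S T. integ \<delta> p)"
proof -
  have i: "integrable (lborel \<Otimes>\<^sub>M lborel) (\<lambda>p. indicator (S T) p * integ \<delta> p)"
    using integ_integrable[OF \<delta>] by (simp add: set_integrable_def lborel_prod)
  have "(LBINT p:S T. integ \<delta> p) = (\<integral>t. \<integral>x. indicator (S T) (t, x) * integ \<delta> (t, x) \<partial>lborel \<partial>lborel)"
    using lborel_pair.integral_fst'[OF i] by (simp add: set_lebesgue_integral_def lborel_prod)
  also have "0 \<le> \<dots>"
  proof (rule integral_nonneg_AE)
    show "AE t in lborel. 0 \<le> (\<integral>x. indicator (S T) (t, x) * integ \<delta> (t, x) \<partial>lborel)"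
      using C1 slice_regularity[OF open_P wd] lborel_pair.AE_integrable_fst'[OF i]
    proof eventually_elim
      fix t
      assume c1: "0 < t \<longrightarrow> (\<exists>d. continuous_on {a..b} d \<and>
           (\<forall>x\<in>{a..b}. ((\<lambda>y. u (t, y)) has_real_derivative d x) (at x within {a..b})))"
        and sr: "\<forall>d. continuous_on {x. (t, x) \<in> P} d \<and> (AE x in lborel. (t, x) \<in> P \<longrightarrow> ux (t, x) = d x) \<longrightarrow>
    (\<exists>w. (\<forall>x. (t, x) \<in> P \<longrightarrow> (d has_real_derivative w x) (at x)) \<and>
       continuous_on {x. (t, x) \<in> P} w \<and>
       (AE x in lborel. (t, x) \<in> P \<longrightarrow> uxx (t, x) = w x) \<and>
       (\<forall>x y. x \<le> y \<and> {x..y} \<subseteq> {x. (t, x) \<in> P} \<longrightarrow>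
          set_integrable lborel {x..y} (\<lambda>s. uxxx (t, s)) \<and> w y - w x = (LBINT s:{x..y}. uxxx (t, s))))"
        and it: "integrable lborel (\<lambda>x. indicator (S T) (t, x) * integ \<delta> (t, x))"
      show "0 \<le> (\<integral>x. indicator (S T) (t, x) * integ \<delta> (t, x) \<partial>lborel)"
      proof (cases "0 < t \<and> t < T")
        case False
        then have "indicator (S T) (t, x) = (0::real)" for x by (auto split: split_indicator)
        then show ?thesis by simp
      next
        case True
        then obtain d where dc: "continuous_on {a..b} d"
          and ud: "\<And>x. x \<in> {a..b} \<Longrightarrow> ((\<lambda>y. u (t, y)) has_real_derivative d x) (at x within {a..b})"
          using c1 by blast
        have wdt: "weak_deriv \<Omega> 1 (\<lambda>x. u (t, x)) (\<lambda>x. ux (t, x))" using h1[of t] True by (simp add: H1_def)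
        have ae: "AE x in lborel. x \<in> \<Omega> \<longrightarrow> ux (t, x) = d x" by (rule weak_deriv_eq_C1[OF wdt dc ud])
        have sub: "{x. (t, x) \<in> P} \<subseteq> {a..b}" by (auto simp: positivity_set_def)
        have ae': "AE x in lborel. (t, x) \<in> P \<longrightarrow> ux (t, x) = d x"
          using ae by eventually_elim (auto simp: positivity_set_def)
        obtain w where "\<And>x. (t, x) \<in> P \<Longrightarrow> (d has_real_derivative w x) (at x)"
          "continuous_on {x. (t, x) \<in> P} w" "AE x in lborel. (t, x) \<in> P \<longrightarrow> uxx (t, x) = w x"
          "\<And>x y. x \<le> y \<Longrightarrow> {x..y} \<subseteq> {x. (t, x) \<in> P} \<Longrightarrow>
          set_integrable lborel {x..y} (\<lambda>s. uxxx (t, s)) \<and> w y - w x = (LBINT s:{x..y}. uxxx (t, s))"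
          using sr[rule_format, of d] continuous_on_subset[OF dc sub] ae' by blast
        then show ?thesis using integ_slice_nonneg[OF _ _ \<delta> dc ud ae _ _ _ _ it] True by blast
      qed
    qed
  qed
  finally show ?thesis .
qed

lemma rho_time_derivative_bound:
  "(LBINT p:Q. rho_eps n \<epsilon> u p * pd (1, 0) \<phi> p)
    \<le> C * (3 + sqrt (9 + 2 * M)) * (T * E0 + (b - a) * Rmax + T * (b - a) + E0 / 2) * L powr (-1/4)"
proof -
  define q where "q = L powr (-1/4)"
  have Lp: "0 < L" using Lpos by linarith
  have q0: "0 < q" using Lp by (simp add: q_def)
  have q4: "q ^ 4 * L = 1"
  proof -
    have "q ^ 4 = q powr 4" using q0 by (simp add: powr_numeral)
    also have "\<dots> = L powr (-1)" by (simp add: q_def powr_powr)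
    finally show ?thesis using Lp by (simp add: powr_minus)
  qed
  have q2: "q \<le> 2"
  proof (rule ccontr)
    assume "\<not> q \<le> 2"
    then have "2 ^ 4 \<le> q ^ 4" by (intro power_mono) auto
    then have "2 ^ 4 * (1/2) \<le> q ^ 4 * L" using Lpos by (intro mult_mono) auto
    then show False using q4 by simp
  qed
  define \<delta> where "\<delta> = q\<^sup>2"
  have \<delta>: "0 < \<delta>" using q0 by (simp add: \<delta>_def)
  define R where "R = sqrt (9 + 2 * M)"
  have R2: "R\<^sup>2 = 9 + 2 * M" "0 \<le> R" using M_ge by (auto simp: R_def)
  define r where "r p = L * deriv (Beps n \<epsilon>) (u p) * (\<epsilon> powr (3 - n) * u p powr (n - 1) + (u p)\<^sup>2) * u p" for p
  define E where "E p = (ux p)\<^sup>2 + u p * (uxx p)\<^sup>2 + 1 + L * mob p * (uxxx p)\<^sup>2" for p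
  have Ei: "set_integrable lborel (S T) E"
    unfolding E_def using S_ux_sq(1)[OF T] S_uxx_sq(1)[OF T] S_measure(1)[OF T] S_uxxx_sq(1)[OF T]
    by (intro set_integral_add)
  have Eb: "(LBINT p:S T. E p) \<le> T * E0 + (b - a) * Rmax + T * (b - a) + E0 / 2"
    unfolding E_def using S_ux_sq[OF T] S_uxx_sq[OF T] S_measure[OF T] S_uxxx_sq[OF T] by simp
  have ule: "u p \<le> M" if "p \<in> S T" for p
    using u_le_M[of "fst p" "snd p"] that by (auto simp: positivity_set_def)
  have r2: "(r p)\<^sup>2 \<le> R\<^sup>2 * mob p" if p: "p \<in> S T" for p
  proof -
    have "(r p)\<^sup>2 \<le> (18 * \<epsilon> + 2 * u p) * mob p"
      unfolding r_def by (rule flux_square_bound) (use n eps on_S(5)[OF p] in auto)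
    also have "\<dots> \<le> R\<^sup>2 * mob p"
      unfolding R2 using mob_nonneg(2)[OF p] eps ule[OF p] by (intro mult_right_mono) auto
    finally show ?thesis .
  qed
  have Ti: "set_integrable lborel (S T) (\<lambda>p. - ux p * (u p * uxxx p) * \<phi> p)"
  proof (rule set_integrable_bound)
    show "set_integrable lborel (S T) (\<lambda>p. C * ((ux p)\<^sup>2 + (u p * uxxx p)\<^sup>2))"
      using S_ux_sq(1)[OF T] S_uuxxx_sq[OF T] by (intro set_integral_add set_integrable_mult_right)
    show "set_borel_measurable lborel (S T) (\<lambda>p. - ux p * (u p * uxxx p) * \<phi> p)"
      by (rule set_measurable_S[of "\<lambda>p. - gux p * (gu p * guxxx p) * \<phi> p"]) (auto simp: on_S)
    show "AE p in lborel. p \<in> S T \<longrightarrow> norm (- ux p * (u p * uxxx p) * \<phi> p) \<le> norm (C * ((ux p)\<^sup>2 + (u p * uxxx p)\<^sup>2))"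
    proof (intro AE_I2 impI)
      fix p
      note ag = abs_mult_le_sum_squares
      have "norm (- ux p * (u p * uxxx p) * \<phi> p) = (\<bar>ux p\<bar> * \<bar>u p * uxxx p\<bar>) * \<bar>\<phi> p\<bar>" by (simp add: abs_mult)
      also have "\<dots> \<le> ((ux p)\<^sup>2 + (u p * uxxx p)\<^sup>2) * C" using C(1)[of p] by (intro mult_mono ag) auto
      finally show "norm (- ux p * (u p * uxxx p) * \<phi> p) \<le> norm (C * ((ux p)\<^sup>2 + (u p * uxxx p)\<^sup>2))"
        using C0 by (simp add: abs_mult mult.commute)
    qed
  qed
  have Ri: "set_integrable lborel (S T) (\<lambda>p. - r p * uxxx p * \<phi>x p)"
  proof (rule set_integrable_bound)
    show "set_integrable lborel (S T) (\<lambda>p. C * (R\<^sup>2 * 1 + 1 / L * (L * mob p * (uxxx p)\<^sup>2)))"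
      using S_measure(1)[OF T] S_uxxx_sq(1)[OF T] by (intro set_integral_add set_integrable_mult_right)
    show "set_borel_measurable lborel (S T) (\<lambda>p. - r p * uxxx p * \<phi>x p)"
      by (rule set_measurable_S[of "\<lambda>p. - (L * (gtail p / (\<epsilon> * L)) * (\<epsilon> powr (3 - n) * gu p powr (n - 1) + (gu p)\<^sup>2) * gu p) * guxxx p * \<phi>x p"])
         (auto simp: on_S r_def deriv_Beps[OF n eps(1)])
    show "AE p in lborel. p \<in> S T \<longrightarrow> norm (- r p * uxxx p * \<phi>x p) \<le> norm (C * (R\<^sup>2 * 1 + 1 / L * (L * mob p * (uxxx p)\<^sup>2)))"
    proof (intro AE_I2 impI)
      fix p assume p: "p \<in> S T"
      have mp: "0 < mob p" using mob_nonneg(2)[OF p] .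
      have rb: "\<bar>r p\<bar> \<le> R * sqrt (mob p)"
      proof (rule power2_le_imp_le)
        have "(R * sqrt (mob p))\<^sup>2 = R\<^sup>2 * mob p" using mp by (simp add: power_mult_distrib)
        then show "\<bar>r p\<bar>\<^sup>2 \<le> (R * sqrt (mob p))\<^sup>2" using r2[OF p] by simp
        show "0 \<le> R * sqrt (mob p)" using R2 mp by simp
      qed
      note ag = abs_mult_le_sum_squares
      have "\<bar>r p\<bar> * \<bar>uxxx p\<bar> \<le> (R * sqrt (mob p)) * \<bar>uxxx p\<bar>" using rb by (rule mult_right_mono) simp
      also have "\<dots> = \<bar>R\<bar> * \<bar>sqrt (mob p) * uxxx p\<bar>" using R2(2) mp by (simp add: abs_mult)
      also have "\<dots> \<le> R\<^sup>2 + (sqrt (mob p) * uxxx p)\<^sup>2" by (rule ag)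
      also have "(sqrt (mob p) * uxxx p)\<^sup>2 = mob p * (uxxx p)\<^sup>2" using mp by (simp add: power_mult_distrib)
      finally have 1: "\<bar>r p\<bar> * \<bar>uxxx p\<bar> \<le> R\<^sup>2 + mob p * (uxxx p)\<^sup>2" .
      have "norm (- r p * uxxx p * \<phi>x p) = (\<bar>r p\<bar> * \<bar>uxxx p\<bar>) * \<bar>\<phi>x p\<bar>" by (simp add: abs_mult)
      also have "\<dots> \<le> (R\<^sup>2 + mob p * (uxxx p)\<^sup>2) * C" using C(2)[of p] mp by (intro mult_mono 1) auto
      also have "\<dots> = C * (R\<^sup>2 * 1 + 1 / L * (L * mob p * (uxxx p)\<^sup>2))" using Lp by (simp add: field_simps)
      also have "\<dots> \<le> norm \<dots>" by simp
      finally show "norm (- r p * uxxx p * \<phi>x p) \<le> norm (C * (R\<^sup>2 * 1 + 1 / L * (L * mob p * (uxxx p)\<^sup>2)))" .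
    qed
  qed
  have T_eq: "(LBINT p:Q. Teps a b u ux uxxx p * \<phi> p) = (LBINT p:S T. - ux p * (u p * uxxx p) * \<phi> p)"
    unfolding set_lebesgue_integral_def
  proof (intro Bochner_Integration.integral_cong refl)
    fix p show "indicator Q p *\<^sub>R (Teps a b u ux uxxx p * \<phi> p) = indicator (S T) p *\<^sub>R (- ux p * (u p * uxxx p) * \<phi> p)"
      using \<phi>T[of p] PQ by (cases "T \<le> fst p") (auto simp: Teps_def split: split_indicator)
  qed
  have R_eq: "(LBINT p:Q. Reps a b n \<epsilon> u uxxx p * \<phi>x p) = (LBINT p:S T. - r p * uxxx p * \<phi>x p)"
    unfolding set_lebesgue_integral_def
  proof (intro Bochner_Integration.integral_cong refl)
    fix p show "indicator Q p *\<^sub>R (Reps a b n \<epsilon> u uxxx p * \<phi>x p) = indicator (S T) p *\<^sub>R (- r p * uxxx p * \<phi>x p)"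
      using \<phi>T[of p] PQ by (cases "T \<le> fst p") (auto simp: Reps_def r_def split: split_indicator)
  qed
  have Ii: "set_integrable lborel (S T) (\<lambda>p. integ \<delta> p - C * (3 + R) * q * E p)"
    using integ_integrable[OF \<delta>] Ei by (intro set_integral_diff set_integrable_mult_right)
  have "(LBINT p:S T. integ \<delta> p - C * (3 + R) * q * E p) \<le> (LBINT p:S T. - ux p * (u p * uxxx p) * \<phi> p - - r p * uxxx p * \<phi>x p)"
  proof (rule set_integral_mono[OF Ii set_integral_diff(1)[OF Ti Ri]])
    fix p assume p: "p \<in> S T"
    show "integ \<delta> p - C * (3 + R) * q * E p \<le> - ux p * (u p * uxxx p) * \<phi> p - - r p * uxxx p * \<phi>x p"
      unfolding integ_def E_def
      using dissipation_pointwise_bound[OF q0 q2 q4 on_S(5)[OF p] C(1)[of p] C(2)[of p] C(3)[of p] \<delta>_def r2[OF p] mob_nonneg(1)[OF p] R2(2),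
          of "ux p" "uxxx p" "uxx p"] by simp
  qed
  also have "\<dots> = (LBINT p:S T. - ux p * (u p * uxxx p) * \<phi> p) - (LBINT p:S T. - r p * uxxx p * \<phi>x p)"
    by (rule set_integral_diff(2)[OF Ti Ri])
  also have "\<dots> = - (LBINT p:Q. rho_eps n \<epsilon> u p * pd (1, 0) \<phi> p)"
    using rho_eq[OF \<phi>] by (simp add: T_eq R_eq)
  finally have "(LBINT p:Q. rho_eps n \<epsilon> u p * pd (1, 0) \<phi> p) \<le> C * (3 + R) * q * (LBINT p:S T. E p) - (LBINT p:S T. integ \<delta> p)"
    using integ_integrable[OF \<delta>] Ei by (simp add: set_integral_diff)
  also have "\<dots> \<le> C * (3 + R) * q * (LBINT p:S T. E p)" using integ_nonneg[OF \<delta>] by simp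
  also have "\<dots> \<le> C * (3 + R) * q * (T * E0 + (b - a) * Rmax + T * (b - a) + E0 / 2)"
    using Eb C0 R2(2) q0 by (intro mult_left_mono) auto
  finally show ?thesis by (simp add: q_def R_def mult_ac)
qed

end

end

subsection \<open>Passage to the limit\<close>

lemma test_fun_integrable:
  fixes \<phi> :: "'a::euclidean_space \<Rightarrow> real"
  assumes "test_fun U \<phi>" shows "integrable lborel \<phi>"
proof -
  let ?K = "closure {p. \<phi> p \<noteq> 0}"
  have sm: "smooth \<phi>" and K: "compact ?K" using assms unfolding test_fun_def by blast+
  have "continuous_on ?K \<phi>" by (rule continuous_on_subset[OF smooth_continuous[OF sm]]) simp
  with K have "integrable lborel (\<lambda>x. indicator ?K x *\<^sub>R \<phi> x)" by (rule borel_integrable_compact)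
  moreover have "(\<lambda>x. indicator ?K x *\<^sub>R \<phi> x) = \<phi>"
  proof
    fix x show "indicator ?K x *\<^sub>R \<phi> x = \<phi> x"
    proof (cases "x \<in> ?K")
      case False
      then have "\<phi> x = 0" by (rule test_fun_zero_outside(1)[OF assms])
      then show ?thesis by simp
    qed simp
  qed
  ultimately show ?thesis by simp
qed

lemma test_fun_mult_integrable:
  fixes \<phi> g :: "'a::euclidean_space \<Rightarrow> real"
  assumes "test_fun U \<phi>" "g \<in> borel_measurable lborel" "\<And>x. \<bar>g x\<bar> \<le> K" "A \<in> sets borel"
  shows "set_integrable lborel A (\<lambda>x. g x * \<phi> x)"
proof -
  have "set_integrable lborel A \<phi>"
    unfolding set_integrable_def by (rule integrable_mult_indicator[OF _ test_fun_integrable[OF assms(1)]]) (use assms in simp)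
  from set_integrable_mult_bounded(1)[OF this assms(2,3)] show ?thesis by (simp add: mult.commute)
qed

lemma test_fun_mult_dominated_convergence:
  fixes \<phi> :: "'a::euclidean_space \<Rightarrow> real" and g :: "nat \<Rightarrow> 'a \<Rightarrow> real"
  assumes \<phi>: "test_fun U \<phi>" and g: "\<And>n. g n \<in> borel_measurable lborel" "\<And>n x. \<bar>g n x\<bar> \<le> K"
    and r: "r \<in> borel_measurable lborel" and A: "A \<in> sets borel"
    and lim: "AE x in lborel. (\<lambda>n. g n x) \<longlonglongrightarrow> r x"
  shows "(\<lambda>n. LBINT x:A. g n x * \<phi> x) \<longlonglongrightarrow> (LBINT x:A. r x * \<phi> x)"
  unfolding set_lebesgue_integral_def
proof (rule integral_dominated_convergence[where w="\<lambda>x. K * \<bar>\<phi> x\<bar>"])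
  have [measurable]: "\<phi> \<in> borel_measurable lborel" by (rule borel_measurable_integrable[OF test_fun_integrable[OF \<phi>]])
  note [measurable] = g(1) r A
  show "(\<lambda>x. indicator A x *\<^sub>R (r x * \<phi> x)) \<in> borel_measurable lborel" by measurable
  show "(\<lambda>x. indicator A x *\<^sub>R (g n x * \<phi> x)) \<in> borel_measurable lborel" for n by measurable
  show "integrable lborel (\<lambda>x. K * \<bar>\<phi> x\<bar>)" using test_fun_integrable[OF \<phi>] by simp
  show "AE x in lborel. (\<lambda>n. indicator A x *\<^sub>R (g n x * \<phi> x)) \<longlonglongrightarrow> indicator A x *\<^sub>R (r x * \<phi> x)"
    using lim by eventually_elim (intro tendsto_intros)
  show "AE x in lborel. norm (indicator A x *\<^sub>R (g n x * \<phi> x)) \<le> K * \<bar>\<phi> x\<bar>" for n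
  proof (rule AE_I2)
    fix x
    have "\<bar>g n x\<bar> * \<bar>\<phi> x\<bar> \<le> K * \<bar>\<phi> x\<bar>" using g(2) by (rule mult_right_mono) simp
    moreover have "0 \<le> K * \<bar>\<phi> x\<bar>" using g(2)[of n x] by (intro mult_nonneg_nonneg) auto
    ultimately show "norm (indicator A x *\<^sub>R (g n x * \<phi> x)) \<le> K * \<bar>\<phi> x\<bar>"
      by (auto simp: abs_mult split: split_indicator)
  qed
qed

lemma set_integral_midpoint:
  fixes f g h :: "'a \<Rightarrow> real"
  assumes "set_integrable M A (\<lambda>x. f x * h x)" "set_integrable M A (\<lambda>x. g x * h x)"
  shows "(LINT x:A|M. (f x + g x) / 2 * h x) = ((LINT x:A|M. f x * h x) + (LINT x:A|M. g x * h x)) / 2"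
proof -
  have eq: "(\<lambda>x. (f x + g x) / 2 * h x) = (\<lambda>x. 1/2 * (f x * h x + g x * h x))" by (auto simp: field_simps)
  show ?thesis unfolding eq set_integral_mult_right set_integral_add(2)[OF assms] by simp
qed

lemma thin_film_solution_thin_film:
  assumes "a < b" "0 < n" "n < 3" "0 < \<epsilon>" "\<epsilon> \<le> 1/2"
    and uin: "H1 {a<..<b} uin uin_x" and mass: "(LBINT x:{a<..<b}. uin x) = 1"
    and sol: "thin_film_solution a b n uin uin_x \<epsilon> u"
  shows "\<exists>ux uxx uxxx. thin_film a b n \<epsilon> (LBINT x:{a<..<b}. (uin_x x)\<^sup>2) u ux uxx uxxx"
proof -
  define E0 where "E0 = (LBINT x:{a<..<b}. (uin_x x)\<^sup>2)"
  have E0: "0 \<le> E0" unfolding E0_def set_lebesgue_integral_def by (intro integral_nonneg_AE AE_I2) auto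
  have i: "set_integrable lborel {a<..<b} (\<lambda>x. (uin_x x)\<^sup>2 / 2)"
    using uin by (auto simp: H1_def Lp_def)
  have "(\<integral>\<^sup>+ x\<in>{a<..<b}. ennreal ((uin_x x)\<^sup>2 / 2) \<partial>lborel) = (\<integral>\<^sup>+ x. ennreal (indicator {a<..<b} x *\<^sub>R ((uin_x x)\<^sup>2 / 2)) \<partial>lborel)"
    by (intro nn_integral_cong) (auto split: split_indicator)
  also have "\<dots> = ennreal (LBINT x:{a<..<b}. (uin_x x)\<^sup>2 / 2)"
    unfolding set_lebesgue_integral_def
    by (rule nn_integral_eq_integral[OF i[unfolded set_integrable_def]]) auto
  finally have e: "(\<integral>\<^sup>+ x\<in>{a<..<b}. ennreal ((uin_x x)\<^sup>2 / 2) \<partial>lborel) = ennreal (E0 / 2)" by (simp add: E0_def)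
  from sol show ?thesis
    unfolding thin_film_solution_def Let_def e mass E0_def[symmetric]
  proof (elim exE conjE)
    fix ux uxx uxxx
    assume cont: "continuous_on ({0..} \<times> {a..b}) u" and nn: "\<forall>p\<in>{0..} \<times> {a..b}. 0 \<le> u p"
      and uxm: "set_borel_measurable lborel ({0<..} \<times> {a<..<b}) ux"
      and h1: "\<forall>t>0. H1 {a<..<b} (\<lambda>x. u (t, x)) (\<lambda>x. ux (t, x))"
      and wd: "weak_deriv (positivity_set a b u) (0, 1) ux uxx" "weak_deriv (positivity_set a b u) (0, 1) uxx uxxx"
      and u3: "\<forall>T>0. Lp 2 (positivity_set a b u \<inter> {0<..<T} \<times> {a<..<b}) (\<lambda>p. u p * uxxx p)"
      and m: "\<forall>t>0. (LBINT x:{a<..<b}. u (t, x)) = 1"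
      and en: "\<forall>t>0. (\<integral>\<^sup>+ x\<in>{a<..<b}. ennreal ((ux (t, x))\<^sup>2 / 2) \<partial>lborel)
          + (\<integral>\<^sup>+ p\<in>positivity_set a b u \<inter> {0<..<t} \<times> {a<..<b}. ennreal (\<bar>ln \<epsilon>\<bar> * mobility n \<epsilon> (u p) * (uxxx p)\<^sup>2) \<partial>lborel)
         \<le> ennreal (E0 / 2)"
      and ent: "\<forall>t>0. (\<integral>\<^sup>+ p\<in>positivity_set a b u \<inter> {0<..<t} \<times> {a<..<b}. ennreal (u p * (uxx p)\<^sup>2) \<partial>lborel)
            + (\<integral>\<^sup>+ x\<in>{a<..<b}. ennreal (rho_eps n \<epsilon> u (0, x)) \<partial>lborel)
         \<le> (\<integral>\<^sup>+ x\<in>{a<..<b}. ennreal (rho_eps n \<epsilon> u (t, x)) \<partial>lborel)"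
      and C1: "AE t in lborel. 0 < t \<longrightarrow>
         (\<exists>d. continuous_on {a..b} d \<and> d a = 0 \<and> d b = 0 \<and>
           (\<forall>x\<in>{a..b}. ((\<lambda>y. u (t, y)) has_real_derivative d x) (at x within {a..b})))"
      and re: "\<forall>\<phi>. test_fun ({0<..} \<times> {a<..<b}) \<phi> \<longrightarrow>
         - (LBINT p:{0<..} \<times> {a<..<b}. rho_eps n \<epsilon> u p * pd (1, 0) \<phi> p)
         = (LBINT p:{0<..} \<times> {a<..<b}. Teps a b u ux uxxx p * \<phi> p)
           - (LBINT p:{0<..} \<times> {a<..<b}. Reps a b n \<epsilon> u uxxx p * pd (0, 1) \<phi> p)"
    have "thin_film a b n \<epsilon> E0 u ux uxx uxxx"
    proof
      show "0 \<le> u p" if "p \<in> {0..} \<times> {a..b}" for p using nn that by blast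
      show "(\<integral>\<^sup>+ p\<in>positivity_set a b u \<inter> {0<..<t} \<times> {a<..<b}. ennreal (u p * (uxx p)\<^sup>2) \<partial>lborel)
       \<le> (\<integral>\<^sup>+ x\<in>{a<..<b}. ennreal (rho_eps n \<epsilon> u (t, x)) \<partial>lborel)" if "0 < t" for t
        by (rule order_trans[OF add_increasing2[OF zero_le order_refl] ent[rule_format, OF that]])
      show "AE t in lborel. 0 < t \<longrightarrow>
         (\<exists>d. continuous_on {a..b} d \<and>
           (\<forall>x\<in>{a..b}. ((\<lambda>y. u (t, y)) has_real_derivative d x) (at x within {a..b})))"
        using C1 by eventually_elim blast
      show "- (LBINT p:{0<..} \<times> {a<..<b}. rho_eps n \<epsilon> u p * pd (1, 0) \<phi> p)
         = (LBINT p:{0<..} \<times> {a<..<b}. Teps a b u ux uxxx p * \<phi> p)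
           - (LBINT p:{0<..} \<times> {a<..<b}. Reps a b n \<epsilon> u uxxx p * pd (0, 1) \<phi> p)"
        if "test_fun ({0<..} \<times> {a<..<b}) \<phi>" for \<phi> using re that by blast
    qed (use assms E0 cont nn uxm h1 wd u3 m en in \<open>simp_all\<close>)
    then show "\<exists>ux uxx uxxx. thin_film a b n \<epsilon> E0 u ux uxx uxxx" by blast
  qed
qed

lemma test_fun_time_support:
  assumes "test_fun ({0<..} \<times> \<Omega>) (\<phi> :: real \<times> real \<Rightarrow> real)"
  obtains T where "0 < T" "\<And>p v. T \<le> fst p \<Longrightarrow> \<phi> p = 0 \<and> pd v \<phi> p = 0"
proof -
  let ?K = "closure {p. \<phi> p \<noteq> 0}"
  have cp: "compact (fst ` ?K)"
    using assms by (intro compact_continuous_image continuous_intros) (simp add: test_fun_def)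
  then obtain c where c: "\<And>y. y \<in> fst ` ?K \<Longrightarrow> \<bar>y\<bar> \<le> c"
    using compact_imp_bounded[OF cp] unfolding bounded_iff real_norm_def by blast
  show thesis
  proof (rule that[of "max 1 (c + 1)"])
    fix p :: "real \<times> real" and v assume p: "max 1 (c + 1) \<le> fst p"
    have "p \<notin> ?K"
    proof
      assume "p \<in> ?K"
      then have "\<bar>fst p\<bar> \<le> c" by (intro c) blast
      then show False using p by simp
    qed
    then show "\<phi> p = 0 \<and> pd v \<phi> p = 0" using test_fun_zero_outside[OF assms] by blast
  qed simp
qed

theorem theorem1p5:
  fixes a b n p :: real
    and uin uin_x :: "real \<Rightarrow> real"
    and u :: "real \<Rightarrow> real \<times> real \<Rightarrow> real"
    and e :: "nat \<Rightarrow> real"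
    and \<rho> :: "real \<Rightarrow> distr"
  assumes "a < b" and "0 < n" and "n < 3"
    and "H1 {a<..<b} uin uin_x"
    and "AE x in lborel. x \<in> {a<..<b} \<longrightarrow> 0 \<le> uin x"
    and "(LBINT x:{a<..<b}. uin x) = 1"
    and "\<And>\<epsilon>. 0 < \<epsilon> \<Longrightarrow> \<epsilon> \<le> 1 / 2 \<Longrightarrow> thin_film_solution a b n uin uin_x \<epsilon> (u \<epsilon>)"
    and "\<And>k. 0 < e k \<and> e k \<le> 1 / 2" and "e \<longlonglongrightarrow> 0"
    and "1 \<le> p"
    and "\<And>T. 0 < T \<Longrightarrow>
      tendsto_Lp_Wm11 p {a<..<b} T (\<lambda>k. distr_of {a<..<b} (rho_eps n (e k) (u (e k)))) \<rho>"
  shows "\<exists>r :: real \<times> real \<Rightarrow> real.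
    r \<in> borel_measurable lborel \<and>
    (AE t in lborel. 0 < t \<longrightarrow>
       (\<forall>\<phi>. test_fun {a<..<b} \<phi> \<longrightarrow> \<rho> t \<phi> = distr_of {a<..<b} r t \<phi>)) \<and>
    (AE q in lborel. q \<in> {0<..} \<times> {a<..<b} \<longrightarrow> 0 \<le> r q \<and> r q \<le> 1) \<and>
    (\<forall>\<phi>. test_fun ({0<..} \<times> {a<..<b}) \<phi> \<and> (\<forall>q. 0 \<le> \<phi> q) \<longrightarrow>
       0 \<le> - (LBINT q:{0<..} \<times> {a<..<b}. r q * pd (1, 0) \<phi> q))"
proof -
  note ab = assms(1) and n = assms(2,3)
  let ?\<Omega> = "{a<..<b}"
  let ?Q = "{0<..} \<times> {a<..<b} :: (real \<times> real) set"
  define E0 where "E0 = (LBINT x:?\<Omega>. (uin_x x)\<^sup>2)"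
  have "\<exists>k. (\<forall>j. j \<le> k j) \<and> (AE t in lborel. 0 < t \<longrightarrow> (\<forall>\<phi>. test_fun ?\<Omega> \<phi> \<longrightarrow>
     (\<lambda>j::nat. distr_of ?\<Omega> (rho_eps n (e (k j)) (u (e (k j)))) t \<phi>) \<longlonglongrightarrow> \<rho> t \<phi>))"
    by (rule tendsto_Lp_Wm11_AE_subseq[OF _ assms(10)]) (use assms(11) in auto)
  then obtain k where k: "\<And>j. j \<le> k j"
    and conv: "AE t in lborel. 0 < t \<longrightarrow> (\<forall>\<phi>. test_fun ?\<Omega> \<phi> \<longrightarrow>
     (\<lambda>j::nat. distr_of ?\<Omega> (rho_eps n (e (k j)) (u (e (k j)))) t \<phi>) \<longlonglongrightarrow> \<rho> t \<phi>)" by blast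
  define \<epsilon> where "\<epsilon> j = e (k j)" for j
  have eps: "0 < \<epsilon> j" "\<epsilon> j \<le> 1/2" for j using assms(8) by (auto simp: \<epsilon>_def)
  have "filterlim k at_top sequentially"
    by (rule filterlim_at_top_mono[OF filterlim_ident]) (use k in auto)
  then have eps0: "\<epsilon> \<longlonglongrightarrow> 0" unfolding \<epsilon>_def by (rule filterlim_compose[OF assms(9)])
  define L where "L j = \<bar>ln (\<epsilon> j)\<bar>" for j
  have Ltop: "filterlim L at_top sequentially"
  proof -
    have "filterlim \<epsilon> (at_right 0) sequentially"
      unfolding filterlim_at using eps0 eps(1) by (auto intro!: always_eventually simp: less_imp_neq[symmetric])
    then have "filterlim (\<lambda>j. ln (\<epsilon> j)) at_bot sequentially" by (rule filterlim_compose[OF ln_at_0])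
    then have "filterlim (\<lambda>j. - ln (\<epsilon> j)) at_top sequentially" by (simp add: filterlim_uminus_at_bot)
    then show ?thesis
      by (rule filterlim_at_top_mono) (unfold L_def, intro always_eventually allI abs_ge_minus_self)
  qed
  have "\<exists>ux uxx uxxx. thin_film a b n (\<epsilon> j) E0 (u (\<epsilon> j)) ux uxx uxxx" for j
    unfolding E0_def by (rule thin_film_solution_thin_film[OF ab n eps assms(4) assms(6) assms(7)[OF eps]])
  then obtain ux uxx uxxx where tf: "\<And>j. thin_film a b n (\<epsilon> j) E0 (u (\<epsilon> j)) (ux j) (uxx j) (uxxx j)" by metis
  define M where "M = thin_film.M a b E0"
  define B where "B = Bfun n 1 + ln M"
  define Rm where "Rm j = thin_film.Rmax a b n (\<epsilon> j) E0" for j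
  have M1: "1 \<le> M" unfolding M_def by (rule thin_film.M_ge[OF tf])
  have Rm_eq: "Rm j = 1 + B / L j" for j
    unfolding Rm_def B_def M_def L_def by (rule thin_film.Rmax_def[OF tf])
  have Rm: "1 \<le> Rm j" "Rm j \<le> 1 + 2 * B" for j
    using thin_film.Rmax_le[OF tf, of j] by (auto simp: Rm_def B_def M_def)
  have Rm_lim: "Rm \<longlonglongrightarrow> 1"
    unfolding Rm_eq[abs_def] using tendsto_add[OF tendsto_const[of 1] real_tendsto_divide_at_top[OF tendsto_const[of B] Ltop]] by simp
  define f where "f j q = indicator ?Q q * rho_eps n (\<epsilon> j) (u (\<epsilon> j)) q" for j q
  define Kb where "Kb = 1 + 2 * B"
  have f_le: "0 \<le> f j q" "f j q \<le> Rm j" for j q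
    using thin_film.rho_bounds[OF tf, of "fst q" "snd q" j] Rm(1)[of j]
    by (auto simp: f_def Rm_def split: split_indicator)
  have f_abs: "\<bar>f j q\<bar> \<le> Kb" for j q using f_le[of j q] Rm(2)[of j] by (simp add: Kb_def)
  have f_meas: "f j \<in> borel_measurable lborel" for j
  proof -
    have "continuous_on ?Q (u (\<epsilon> j))" by (rule thin_film.contQ[OF tf])
    from borel_measurable_continuous_on_indicator[OF borel_open this]
    have [measurable]: "(\<lambda>q. indicator ?Q q * u (\<epsilon> j) q) \<in> borel_measurable borel" by (simp add: open_Times)
    have [measurable]: "?Q \<in> sets borel" by (intro borel_open open_Times) auto
    note [measurable] = Bfun_measurable[OF n]
    have "f j = (\<lambda>q. indicator ?Q q * (Bfun n (indicator ?Q q * u (\<epsilon> j) q / \<epsilon> j) / L j))"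
      by (auto simp: f_def rho_eps_def Beps_def L_def split: split_indicator)
    also have "\<dots> \<in> borel_measurable lborel" by measurable
    finally show ?thesis .
  qed
  have sQ: "?Q \<in> sets borel" by (intro borel_open open_Times) auto
  have section_meas: "(\<lambda>x. g (t, x)) \<in> borel_measurable lborel" if "g \<in> borel_measurable lborel" for g :: "real \<times> real \<Rightarrow> real" and t
  proof -
    have "(\<lambda>x. (t, x)) \<in> borel \<rightarrow>\<^sub>M (borel :: (real \<times> real) measure)"
      by (intro borel_measurable_continuous_onI continuous_intros)
    from measurable_compose[OF this, of g borel] that show ?thesis by simp
  qed
  have Bas: "(1, 0) \<in> (Basis :: (real \<times> real) set)" by (simp add: Basis_prod_def)
  define C where "C N = {g. g \<in> borel_measurable lborel \<and> (\<forall>q. \<bar>g q\<bar> \<le> Kb \<and> 0 \<le> g q) \<and>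
      (\<forall>q c. (\<forall>j\<ge>N. f j q \<le> c) \<longrightarrow> g q \<le> c) \<and>
      (\<forall>t \<phi> c. test_fun ?\<Omega> \<phi> \<and> (\<forall>j\<ge>N. \<bar>distr_of ?\<Omega> (f j) t \<phi> - \<rho> t \<phi>\<bar> \<le> c) \<longrightarrow> \<bar>distr_of ?\<Omega> g t \<phi> - \<rho> t \<phi>\<bar> \<le> c) \<and>
      (\<forall>\<phi> c. test_fun ?Q \<phi> \<and> (\<forall>j\<ge>N. (LBINT q:?Q. f j q * pd (1, 0) \<phi> q) \<le> c) \<longrightarrow> (LBINT q:?Q. g q * pd (1, 0) \<phi> q) \<le> c)}" for N
  have C_meas: "g \<in> borel_measurable lborel" and C_abs: "\<bar>g q\<bar> \<le> Kb" and C_nn: "0 \<le> g q" if "g \<in> C N" for g N q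
    using that unfolding C_def by blast+
  have C_le: "g q \<le> c" if "g \<in> C N" "\<And>j. N \<le> j \<Longrightarrow> f j q \<le> c" for g N q c
    using that unfolding C_def by blast
  have C_distr: "\<bar>distr_of ?\<Omega> g t \<phi> - \<rho> t \<phi>\<bar> \<le> c"
    if "g \<in> C N" "test_fun ?\<Omega> \<phi>" "\<And>j. N \<le> j \<Longrightarrow> \<bar>distr_of ?\<Omega> (f j) t \<phi> - \<rho> t \<phi>\<bar> \<le> c" for g N t \<phi> c
    using that unfolding C_def by blast
  have C_time: "(LBINT q:?Q. g q * pd (1, 0) \<phi> q) \<le> c"
    if "g \<in> C N" "test_fun ?Q \<phi>" "\<And>j. N \<le> j \<Longrightarrow> (LBINT q:?Q. f j q * pd (1, 0) \<phi> q) \<le> c" for g N \<phi> c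
    using that unfolding C_def by blast
  have "\<exists>g. (\<forall>N. g N \<in> C N) \<and> (AE q in lborel. convergent (\<lambda>N. g N q))"
  proof (rule midpoint_convex_AE_convergent[OF sigma_finite_lborel])
    show "C N \<noteq> {}" for N
    proof -
      have "f N \<in> C N" using f_meas[of N] f_le[of N] f_abs[of N] by (auto simp: C_def)
      then show ?thesis by blast
    qed
    show "C N \<subseteq> C m" if "m \<le> N" for m N
      unfolding C_def using that by (auto intro: order_trans)
    show "g \<in> borel_measurable lborel" if "g \<in> C N" for N g using that by (rule C_meas)
    show "\<bar>g q\<bar> \<le> Kb" if "g \<in> C N" for N g q using that by (rule C_abs)
    fix N g h assume g: "g \<in> C N" and h: "h \<in> C N"
    let ?m = "\<lambda>x. (g x + h x) / 2"
    have gm: "g \<in> borel_measurable lborel" "h \<in> borel_measurable lborel" and gb: "\<And>q. \<bar>g q\<bar> \<le> Kb" "\<And>q. \<bar>h q\<bar> \<le> Kb"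
      and g0: "\<And>q. 0 \<le> g q" "\<And>q. 0 \<le> h q"
      using C_meas[OF g] C_meas[OF h] C_abs[OF g] C_abs[OF h] C_nn[OF g] C_nn[OF h] .
    have d: "distr_of ?\<Omega> ?m t \<phi> = (distr_of ?\<Omega> g t \<phi> + distr_of ?\<Omega> h t \<phi>) / 2" if "test_fun ?\<Omega> \<phi>" for t \<phi>
    proof -
      have "set_integrable lborel ?\<Omega> (\<lambda>x. g (t, x) * \<phi> x)" "set_integrable lborel ?\<Omega> (\<lambda>x. h (t, x) * \<phi> x)"
        by (rule test_fun_mult_integrable[OF that section_meas[OF gm(1)] gb(1)] test_fun_mult_integrable[OF that section_meas[OF gm(2)] gb(2)]; simp)+
      from set_integral_midpoint[OF this] show ?thesis unfolding distr_of_def .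
    qed
    have i: "(LBINT q:?Q. ?m q * pd (1, 0) \<phi> q) = ((LBINT q:?Q. g q * pd (1, 0) \<phi> q) + (LBINT q:?Q. h q * pd (1, 0) \<phi> q)) / 2"
      if "test_fun ?Q \<phi>" for \<phi>
    proof -
      have "set_integrable lborel ?Q (\<lambda>q. g q * pd (1, 0) \<phi> q)" "set_integrable lborel ?Q (\<lambda>q. h q * pd (1, 0) \<phi> q)"
        by (rule test_fun_mult_integrable[OF test_fun_pd[OF that Bas] gm(1) gb(1) sQ] test_fun_mult_integrable[OF test_fun_pd[OF that Bas] gm(2) gb(2) sQ])+
      from set_integral_midpoint[OF this] show ?thesis .
    qed
    have tri: "\<bar>(x + y) / 2 - z\<bar> \<le> c" if "\<bar>x - z\<bar> \<le> c" "\<bar>y - z\<bar> \<le> c" for x y z c :: real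
      using that unfolding abs_le_iff by (simp add: field_simps)
    show "?m \<in> C N"
      unfolding C_def
    proof (intro CollectI conjI allI impI; (elim conjE)?)
      show "?m \<in> borel_measurable lborel" using gm by measurable
      show "\<bar>?m q\<bar> \<le> Kb" for q using gb[of q] g0[of q] by simp
      show "0 \<le> ?m q" for q using g0[of q] by simp
      show "?m q \<le> c" if "\<forall>j\<ge>N. f j q \<le> c" for q c
      proof -
        have "g q \<le> c" "h q \<le> c" using C_le[OF g] C_le[OF h] that by blast+
        then show ?thesis by simp
      qed
      show "\<bar>distr_of ?\<Omega> ?m t \<phi> - \<rho> t \<phi>\<bar> \<le> c"
        if t: "test_fun ?\<Omega> \<phi>" and c: "\<forall>j\<ge>N. \<bar>distr_of ?\<Omega> (f j) t \<phi> - \<rho> t \<phi>\<bar> \<le> c" for t \<phi> c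
        unfolding d[OF t] by (rule tri[OF C_distr[OF g t] C_distr[OF h t]]) (use c in blast)+
      show "(LBINT q:?Q. ?m q * pd (1, 0) \<phi> q) \<le> c"
        if t: "test_fun ?Q \<phi>" and c: "\<forall>j\<ge>N. (LBINT q:?Q. f j q * pd (1, 0) \<phi> q) \<le> c" for \<phi> c
      proof -
        have "(LBINT q:?Q. g q * pd (1, 0) \<phi> q) \<le> c" "(LBINT q:?Q. h q * pd (1, 0) \<phi> q) \<le> c"
          using C_time[OF g t] C_time[OF h t] c by blast+
        then show ?thesis unfolding i[OF t] by simp
      qed
    qed
  qed
  then obtain g where gC: "\<And>N. g N \<in> C N" and gconv: "AE q in lborel. convergent (\<lambda>N. g N q)" by blast
  have gm: "g N \<in> borel_measurable lborel" and gb: "\<bar>g N q\<bar> \<le> Kb" and g0: "0 \<le> g N q" for N q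
    using C_meas[OF gC] C_abs[OF gC] C_nn[OF gC] .
  define r where "r q = lim (\<lambda>N. g N q)" for q
  have rm: "r \<in> borel_measurable lborel" unfolding r_def by (rule borel_measurable_lim_metric) (rule gm)
  have lim: "AE q in lborel. (\<lambda>N. g N q) \<longlonglongrightarrow> r q"
    using gconv by eventually_elim (simp add: r_def convergent_LIMSEQ_iff)
  have fd: "distr_of ?\<Omega> (f j) t \<phi> = distr_of ?\<Omega> (rho_eps n (e (k j)) (u (e (k j)))) t \<phi>" if "0 < t" for j t \<phi>
    unfolding distr_of_def by (rule set_lebesgue_integral_cong) (use that in \<open>auto simp: f_def \<epsilon>_def\<close>)
  show ?thesis
  proof (intro exI[of _ r] conjI allI impI)
    show "r \<in> borel_measurable lborel" by (rule rm)
    have "AE t in lborel. AE x in lborel. (\<lambda>N. g N (t, x)) \<longlonglongrightarrow> r (t, x)"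
      by (rule lborel_pair.AE_pair) (unfold lborel_prod, rule lim)
    then show "AE t in lborel. 0 < t \<longrightarrow> (\<forall>\<phi>. test_fun ?\<Omega> \<phi> \<longrightarrow> \<rho> t \<phi> = distr_of ?\<Omega> r t \<phi>)"
      using conv
    proof (eventually_elim, intro impI allI)
      fix t \<phi>
      assume ae: "AE x in lborel. (\<lambda>N. g N (t, x)) \<longlonglongrightarrow> r (t, x)"
        and cv: "0 < t \<longrightarrow> (\<forall>\<phi>. test_fun ?\<Omega> \<phi> \<longrightarrow> (\<lambda>j. distr_of ?\<Omega> (rho_eps n (e (k j)) (u (e (k j)))) t \<phi>) \<longlonglongrightarrow> \<rho> t \<phi>)"
        and t: "0 < t" and \<phi>: "test_fun ?\<Omega> \<phi>"
      have fl: "(\<lambda>j. distr_of ?\<Omega> (f j) t \<phi>) \<longlonglongrightarrow> \<rho> t \<phi>" using cv t \<phi> by (simp add: fd)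
      have "(\<lambda>N. distr_of ?\<Omega> (g N) t \<phi>) \<longlonglongrightarrow> \<rho> t \<phi>"
        unfolding LIMSEQ_iff
      proof (intro allI impI)
        fix d :: real assume "0 < d"
        then obtain N where N: "\<And>j. N \<le> j \<Longrightarrow> \<bar>distr_of ?\<Omega> (f j) t \<phi> - \<rho> t \<phi>\<bar> < d / 2"
          using fl[unfolded LIMSEQ_iff, rule_format, of "d/2"] by auto
        have "\<bar>distr_of ?\<Omega> (g m) t \<phi> - \<rho> t \<phi>\<bar> \<le> d / 2" if "N \<le> m" for m
        proof -
          have "\<bar>distr_of ?\<Omega> (f j) t \<phi> - \<rho> t \<phi>\<bar> \<le> d / 2" if "m \<le> j" for j
            using N[of j] \<open>N \<le> m\<close> that by simp
          then show ?thesis by (rule C_distr[OF gC \<phi>])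
        qed
        then show "\<exists>N. \<forall>m\<ge>N. norm (distr_of ?\<Omega> (g m) t \<phi> - \<rho> t \<phi>) < d"
          using \<open>0 < d\<close> by (intro exI[of _ N]) (force intro: le_less_trans)
      qed
      moreover have "(\<lambda>N. distr_of ?\<Omega> (g N) t \<phi>) \<longlonglongrightarrow> distr_of ?\<Omega> r t \<phi>"
        unfolding distr_of_def
        by (rule test_fun_mult_dominated_convergence[OF \<phi> section_meas[OF gm] gb section_meas[OF rm] _ ae]) simp
      ultimately show "\<rho> t \<phi> = distr_of ?\<Omega> r t \<phi>" by (rule LIMSEQ_unique)
    qed
    show "AE q in lborel. q \<in> ?Q \<longrightarrow> 0 \<le> r q \<and> r q \<le> 1"
      using lim
    proof (eventually_elim, intro impI conjI)
      fix q assume l: "(\<lambda>N. g N q) \<longlonglongrightarrow> r q"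
      show "0 \<le> r q" by (rule LIMSEQ_le_const[OF l]) (use g0 in auto)
      show "r q \<le> 1"
      proof (rule field_le_epsilon)
        fix d :: real assume "0 < d"
        then have "\<forall>\<^sub>F j in sequentially. Rm j < 1 + d" using Rm_lim by (intro order_tendstoD) auto
        then obtain N where N: "\<And>j. N \<le> j \<Longrightarrow> Rm j < 1 + d" by (auto simp: eventually_sequentially)
        have "g m q \<le> 1 + d" if "N \<le> m" for m
        proof -
          have "f j q \<le> 1 + d" if "m \<le> j" for j
            using N[of j] \<open>N \<le> m\<close> that f_le(2)[of j q] by simp
          then show ?thesis by (rule C_le[OF gC])
        qed
        then show "r q \<le> 1 + d" by (intro LIMSEQ_le_const2[OF l]) blast
      qed
    qed
    fix \<phi> assume "test_fun ?Q \<phi> \<and> (\<forall>q. 0 \<le> \<phi> q)"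
    then have \<phi>: "test_fun ?Q \<phi>" and \<phi>0: "\<And>q. 0 \<le> \<phi> q" by auto
    have Bas': "(0, 1) \<in> (Basis :: (real \<times> real) set)" by (simp add: Basis_prod_def)
    obtain T where T: "0 < T" "\<And>p v. T \<le> fst p \<Longrightarrow> \<phi> p = 0 \<and> pd v \<phi> p = 0" using test_fun_time_support[OF \<phi>] by blast
    have \<phi>x: "test_fun ?Q (pd (0,1) \<phi>)" "test_fun ?Q (pd (0,1) (pd (0,1) \<phi>))"
      using test_fun_pd[OF \<phi> Bas'] test_fun_pd[OF test_fun_pd[OF \<phi> Bas'] Bas'] .
    obtain C1 C2 C3 where C123: "\<And>q. \<bar>\<phi> q\<bar> \<le> C1" "\<And>q. \<bar>pd (0,1) \<phi> q\<bar> \<le> C2" "\<And>q. \<bar>pd (0,1) (pd (0,1) \<phi>) q\<bar> \<le> C3"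
      using test_fun_bounds[OF \<phi>] test_fun_bounds[OF \<phi>x(1)] test_fun_bounds[OF \<phi>x(2)] by blast
    define Cm where "Cm = max C1 (max C2 C3)"
    have Cm: "\<bar>\<phi> q\<bar> \<le> Cm" "\<bar>pd (0,1) \<phi> q\<bar> \<le> Cm" "\<bar>pd (0,1) (pd (0,1) \<phi>) q\<bar> \<le> Cm" for q
      using C123[of q] by (auto simp: Cm_def le_max_iff_disj)
    have Cm0: "0 \<le> Cm" using Cm(1)[of 0] by linarith
    define c where "c = Cm * (3 + sqrt (9 + 2 * M)) * (T * E0 + (b - a) * Kb + T * (b - a) + E0 / 2)"
    have fb: "(LBINT q:?Q. f j q * pd (1, 0) \<phi> q) \<le> c * L j powr (-1/4)" for j
    proof -
      have "(LBINT q:?Q. f j q * pd (1, 0) \<phi> q) = (LBINT q:?Q. rho_eps n (\<epsilon> j) (u (\<epsilon> j)) q * pd (1, 0) \<phi> q)"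
        by (rule set_lebesgue_integral_cong) (use sQ in \<open>auto simp: f_def\<close>)
      also have "\<dots> \<le> Cm * (3 + sqrt (9 + 2 * M)) * (T * E0 + (b - a) * Rm j + T * (b - a) + E0 / 2) * L j powr (-1/4)"
        unfolding M_def Rm_def L_def
        by (rule thin_film.rho_time_derivative_bound[OF tf \<phi> \<phi>0 T(1) _ Cm]) (use T(2) in blast)
      also have "\<dots> \<le> c * L j powr (-1/4)"
        unfolding c_def using Rm(2)[of j] Cm0 M1 ab by (intro mult_right_mono mult_left_mono) (auto simp: Kb_def)
      finally show ?thesis .
    qed
    have "(\<lambda>j. L j powr (-1/4)) \<longlonglongrightarrow> 0" by (rule tendsto_neg_powr[OF _ Ltop]) simp
    then have "(\<lambda>j. c * L j powr (-1/4)) \<longlonglongrightarrow> c * 0" by (intro tendsto_intros)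
    then have c0: "(\<lambda>j. c * L j powr (-1/4)) \<longlonglongrightarrow> 0" by simp
    have l: "(\<lambda>N. LBINT q:?Q. g N q * pd (1, 0) \<phi> q) \<longlonglongrightarrow> (LBINT q:?Q. r q * pd (1, 0) \<phi> q)"
      by (rule test_fun_mult_dominated_convergence[OF test_fun_pd[OF \<phi> Bas] gm gb rm sQ lim])
    have "(LBINT q:?Q. r q * pd (1, 0) \<phi> q) \<le> 0 + d" if "0 < d" for d :: real
    proof (rule LIMSEQ_le_const2[OF l])
      have "\<forall>\<^sub>F j in sequentially. c * L j powr (-1/4) < d" using c0 that by (intro order_tendstoD) auto
      then obtain N where N: "\<And>j. N \<le> j \<Longrightarrow> c * L j powr (-1/4) < d" by (auto simp: eventually_sequentially)
      have "(LBINT q:?Q. g m q * pd (1, 0) \<phi> q) \<le> 0 + d" if "N \<le> m" for m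
      proof -
        have "(LBINT q:?Q. f j q * pd (1, 0) \<phi> q) \<le> 0 + d" if "m \<le> j" for j
          using N[of j] \<open>N \<le> m\<close> that fb[of j] by simp
        then show ?thesis by (rule C_time[OF gC \<phi>])
      qed
      then show "\<exists>N. \<forall>m\<ge>N. (LBINT q:?Q. g m q * pd (1, 0) \<phi> q) \<le> 0 + d" by blast
    qed
    then have "(LBINT q:?Q. r q * pd (1, 0) \<phi> q) \<le> 0" by (rule field_le_epsilon)
    then show "0 \<le> - (LBINT q:?Q. r q * pd (1, 0) \<phi> q)" by simp
  qed
qed

end
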